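(* Let $M\ge 2$, let $\sigma_{\mathrm c}^2,\sigma_{\mathrm r}^2>0$, and let $C(\rho)$ be the capacity, under average power $\rho$, of the electro-optic comb phase-noise channel described in the context. Then $$C(\rho)\le (M-1)\log\Big(\frac{\rho}{M-1}\Big)+2\log\pi-h(\boldsymbol\Delta^{\mathrm c},\boldsymbol\Delta^{\mathrm r})+o(1),\qquad\rho\to\infty,$$ where $\boldsymbol\Delta^{\mathrm c}\sim\mathcal{WN}(0,\sigma_{\mathrm c}^2)$ and $\boldsymbol\Delta^{\mathrm r}\sim\mathcal{WN}(0,\sigma_{\mathrm r}^2)$ are independent and $o(1)$ is a function of $\rho$ that vanishes as $\rho\to\infty$.
   Context: Conventions: $\log$ is base 2; $h$ and $I$ denote differential entropy and mutual information (in bits); $j$ is the imaginary unit; $\mathrm{wrap}_\pi(\theta)=((\theta+\pi)\bmod 2\pi)-\pi\in[-\pi,\pi)$ and $\theta\oplus\phi=\mathrm{wrap}_\pi(\theta+\phi)$. $\mathcal{CN}(0,1)$ is the standard circularly symmetric complex Gaussian law; $\mathcal{WN}(0,\sigma^2)$ is the law of $\mathrm{wrap}_\pi(X)$ for $X\sim\mathcal N(0,\sigma^2)$. $\|\cdot\|$ is the Euclidean norm. Channel: for $k=1,2,\dots$ and $m=0,\dots,M-1$, the output is $\mathbf y_{k,m}=e^{j\boldsymbol\theta_{k,m}}\mathbf x_{k,m}+\mathbf w_{k,m}$, where the $\mathbf w_{k,m}$ are i.i.d. $\mathcal{CN}(0,1)$ and $\boldsymbol\theta_{k,m}=\mathrm{wrap}_\pi(\boldsymbol\theta_k^{\mathrm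 c}+m\boldsymbol\theta_k^{\mathrm r})$. The two processes $(\boldsymbol\theta^{\mathrm c}_k)_{k\ge0}$, $(\boldsymbol\theta^{\mathrm r}_k)_{k\ge0}$ are independent of each other; for each of them, $\boldsymbol\theta_0^{\mathrm{c/r}}$ is uniform on $[-\pi,\pi)$ and $\boldsymbol\theta_k^{\mathrm{c/r}}=\boldsymbol\Delta_k^{\mathrm{c/r}}\oplus\boldsymbol\theta_{k-1}^{\mathrm{c/r}}$ for $k\ge1$, where the $\boldsymbol\Delta_k^{\mathrm{c/r}}$ are i.i.d. $\mathcal{WN}(0,\sigma_{\mathrm{c/r}}^2)$, independent of $\boldsymbol\theta_0^{\mathrm{c/r}}$. Inputs, phase noises and additive noise are independent. Capacity: with $\underline{\mathbf x}_k=(\mathbf x_{k,0},\dots,\mathbf x_{k,M-1})\in\mathbb C^M$ and similarly $\underline{\mathbf y}_k$, $C(\rho)=\lim_{n\to\infty}\frac1n\sup I(\underline{\mathbf x}_1,\dots,\underline{\mathbf x}_n;\underline{\mathbf y}_1,\dots,\underline{\mathbf y}_n)$, the supremum being over all laws of $(\underline{\mathbf x}_1,\dots,\underline{\mathbf x}_n)$ with $\sum_{k=1}^n\mathbb E[\|\underline{\mathbf x}_k\|^2]\le n\rho$. *)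

theory Defs
  imports "HOL-Probability.Probability" "HOL-Library.Real_Mod"
begin

definition wrap_pi :: "real \<Rightarrow> real" where
  "wrap_pi \<theta> = (\<theta> + pi) rmod (2 * pi) - pi"

(* The parameter is the standard deviation sigma of the unwrapped Gaussian, not its variance. *)
definition wrapped_normal :: "real \<Rightarrow> real measure" where
  "wrapped_normal \<sigma> = distr (density lborel (\<lambda>x. ennreal (normal_density 0 \<sigma> x))) borel wrap_pi"

(* Independent real and imaginary parts, each of variance 1/2, so that E|w|^2 = 1. *)
definition std_complex_normal :: "complex measure" where
  "std_complex_normal =
     (let N = density lborel (\<lambda>x. ennreal (normal_density 0 (sqrt (1 / 2)) x))
      in distr (N \<Otimes>\<^sub>M N) borel (\<lambda>(a, b). Complex a b))"

definition uniform_phase :: "real measure" where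
  "uniform_phase = uniform_measure lborel {-pi..<pi}"

(* Phase process driven by an initial phase and the increments d 1, d 2, ... *)
primrec phase :: "real \<times> (nat \<Rightarrow> real) \<Rightarrow> nat \<Rightarrow> real" where
  "phase s 0 = fst s"
| "phase s (Suc k) = wrap_pi (snd s (Suc k) + phase s k)"

definition phase_source :: "real \<Rightarrow> (real \<times> (nat \<Rightarrow> real)) measure" where
  "phase_source \<sigma> = uniform_phase \<Otimes>\<^sub>M PiM {1..} (\<lambda>_. wrapped_normal \<sigma>)"

definition additive_noise :: "nat \<Rightarrow> (nat \<Rightarrow> nat \<Rightarrow> complex) measure" where
  "additive_noise M = PiM {1..} (\<lambda>_. PiM {..<M} (\<lambda>_. std_complex_normal))"

type_synonym noise_sample =
  "(real \<times> (nat \<Rightarrow> real)) \<times> (real \<times> (nat \<Rightarrow> real)) \<times> (nat \<Rightarrow> nat \<Rightarrow> complex)"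

(* The product measure encodes the mutual independence of the two phase processes and the
   additive noise. *)
definition channel_noise :: "nat \<Rightarrow> real \<Rightarrow> real \<Rightarrow> noise_sample measure" where
  "channel_noise M \<sigma>c \<sigma>r = phase_source \<sigma>c \<Otimes>\<^sub>M phase_source \<sigma>r \<Otimes>\<^sub>M additive_noise M"

(* Sequences of n blocks from C^M: block k in {1..n}, coordinate m in {..<M}. *)
definition block_space :: "nat \<Rightarrow> nat \<Rightarrow> (nat \<Rightarrow> nat \<Rightarrow> complex) measure" where
  "block_space M n = PiM {1..n} (\<lambda>_. PiM {..<M} (\<lambda>_. borel))"

definition channel_output ::
    "nat \<Rightarrow> nat \<Rightarrow> (nat \<Rightarrow> nat \<Rightarrow> complex) \<times> noise_sample \<Rightarrow> nat \<Rightarrow> nat \<Rightarrow> complex" where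
  "channel_output M n = (\<lambda>(x, sc, sr, w). \<lambda>k\<in>{1..n}. \<lambda>m\<in>{..<M}.
     cis (wrap_pi (phase sc k + real m * phase sr k)) * x k m + w k m)"

definition admissible_inputs ::
    "nat \<Rightarrow> nat \<Rightarrow> real \<Rightarrow> (nat \<Rightarrow> nat \<Rightarrow> complex) measure set" where
  "admissible_inputs M n \<rho> = {P. prob_space P \<and> sets P = sets (block_space M n) \<and>
     (\<Sum>k=1..n. \<integral>\<^sup>+x. ennreal ((L2_set (\<lambda>m. cmod (x k m)) {..<M})\<^sup>2) \<partial>P) \<le> ennreal (real n * \<rho>)}"

(* Input law and channel noise are independent by construction.  The library's real-valued
   mutual information takes a junk value when the true one is infinite or when the joint law is
   not absolutely continuous; for admissible inputs neither can happen, because the Gaussian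
   noise has a density and the power is finite. *)
definition block_information ::
    "nat \<Rightarrow> real \<Rightarrow> real \<Rightarrow> nat \<Rightarrow> (nat \<Rightarrow> nat \<Rightarrow> complex) measure \<Rightarrow> real" where
  "block_information M \<sigma>c \<sigma>r n P =
     prob_space.mutual_information (P \<Otimes>\<^sub>M channel_noise M \<sigma>c \<sigma>r) 2
       (block_space M n) (block_space M n) fst (channel_output M n)"

definition capacity :: "nat \<Rightarrow> real \<Rightarrow> real \<Rightarrow> real \<Rightarrow> ereal" where
  "capacity M \<sigma>c \<sigma>r \<rho> =
     lim (\<lambda>n. (SUP P \<in> admissible_inputs M n \<rho>. ereal (block_information M \<sigma>c \<sigma>r n P)) / ereal (real n))"

lemma wrap_pi_measurable [measurable]: "wrap_pi \<in> borel_measurable borel"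
  unfolding wrap_pi_def rmod_def by measurable

lemma prob_space_wrapped_normal: "0 < \<sigma> \<Longrightarrow> prob_space (wrapped_normal \<sigma>)"
  unfolding wrapped_normal_def
  by (intro prob_space.prob_space_distr prob_space_normal_density) auto

lemma phase_measurable:
  "(\<lambda>s. phase s k) \<in> borel_measurable (borel \<Otimes>\<^sub>M PiM {1..} (\<lambda>_. borel))"
proof (induction k)
  case (Suc k)
  note Suc.IH [measurable]
  show ?case unfolding phase.simps by measurable
qed simp

lemma sets_phase_source:
  "sets (phase_source \<sigma>) = sets (borel \<Otimes>\<^sub>M PiM {1..} (\<lambda>_. borel))"
  unfolding phase_source_def uniform_phase_def wrapped_normal_def
  by (intro sets_pair_measure_cong sets_PiM_cong) auto

lemma sets_additive_noise:
  "sets (additive_noise M) = sets (PiM {1..} (\<lambda>_. PiM {..<M} (\<lambda>_. borel)))"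
  unfolding additive_noise_def std_complex_normal_def Let_def
  by (intro sets_PiM_cong) auto

lemma channel_output_measurable:
  assumes "sets P = sets (block_space M n)"
  shows "channel_output M n \<in> measurable (P \<Otimes>\<^sub>M channel_noise M \<sigma>c \<sigma>r) (block_space M n)"
proof -
  let ?S = "borel \<Otimes>\<^sub>M PiM {1..} (\<lambda>_. borel) :: (real \<times> (nat \<Rightarrow> real)) measure"
  let ?W = "PiM {1..} (\<lambda>_. PiM {..<M} (\<lambda>_. borel)) :: (nat \<Rightarrow> nat \<Rightarrow> complex) measure"
  note phase_measurable [measurable]
  have s: "sets (P \<Otimes>\<^sub>M channel_noise M \<sigma>c \<sigma>r) = sets (block_space M n \<Otimes>\<^sub>M ?S \<Otimes>\<^sub>M ?S \<Otimes>\<^sub>M ?W)"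
    unfolding channel_noise_def
    by (intro sets_pair_measure_cong assms sets_phase_source sets_additive_noise)
  have "channel_output M n \<in> measurable (block_space M n \<Otimes>\<^sub>M ?S \<Otimes>\<^sub>M ?S \<Otimes>\<^sub>M ?W) (block_space M n)"
    unfolding block_space_def channel_output_def case_prod_beta
  proof (intro measurable_restrict)
    fix k m assume k: "k \<in> {1..n}" and m: "m \<in> {..<M}"
    have coord: "(\<lambda>x. x k m) \<in> borel_measurable (PiM I (\<lambda>_. PiM {..<M} (\<lambda>_. borel :: complex measure)))"
      if "k \<in> I" for I
      by (rule measurable_compose[where g = "\<lambda>y. y m" and N = "PiM {..<M} (\<lambda>_. borel)"])
        (use that m in \<open>auto intro: measurable_component_singleton\<close>)
    have [measurable]: "(\<lambda>x. x k m) \<in> borel_measurable (PiM {1..n} (\<lambda>_. PiM {..<M} (\<lambda>_. borel :: complex measure)))"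
      "(\<lambda>x. x k m) \<in> borel_measurable ?W"
      using k by (auto intro!: coord)
    show "(\<lambda>x. cis (wrap_pi (phase (fst (snd x)) k + real m * phase (fst (snd (snd x))) k)) *
            fst x k m + snd (snd (snd x)) k m)
      \<in> borel_measurable (PiM {1..n} (\<lambda>_. PiM {..<M} (\<lambda>_. borel)) \<Otimes>\<^sub>M ?S \<Otimes>\<^sub>M ?S \<Otimes>\<^sub>M ?W)"
      unfolding cis_conv_exp by measurable
  qed
  then show ?thesis
    using measurable_cong_sets[OF s refl] by blast
qed

lemma prob_space_std_complex_normal: "prob_space std_complex_normal"
proof -
  have N: "prob_space (density lborel (\<lambda>x. ennreal (normal_density 0 (sqrt (1 / 2)) x)))"
    by (intro prob_space_normal_density) auto
  show ?thesis
    unfolding std_complex_normal_def Let_def case_prod_beta Complex_eq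
    by (intro prob_space.prob_space_distr prob_space_pair N) measurable
qed

lemma prob_space_channel_noise:
  assumes "0 < \<sigma>c" "0 < \<sigma>r"
  shows "prob_space (channel_noise M \<sigma>c \<sigma>r)"
proof -
  have u: "prob_space uniform_phase"
    unfolding uniform_phase_def by (intro prob_space_uniform_measure) auto
  have p: "prob_space (phase_source \<sigma>)" if "0 < \<sigma>" for \<sigma>
    unfolding phase_source_def
    by (intro prob_space_pair u prob_space_PiM prob_space_wrapped_normal that)
  have "prob_space (additive_noise M)"
    unfolding additive_noise_def by (intro prob_space_PiM prob_space_std_complex_normal)
  then show ?thesis
    unfolding channel_noise_def by (intro prob_space_pair p assms)
qed

end

theory Submission
  imports Defs
begin

text \<open>Let \<open>\<theta>\<^sub>k\<close> be the pair of phases of block \<open>k\<close>.  For a reference output density \<open>q\<close> and a reference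
  conditional density \<open>r\<close> of the phases given input and output, the law of
  \<open>(x, y, \<theta>\<^sub>1, \<dots>, \<theta>\<^sub>n)\<close> has, relative to \<open>P\<^sub>x \<Otimes> q\<^sup>n \<Otimes> r\<^sup>n\<close>, the density
  \<open>\<Prod> f(\<Delta>\<^sub>k) g(w\<^sub>k) / (q(y\<^sub>k) r(\<theta>\<^sub>k | x\<^sub>k, y\<^sub>k))\<close>, where \<open>f\<close> is the density of the phase increments and \<open>g\<close> that
  of the additive noise.  By monotonicity of relative entropy the information is at most the
  expectation of the logarithm of this product, a sum over the blocks that needs no chain rule.
  The output density \<open>q\<close> behaves like \<open>exp (- |z|\<^sup>2 / \<tau>) / |z|\<close> in the coordinates \<open>0\<close> and \<open>1\<close>, which
  determine the two phases, and is Gaussian in the others, with \<open>\<tau> = \<rho> / (M - 1)\<close>; raising \<open>q\<close> near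
  the origin penalises small inputs at a cost that vanishes as \<open>\<rho> \<rightarrow> \<infinity>\<close>.

  The limit in the definition of the capacity exists by Fekete's lemma: independent inputs on
  consecutive stretches of blocks, together with the stationarity of the phases, make the optimal
  information superadditive.\<close>

section \<open>Relative entropy bounds\<close>

text \<open>The factor \<open>1 / |z|\<close> makes the bound blind to the law of the input moduli:
  at output modulus \<open>s\<close> the normaliser of the phase posterior is close to
  \<open>sqrt pi / s\<close>, the two factors cancel, and the input enters through its power only.
  In nats and up to small errors, a coordinate that reveals a phase costs
  \<open>ln pi + ln \<tau> / 2 - 1 / 2\<close>, where \<open>- 1 / 2\<close> is the noise energy
  \<open>- 1\<close> plus the variance \<open>1 / 2\<close> of the noise component orthogonal to the
  input; any other coordinate costs \<open>ln \<tau> - 1\<close>, and the power adds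
  \<open>\<rho> / \<tau>\<close>. The total
  \<open>2 * ln pi + (M - 1) * (ln \<tau> - 1) + \<rho> / \<tau>\<close> is least at
  \<open>\<tau> = \<rho> / (M - 1)\<close>. The entropy enters as the mean of \<open>- ln f\<close>.
  The obstacle is an input comparable with the noise: its phase error is not a small angle and costs
  an amount of order one. The raised density near the origin returns more than that for every input
  of bounded modulus, while larger inputs rarely meet such noise. All parameters of this trade
  depend on the tolerance \<open>e\<close> alone, which is sent to 0 after \<open>\<rho>\<close> has
  grown.\<close>

lemma AE_RN_deriv_pos_finite:
  assumes "prob_space \<mu>" "prob_space \<nu>" and sets: "sets \<nu> = sets \<mu>"
    and ac: "absolutely_continuous \<mu> \<nu>"
  shows "AE z in \<nu>. 0 < RN_deriv \<mu> \<nu> z \<and> RN_deriv \<mu> \<nu> z < \<infinity>"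
proof -
  interpret m: prob_space \<mu> by fact
  interpret n: prob_space \<nu> by fact
  have d: "density \<mu> (RN_deriv \<mu> \<nu>) = \<nu>"
    using m.density_RN_deriv[OF ac] sets by simp
  have fin: "AE z in \<mu>. RN_deriv \<mu> \<nu> z \<noteq> \<infinity>"
    using m.RN_deriv_finite[OF n.sigma_finite_measure_axioms ac] sets by simp
  have "AE z in density \<mu> (RN_deriv \<mu> \<nu>). 0 < RN_deriv \<mu> \<nu> z \<and> RN_deriv \<mu> \<nu> z < \<infinity>"
    using fin by (subst AE_density) (auto simp: less_top)
  then show ?thesis unfolding d .
qed

text \<open>Only an inequality, because \<open>\<mu>\<close> may charge the set where the derivative
  vanishes; what \<open>G\<close> contributes there is lost on the left.\<close>

lemma nn_integral_divide_RN_deriv_le: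
  assumes "prob_space \<mu>" "prob_space \<nu>" and sets: "sets \<nu> = sets \<mu>"
    and ac: "absolutely_continuous \<mu> \<nu>" and G[measurable]: "G \<in> borel_measurable \<mu>"
  shows "(\<integral>\<^sup>+z. G z / RN_deriv \<mu> \<nu> z \<partial>\<nu>) \<le> (\<integral>\<^sup>+z. G z \<partial>\<mu>)"
proof -
  interpret m: prob_space \<mu> by fact
  interpret n: prob_space \<nu> by fact
  have d: "density \<mu> (RN_deriv \<mu> \<nu>) = \<nu>"
    using m.density_RN_deriv[OF ac] sets by simp
  have fin: "AE z in \<mu>. RN_deriv \<mu> \<nu> z \<noteq> \<infinity>"
    using m.RN_deriv_finite[OF n.sigma_finite_measure_axioms ac] sets by simp
  have "(\<integral>\<^sup>+z. G z / RN_deriv \<mu> \<nu> z \<partial>\<nu>) = (\<integral>\<^sup>+z. G z / RN_deriv \<mu> \<nu> z \<partial>density \<mu> (RN_deriv \<mu> \<nu>))"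
    unfolding d ..
  also have "\<dots> = (\<integral>\<^sup>+z. RN_deriv \<mu> \<nu> z * (G z / RN_deriv \<mu> \<nu> z) \<partial>\<mu>)"
    by (rule nn_integral_density) measurable
  also have "\<dots> \<le> (\<integral>\<^sup>+z. G z \<partial>\<mu>)"
  proof (rule nn_integral_mono_AE, use fin in eventually_elim)
    fix z assume "RN_deriv \<mu> \<nu> z \<noteq> \<infinity>"
    then show "RN_deriv \<mu> \<nu> z * (G z / RN_deriv \<mu> \<nu> z) \<le> G z"
      by (cases "RN_deriv \<mu> \<nu> z = 0")
        (auto simp: ennreal_times_divide mult.commute[of "RN_deriv \<mu> \<nu> z"] ennreal_mult_divide_eq)
  qed
  finally show ?thesis .
qed

lemma integrable_if_nn_integral_finite_nonneg:
  fixes f :: "'a \<Rightarrow> real"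
  assumes "f \<in> borel_measurable M" "(\<integral>\<^sup>+x. ennreal (f x) \<partial>M) < \<infinity>" "\<And>x. 0 \<le> f x"
  shows "integrable M f"
  using assms by (intro integrableI_nonneg) auto

lemma enn2real_div_pos:
  assumes "0 < r" "r < \<infinity>"
  shows "ennreal (1 / enn2real r) = 1 / r"
proof -
  obtain s where s: "r = ennreal s" "0 \<le> s" using assms by (cases r) auto
  with assms have "0 < s" by auto
  with s show ?thesis by (simp add: divide_ennreal[symmetric] flip: ennreal_1)
qed

text \<open>The inequality \<open>ln t \<le> t - 1\<close> at \<open>t = \<rho> * exp (- U)\<close>,
  with \<open>\<rho>\<close> the derivative, integrated over \<open>\<Omega>\<close>. The function
  \<open>U\<close> lives on the sample space, which carries more randomness than the pair
  distributed as \<open>\<nu>\<close> (in the application, the phases). Monotonicity of relative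
  entropy under marginalisation is thereby built in, and no marginal density has to be formed.
  Integrability is part of the conclusion, since otherwise the integral could be the default value
  0.\<close>

lemma KL_upper:
  assumes "prob_space \<mu>" "prob_space \<nu>" and sets: "sets \<nu> = sets \<mu>"
    and ac: "absolutely_continuous \<mu> \<nu>"
    and T: "T \<in> measurable \<Omega> \<nu>" and distr: "distr \<Omega> \<nu> T = \<nu>"
    and U: "integrable \<Omega> U"
    and le: "(\<integral>\<^sup>+\<omega>. RN_deriv \<mu> \<nu> (T \<omega>) * ennreal (exp (- U \<omega>)) \<partial>\<Omega>) \<le> 1"
    and \<Omega>: "prob_space \<Omega>"
  shows "integrable \<nu> (\<lambda>z. ln (enn2real (RN_deriv \<mu> \<nu> z)))"
    and "(\<integral>z. ln (enn2real (RN_deriv \<mu> \<nu> z)) \<partial>\<nu>) \<le> (\<integral>\<omega>. U \<omega> \<partial>\<Omega>)"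
proof -
  interpret O: prob_space \<Omega> by fact
  interpret n: prob_space \<nu> by fact
  interpret m: prob_space \<mu> by fact
  let ?R = "\<lambda>z. enn2real (RN_deriv \<mu> \<nu> z)"
  note T[measurable]
  have [measurable]: "RN_deriv \<mu> \<nu> \<in> borel_measurable \<nu>"
    using borel_measurable_RN_deriv[of \<mu> \<nu>] measurable_cong_sets[OF sets refl] by blast
  have [measurable]: "U \<in> borel_measurable \<Omega>" using U by auto
  have pos: "AE z in \<nu>. 0 < RN_deriv \<mu> \<nu> z \<and> RN_deriv \<mu> \<nu> z < \<infinity>"
    by (rule AE_RN_deriv_pos_finite) fact+
  have posT: "AE \<omega> in \<Omega>. 0 < RN_deriv \<mu> \<nu> (T \<omega>) \<and> RN_deriv \<mu> \<nu> (T \<omega>) < \<infinity>"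
    by (rule AE_distrD[OF T], unfold distr) (rule pos)
  have V: "integrable \<Omega> (\<lambda>\<omega>. ?R (T \<omega>) * exp (- U \<omega>))" (is "integrable _ ?V")
    and V1: "(\<integral>\<omega>. ?R (T \<omega>) * exp (- U \<omega>) \<partial>\<Omega>) \<le> 1"
  proof -
    have "(\<integral>\<^sup>+\<omega>. ennreal (?V \<omega>) \<partial>\<Omega>) = (\<integral>\<^sup>+\<omega>. RN_deriv \<mu> \<nu> (T \<omega>) * ennreal (exp (- U \<omega>)) \<partial>\<Omega>)"
      by (rule nn_integral_cong_AE, use posT in eventually_elim) (simp add: ennreal_mult'')
    then have nn: "(\<integral>\<^sup>+\<omega>. ennreal (?V \<omega>) \<partial>\<Omega>) \<le> 1" using le by simp
    show *: "integrable \<Omega> ?V"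
      by (rule integrable_if_nn_integral_finite_nonneg)
        (use nn in \<open>auto simp: le_less_trans[OF nn]\<close>)
    have "ennreal (\<integral>\<omega>. ?V \<omega> \<partial>\<Omega>) = (\<integral>\<^sup>+\<omega>. ennreal (?V \<omega>) \<partial>\<Omega>)"
      by (rule nn_integral_eq_integral[symmetric, OF *]) auto
    with nn show "(\<integral>\<omega>. ?V \<omega> \<partial>\<Omega>) \<le> 1"
      by (metis ennreal_1 ennreal_le_iff zero_le_one)
  qed
  \<comment> \<open>The reciprocal of the derivative has \<open>\<nu>\<close>-mean at most 1.
    Through \<open>- ln r \<le> 1 / r\<close> it controls the negative part of the logarithm, which
    \<open>U\<close> does not see.\<close>
  have I: "integrable \<nu> (\<lambda>z. 1 / ?R z)"
  proof (rule integrable_if_nn_integral_finite_nonneg)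
    have "(\<integral>\<^sup>+z. ennreal (1 / ?R z) \<partial>\<nu>) = (\<integral>\<^sup>+z. 1 / RN_deriv \<mu> \<nu> z \<partial>\<nu>)"
      by (rule nn_integral_cong_AE, use pos in eventually_elim) (simp add: enn2real_div_pos)
    also have "\<dots> \<le> (\<integral>\<^sup>+z. 1 \<partial>\<mu>)"
      by (rule nn_integral_divide_RN_deriv_le) (fact | simp)+
    also have "\<dots> < \<infinity>" by (simp add: m.emeasure_space_1)
    finally show "(\<integral>\<^sup>+z. ennreal (1 / ?R z) \<partial>\<nu>) < \<infinity>" .
  qed auto
  have IT: "integrable \<Omega> (\<lambda>\<omega>. 1 / ?R (T \<omega>))"
    using I integrable_distr_eq[OF T, of "\<lambda>z. 1 / ?R z"] by (simp add: distr)
  have up: "AE \<omega> in \<Omega>. ln (?R (T \<omega>)) \<le> U \<omega> + ?V \<omega> - 1"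
    using posT
  proof eventually_elim
    case (elim \<omega>)
    then have p: "0 < ?R (T \<omega>)" by (simp add: enn2real_positive_iff)
    have "ln (?V \<omega>) \<le> ?V \<omega> - 1" using p by (intro ln_le_minus_one) auto
    moreover have "ln (?V \<omega>) = ln (?R (T \<omega>)) - U \<omega>" using p by (simp add: ln_mult)
    ultimately show ?case by simp
  qed
  have lo: "AE \<omega> in \<Omega>. - ln (?R (T \<omega>)) \<le> 1 / ?R (T \<omega>)"
    using posT
  proof eventually_elim
    case (elim \<omega>)
    then have p: "0 < ?R (T \<omega>)" by (simp add: enn2real_positive_iff)
    have "ln (1 / ?R (T \<omega>)) \<le> 1 / ?R (T \<omega>) - 1" using p by (intro ln_le_minus_one) auto
    then show ?case using p by (simp add: ln_div)
  qed
  have int: "integrable \<Omega> (\<lambda>\<omega>. ln (?R (T \<omega>)))"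
  proof (rule Bochner_Integration.integrable_bound)
    show "integrable \<Omega> (\<lambda>\<omega>. \<bar>U \<omega>\<bar> + ?V \<omega> + 1 / ?R (T \<omega>))"
      using U V IT by auto
    show "AE \<omega> in \<Omega>. norm (ln (?R (T \<omega>))) \<le> norm (\<bar>U \<omega>\<bar> + ?V \<omega> + 1 / ?R (T \<omega>))"
      using up lo
    proof eventually_elim
      case (elim \<omega>)
      have "0 \<le> ?V \<omega>" "0 \<le> 1 / ?R (T \<omega>)" by auto
      with elim show ?case unfolding real_norm_def by linarith
    qed
  qed measurable
  then show "integrable \<nu> (\<lambda>z. ln (?R z))"
    using integrable_distr_eq[OF T, of "\<lambda>z. ln (?R z)"] by (simp add: distr)
  have "(\<integral>z. ln (?R z) \<partial>\<nu>) = (\<integral>\<omega>. ln (?R (T \<omega>)) \<partial>\<Omega>)"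
    using integral_distr[OF T, of "\<lambda>z. ln (?R z)"] by (simp add: distr)
  also have "\<dots> \<le> (\<integral>\<omega>. U \<omega> + ?V \<omega> - 1 \<partial>\<Omega>)"
    using U V int up by (intro integral_mono_AE) auto
  also have "\<dots> = (\<integral>\<omega>. U \<omega> \<partial>\<Omega>) + (\<integral>\<omega>. ?V \<omega> \<partial>\<Omega>) - 1"
    using U V by (simp add: O.prob_space)
  finally show "(\<integral>z. ln (?R z) \<partial>\<nu>) \<le> (\<integral>\<omega>. U \<omega> \<partial>\<Omega>)" using V1 by simp
qed

text \<open>The Gibbs variational principle from below: \<open>G\<close> is a subprobability density
  with respect to \<open>\<mu>\<close>, and the mean of \<open>ln (G / \<rho>)\<close> under
  \<open>\<nu>\<close> is at most that of \<open>G / \<rho> - 1\<close>, hence not positive. With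
  \<open>G = 1\<close> it shows that the information is nonnegative; with a product of two
  derivatives it gives superadditivity.\<close>

lemma KL_lower:
  assumes "prob_space \<mu>" "prob_space \<nu>" and sets: "sets \<nu> = sets \<mu>"
    and ac: "absolutely_continuous \<mu> \<nu>"
    and int: "integrable \<nu> (\<lambda>z. ln (enn2real (RN_deriv \<mu> \<nu> z)))"
    and G[measurable]: "G \<in> borel_measurable \<mu>" and G1: "(\<integral>\<^sup>+z. G z \<partial>\<mu>) \<le> 1"
    and Gpos: "AE z in \<nu>. 0 < G z \<and> G z < \<infinity>"
    and intG: "integrable \<nu> (\<lambda>z. ln (enn2real (G z)))"
  shows "(\<integral>z. ln (enn2real (G z)) \<partial>\<nu>) \<le> (\<integral>z. ln (enn2real (RN_deriv \<mu> \<nu> z)) \<partial>\<nu>)"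
proof -
  interpret n: prob_space \<nu> by fact
  let ?R = "\<lambda>z. enn2real (RN_deriv \<mu> \<nu> z)"
  let ?V = "\<lambda>z. enn2real (G z) / ?R z"
  have [measurable]: "RN_deriv \<mu> \<nu> \<in> borel_measurable \<nu>" "G \<in> borel_measurable \<nu>"
    using borel_measurable_RN_deriv[of \<mu> \<nu>] G measurable_cong_sets[OF sets refl] by blast+
  have pos: "AE z in \<nu>. 0 < RN_deriv \<mu> \<nu> z \<and> RN_deriv \<mu> \<nu> z < \<infinity>"
    by (rule AE_RN_deriv_pos_finite) fact+
  have "(\<integral>\<^sup>+z. ennreal (?V z) \<partial>\<nu>) = (\<integral>\<^sup>+z. G z / RN_deriv \<mu> \<nu> z \<partial>\<nu>)"
  proof (rule nn_integral_cong_AE, use pos Gpos in eventually_elim)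
    case (elim z)
    then have "0 < ?R z" by (simp add: enn2real_positive_iff)
    with elim show ?case by (simp add: divide_ennreal[symmetric])
  qed
  also have "\<dots> \<le> (\<integral>\<^sup>+z. G z \<partial>\<mu>)"
    by (rule nn_integral_divide_RN_deriv_le) (fact | simp)+
  finally have nn: "(\<integral>\<^sup>+z. ennreal (?V z) \<partial>\<nu>) \<le> 1" using G1 by simp
  have V: "integrable \<nu> ?V"
    by (rule integrable_if_nn_integral_finite_nonneg) (auto simp: le_less_trans[OF nn])
  have "ennreal (\<integral>z. ?V z \<partial>\<nu>) = (\<integral>\<^sup>+z. ennreal (?V z) \<partial>\<nu>)"
    by (rule nn_integral_eq_integral[symmetric, OF V]) auto
  with nn have V1: "(\<integral>z. ?V z \<partial>\<nu>) \<le> 1"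
    by (metis ennreal_1 ennreal_le_iff zero_le_one)
  have up: "AE z in \<nu>. ln (enn2real (G z)) \<le> ln (?R z) + ?V z - 1"
    using pos Gpos
  proof eventually_elim
    case (elim z)
    then have p: "0 < ?R z" "0 < enn2real (G z)" by (auto simp: enn2real_positive_iff)
    then have "ln (?V z) \<le> ?V z - 1" by (intro ln_le_minus_one) auto
    with p show ?case by (simp add: ln_div)
  qed
  have "(\<integral>z. ln (enn2real (G z)) \<partial>\<nu>) \<le> (\<integral>z. ln (?R z) + ?V z - 1 \<partial>\<nu>)"
    using int intG V up by (intro integral_mono_AE) auto
  also have "\<dots> = (\<integral>z. ln (?R z) \<partial>\<nu>) + (\<integral>z. ?V z \<partial>\<nu>) - 1"
    using int V by (simp add: n.prob_space)
  finally show ?thesis using V1 by simp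
qed

lemma measure_eqI_nn_integral:
  assumes "sets M = sets N"
    and "\<And>f :: 'a \<Rightarrow> ennreal. f \<in> borel_measurable M \<Longrightarrow> (\<integral>\<^sup>+x. f x \<partial>M) = (\<integral>\<^sup>+x. f x \<partial>N)"
  shows "M = N"
proof (rule measure_eqI[OF assms(1)])
  fix E assume E: "E \<in> sets M"
  then show "emeasure M E = emeasure N E"
    using assms(2)[of "indicator E"] by (simp add: nn_integral_indicator flip: assms(1))
qed

lemma distr_pair_snd:
  assumes "prob_space A" "sigma_finite_measure B"
  shows "distr (A \<Otimes>\<^sub>M B) B snd = B"
proof (rule measure_eqI_nn_integral)
  interpret A: prob_space A by fact
  interpret B: sigma_finite_measure B by fact
  fix f :: "_ \<Rightarrow> ennreal" assume "f \<in> borel_measurable (distr (A \<Otimes>\<^sub>M B) B snd)"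
  then have [measurable]: "f \<in> borel_measurable B" by simp
  show "(\<integral>\<^sup>+x. f x \<partial>distr (A \<Otimes>\<^sub>M B) B snd) = (\<integral>\<^sup>+x. f x \<partial>B)"
    by (simp add: nn_integral_distr B.nn_integral_fst[symmetric] A.emeasure_space_1)
qed simp

section \<open>The wrapped normal law on the circle\<close>

lemma wrap_pi_eq: "wrap_pi x = x - 2 * pi * of_int \<lfloor>(x + pi) / (2 * pi)\<rfloor>"
  unfolding wrap_pi_def rmod_def by simp

lemma wrap_pi_range: "wrap_pi x \<in> {-pi..<pi}"
proof -
  have "of_int \<lfloor>(x + pi) / (2 * pi)\<rfloor> \<le> (x + pi) / (2 * pi)"
    "(x + pi) / (2 * pi) < of_int \<lfloor>(x + pi) / (2 * pi)\<rfloor> + 1" by linarith+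
  then have "of_int \<lfloor>(x + pi) / (2 * pi)\<rfloor> * (2 * pi) \<le> x + pi"
    "x + pi < (of_int \<lfloor>(x + pi) / (2 * pi)\<rfloor> + 1) * (2 * pi)"
    by (simp_all only: pos_le_divide_eq pos_divide_less_eq pi_gt_zero zero_less_mult_iff zero_less_numeral simp_thms)
  then show ?thesis unfolding wrap_pi_eq by (auto simp: algebra_simps)
qed

lemma wrap_pi_add_int: "wrap_pi (x + 2 * pi * of_int k) = wrap_pi x"
proof -
  have "(x + 2 * pi * of_int k + pi) / (2 * pi) = (x + pi) / (2 * pi) + of_int k"
    by (simp add: field_simps)
  then show ?thesis unfolding wrap_pi_eq by (simp add: algebra_simps)
qed

lemma wrap_pi_id: "x \<in> {-pi..<pi} \<Longrightarrow> wrap_pi x = x"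
proof -
  assume "x \<in> {-pi..<pi}"
  then have "\<lfloor>(x + pi) / (2 * pi)\<rfloor> = 0" by (auto simp: floor_eq_iff field_simps)
  then show ?thesis unfolding wrap_pi_eq by simp
qed

lemma wrap_pi_obtain: obtains k :: int where "wrap_pi x = x + 2 * pi * of_int k"
proof
  show "wrap_pi x = x + 2 * pi * of_int (- \<lfloor>(x + pi) / (2 * pi)\<rfloor>)"
    unfolding wrap_pi_eq by simp
qed

lemma cis_wrap_pi [simp]: "cis (wrap_pi x) = cis x"
proof -
  obtain k :: int where "wrap_pi x = x + 2 * pi * of_int k" by (rule wrap_pi_obtain)
  then show ?thesis by (simp flip: cis_mult add: cis_multiple_2pi)
qed

lemma ex1_translate_circle_lborel: "\<exists>!k::int. x + 2 * pi * of_int k \<in> {-pi..<pi}"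
proof
  show "x + 2 * pi * of_int (- \<lfloor>(x + pi) / (2 * pi)\<rfloor>) \<in> {-pi..<pi}"
    using wrap_pi_range[of x] unfolding wrap_pi_eq by simp
  fix k :: int assume k: "x + 2 * pi * of_int k \<in> {-pi..<pi}"
  have "x + 2 * pi * of_int k = wrap_pi (x + 2 * pi * of_int k)"
    using k by (simp add: wrap_pi_id)
  also have "\<dots> = wrap_pi x" by (rule wrap_pi_add_int)
  also have "\<dots> = x + 2 * pi * of_int (- \<lfloor>(x + pi) / (2 * pi)\<rfloor>)" unfolding wrap_pi_eq by simp
  finally have "2 * pi * of_int k = 2 * pi * of_int (- \<lfloor>(x + pi) / (2 * pi)\<rfloor>)" by linarith
  then show "k = - \<lfloor>(x + pi) / (2 * pi)\<rfloor>"
    by (metis mult_cancel_left of_int_eq_iff pi_neq_zero mult_eq_0_iff zero_neq_numeral)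
qed

text \<open>Enumerates the integers by \<open>nat\<close>, so that sums over the period lattice
  become series that commute with the nonnegative integral.\<close>

abbreviation zdec :: "nat \<Rightarrow> real" where "zdec i \<equiv> of_int (int_decode i)"

lemma suminf_indicator_unique:
  assumes "\<exists>!k::int. P k"
  shows "(\<Sum>i. indicator {i. P (int_decode i)} i :: ennreal) = 1"
proof -
  obtain k where k: "P k" "\<And>l. P l \<Longrightarrow> l = k" using assms by blast
  have eq: "{i. P (int_decode i)} = {int_encode k}"
  proof (rule set_eqI)
    fix i show "i \<in> {i. P (int_decode i)} \<longleftrightarrow> i \<in> {int_encode k}"
      unfolding mem_Collect_eq singleton_iff using k by (metis int_decode_inverse int_encode_inverse)
  qed
  have "(\<lambda>i. indicator {int_encode k} i :: ennreal) = (\<lambda>i. if i = int_encode k then 1 else 0)"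
    by (simp add: indicator_def fun_eq_iff)
  moreover have "(\<lambda>i. if i = int_encode k then 1 else 0) sums (1::ennreal)"
    by (rule sums_single)
  ultimately show ?thesis unfolding eq by (metis sums_unique)
qed

lemma suminf_translate_circle_lborel:
  "(\<Sum>i. indicator {-pi..<pi} (x + 2 * pi * zdec i) :: ennreal) = 1"
  "(\<Sum>i. indicator {-pi..<pi} (x - 2 * pi * zdec i) :: ennreal) = 1"
proof -
  show "(\<Sum>i. indicator {-pi..<pi} (x + 2 * pi * zdec i) :: ennreal) = 1"
    using suminf_indicator_unique[OF ex1_translate_circle_lborel[of x]] by (simp add: indicator_def)
  have "\<exists>!k::int. x - 2 * pi * of_int k \<in> {-pi..<pi}"
    using ex1_translate_circle_lborel[of x] by (metis (no_types) of_int_minus minus_minus mult_minus_right diff_conv_add_uminus)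
  from suminf_indicator_unique[OF this]
  show "(\<Sum>i. indicator {-pi..<pi} (x - 2 * pi * zdec i) :: ennreal) = 1"
    by (simp add: indicator_def)
qed

lemma nn_integral_lborel_translate:
  fixes G :: "'a::euclidean_space \<Rightarrow> ennreal"
  assumes [measurable]: "G \<in> borel_measurable borel"
  shows "(\<integral>\<^sup>+x. G (x + c) \<partial>lborel) = (\<integral>\<^sup>+x. G x \<partial>lborel)"
proof -
  have "(\<integral>\<^sup>+x. G x \<partial>lborel) = (\<integral>\<^sup>+x. G x \<partial>distr lborel borel ((+) c))"
    by (simp add: lborel_distr_plus)
  also have "\<dots> = (\<integral>\<^sup>+x. G (c + x) \<partial>lborel)" by (rule nn_integral_distr) auto
  finally show ?thesis by (simp add: add.commute)
qed

text \<open>Tiling of the line: exactly one translate of each point lies in the fundamental domain,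
  and a shift of the variable carries every tile back to it.\<close>

lemma nn_integral_periodize:
  assumes [measurable]: "G \<in> borel_measurable borel"
  shows "(\<integral>\<^sup>+x. G x \<partial>lborel) =
    (\<integral>\<^sup>+\<theta>. indicator {-pi..<pi} \<theta> * (\<Sum>i. G (\<theta> + 2 * pi * zdec i)) \<partial>lborel)"
proof -
  have "(\<integral>\<^sup>+x. G x \<partial>lborel) = (\<integral>\<^sup>+x. (\<Sum>i. G x * indicator {-pi..<pi} (x - 2 * pi * zdec i)) \<partial>lborel)"
    by (simp only: ennreal_suminf_cmult suminf_translate_circle_lborel mult_1_right)
  also have "\<dots> = (\<Sum>i. \<integral>\<^sup>+x. G x * indicator {-pi..<pi} (x - 2 * pi * zdec i) \<partial>lborel)"
    by (rule nn_integral_suminf) measurable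
  also have "\<dots> = (\<Sum>i. \<integral>\<^sup>+x. G (x + 2 * pi * zdec i) * indicator {-pi..<pi} x \<partial>lborel)"
  proof (rule suminf_cong)
    fix i
    have "(\<integral>\<^sup>+x. G x * indicator {-pi..<pi} (x - 2 * pi * zdec i) \<partial>lborel)
      = (\<integral>\<^sup>+x. G (x + 2 * pi * zdec i) * indicator {-pi..<pi} (x + 2 * pi * zdec i - 2 * pi * zdec i) \<partial>lborel)"
      by (rule nn_integral_lborel_translate[symmetric]) measurable
    then show "(\<integral>\<^sup>+x. G x * indicator {-pi..<pi} (x - 2 * pi * zdec i) \<partial>lborel)
      = (\<integral>\<^sup>+x. G (x + 2 * pi * zdec i) * indicator {-pi..<pi} x \<partial>lborel)" by simp
  qed
  also have "\<dots> = (\<integral>\<^sup>+x. (\<Sum>i. G (x + 2 * pi * zdec i) * indicator {-pi..<pi} x) \<partial>lborel)"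
    by (rule nn_integral_suminf[symmetric]) measurable
  finally show ?thesis by (simp only: mult.commute[of _ "indicator _ _"] ennreal_suminf_cmult)
qed

text \<open>A density instead of a restricted space: the measurable sets stay those of
  \<open>borel\<close>, so the wrapped normal law is a density over it and the uniform law a
  multiple of it on the same space.\<close>

definition circle_lborel :: "real measure" where
  "circle_lborel = density lborel (indicator {-pi..<pi})"

lemma sets_circle_lborel [simp, measurable_cong]: "sets circle_lborel = sets borel" by (simp add: circle_lborel_def)
lemma space_circle_lborel [simp]: "space circle_lborel = UNIV" by (simp add: circle_lborel_def)

lemma nn_integral_circle_lborel:
  "f \<in> borel_measurable borel \<Longrightarrow> (\<integral>\<^sup>+x. f x \<partial>circle_lborel) = (\<integral>\<^sup>+x. indicator {-pi..<pi} x * f x \<partial>lborel)"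
  unfolding circle_lborel_def by (subst nn_integral_density) auto

lemma emeasure_circle_lborel_UNIV: "emeasure circle_lborel UNIV = ennreal (2 * pi)"
  by (simp add: circle_lborel_def emeasure_density nn_integral_indicator)

lemma finite_measure_circle_lborel: "finite_measure circle_lborel"
  by (rule finite_measureI) (simp add: emeasure_circle_lborel_UNIV)

lemma AE_circle_lborel: "AE x in circle_lborel. x \<in> {-pi..<pi}"
  unfolding circle_lborel_def by (subst AE_density) (auto simp: indicator_def)

lemma nn_integral_wrap_pi:
  assumes [measurable]: "u \<in> borel_measurable borel" "H \<in> borel_measurable borel"
  shows "(\<integral>\<^sup>+x. u x * H (wrap_pi x) \<partial>lborel) = (\<integral>\<^sup>+\<theta>. (\<Sum>i. u (\<theta> + 2 * pi * zdec i)) * H \<theta> \<partial>circle_lborel)"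
proof -
  have "(\<integral>\<^sup>+x. u x * H (wrap_pi x) \<partial>lborel) = (\<integral>\<^sup>+\<theta>. indicator {-pi..<pi} \<theta> *
      (\<Sum>i. u (\<theta> + 2 * pi * zdec i) * H (wrap_pi (\<theta> + 2 * pi * zdec i))) \<partial>lborel)"
    by (rule nn_integral_periodize) measurable
  also have "\<dots> = (\<integral>\<^sup>+\<theta>. indicator {-pi..<pi} \<theta> * ((\<Sum>i. u (\<theta> + 2 * pi * zdec i)) * H \<theta>) \<partial>lborel)"
    by (rule nn_integral_cong)
      (auto simp: wrap_pi_add_int wrap_pi_id ennreal_suminf_multc split: split_indicator)
  finally show ?thesis by (simp add: nn_integral_circle_lborel)
qed

text \<open>Invariance of the Haar measure of the circle. The rotated interval is again a
  fundamental domain, so after wrapping its translates still sum to 1 at every point.\<close>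

lemma nn_integral_circle_lborel_rotate:
  assumes [measurable]: "H \<in> borel_measurable borel"
  shows "(\<integral>\<^sup>+\<theta>. H (wrap_pi (\<theta> + a)) \<partial>circle_lborel) = (\<integral>\<^sup>+\<theta>. H \<theta> \<partial>circle_lborel)"
proof -
  have "(\<integral>\<^sup>+\<theta>. H (wrap_pi (\<theta> + a)) \<partial>circle_lborel) =
      (\<integral>\<^sup>+\<theta>. indicator {-pi..<pi} ((\<theta> + a) - a) * H (wrap_pi (\<theta> + a)) \<partial>lborel)"
    by (simp add: nn_integral_circle_lborel)
  also have "\<dots> = (\<integral>\<^sup>+x. indicator {-pi..<pi} (x - a) * H (wrap_pi x) \<partial>lborel)"
    by (rule nn_integral_lborel_translate) measurable
  also have "\<dots> = (\<integral>\<^sup>+\<theta>. (\<Sum>i. indicator {-pi..<pi} ((\<theta> + 2 * pi * zdec i) - a)) * H \<theta> \<partial>circle_lborel)"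
    by (rule nn_integral_wrap_pi) measurable
  also have "\<dots> = (\<integral>\<^sup>+\<theta>. H \<theta> \<partial>circle_lborel)"
  proof (rule nn_integral_cong)
    fix \<theta>
    have "(\<Sum>i. indicator {-pi..<pi} ((\<theta> + 2 * pi * zdec i) - a) :: ennreal)
      = (\<Sum>i. indicator {-pi..<pi} ((\<theta> - a) + 2 * pi * zdec i))" by (simp add: algebra_simps)
    then show "(\<Sum>i. indicator {-pi..<pi} ((\<theta> + 2 * pi * zdec i) - a)) * H \<theta> = H \<theta>"
      by (simp only: suminf_translate_circle_lborel mult_1_left)
  qed
  finally show ?thesis .
qed

lemma nn_integral_uniform_phase:
  "f \<in> borel_measurable borel \<Longrightarrow>
    (\<integral>\<^sup>+x. f x \<partial>uniform_phase) = (\<integral>\<^sup>+x. f x \<partial>circle_lborel) / ennreal (2 * pi)"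
  unfolding uniform_phase_def
  by (subst nn_integral_uniform_measure) (auto simp: nn_integral_circle_lborel mult.commute)

lemma nn_integral_uniform_phase_rotate:
  assumes [measurable]: "H \<in> borel_measurable borel"
  shows "(\<integral>\<^sup>+\<theta>. H (wrap_pi (\<theta> + a)) \<partial>uniform_phase) = (\<integral>\<^sup>+\<theta>. H \<theta> \<partial>uniform_phase)"
  by (simp add: nn_integral_uniform_phase nn_integral_circle_lborel_rotate)

lemma prob_space_uniform_phase: "prob_space uniform_phase"
  unfolding uniform_phase_def by (intro prob_space_uniform_measure) auto

text \<open>Quadratic decay suffices for a summable majorant and comes from
  \<open>exp (- u) \<le> 1 / u\<close>. Index 0, which encodes the integer 0, is left out. For every
  other integer \<open>z\<close> in the enumeration the translate has modulus at least
  \<open>2 * pi * |z| - pi\<close>, hence at least \<open>pi * |z|\<close>, and so at least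
  \<open>|z| \<ge> Suc i / 2\<close>.\<close>

lemma normal_density_translate_le:
  assumes \<sigma>: "0 < \<sigma>" and \<theta>: "\<theta> \<in> {-pi..<pi}"
  shows "normal_density 0 \<sigma> (\<theta> + 2 * pi * zdec (Suc i))
    \<le> 1 / sqrt (2 * pi * \<sigma>\<^sup>2) * (8 * \<sigma>\<^sup>2 * inverse (real (Suc i) ^ 2))"
proof -
  let ?z = "zdec (Suc i)" let ?y = "\<theta> + 2 * pi * ?z"
  have z: "real (Suc i) / 2 \<le> \<bar>?z\<bar>"
    unfolding int_decode_def sum_decode_def by (auto elim!: oddE evenE)
  have z1: "1 \<le> \<bar>?z\<bar>"
  proof -
    have "int_decode (Suc i) \<noteq> 0" using z by auto
    then have "1 \<le> \<bar>int_decode (Suc i)\<bar>" by linarith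
    then show ?thesis by (metis of_int_1_le_iff of_int_abs)
  qed
  have "\<bar>2 * pi * ?z\<bar> \<le> \<bar>?y\<bar> + pi" using \<theta> by auto
  then have "2 * pi * \<bar>?z\<bar> \<le> \<bar>?y\<bar> + pi" by (simp add: abs_mult)
  moreover have "pi * 1 \<le> pi * \<bar>?z\<bar>" using z1 by (intro mult_left_mono) auto
  ultimately have "pi * \<bar>?z\<bar> \<le> \<bar>?y\<bar>" by linarith
  moreover have "1 * \<bar>?z\<bar> \<le> pi * \<bar>?z\<bar>" using pi_gt3 by (intro mult_right_mono) auto
  ultimately have "real (Suc i) / 2 \<le> \<bar>?y\<bar>" using z by linarith
  then have "(real (Suc i) / 2)\<^sup>2 \<le> \<bar>?y\<bar>\<^sup>2" by (intro power_mono) auto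
  then have y2: "(real (Suc i))\<^sup>2 / 4 \<le> ?y\<^sup>2" by (simp add: power_divide)
  have y0: "0 < ?y\<^sup>2" by (rule less_le_trans[OF _ y2]) simp
  have "exp (- (?y\<^sup>2 / (2 * \<sigma>\<^sup>2))) \<le> 1 / (?y\<^sup>2 / (2 * \<sigma>\<^sup>2))"
  proof -
    have "?y\<^sup>2 / (2 * \<sigma>\<^sup>2) \<le> exp (?y\<^sup>2 / (2 * \<sigma>\<^sup>2))"
      using exp_ge_add_one_self[of "?y\<^sup>2 / (2 * \<sigma>\<^sup>2)"] by linarith
    moreover have "0 < ?y\<^sup>2 / (2 * \<sigma>\<^sup>2)" using y0 \<sigma> by (intro divide_pos_pos) auto
    ultimately have "inverse (exp (?y\<^sup>2 / (2 * \<sigma>\<^sup>2))) \<le> inverse (?y\<^sup>2 / (2 * \<sigma>\<^sup>2))"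
      by (rule le_imp_inverse_le)
    then show ?thesis by (simp only: exp_minus inverse_eq_divide)
  qed
  also have "\<dots> \<le> 1 / (((real (Suc i))\<^sup>2 / 4) / (2 * \<sigma>\<^sup>2))"
    using y2 y0 \<sigma> by (intro divide_left_mono divide_right_mono mult_pos_pos divide_pos_pos) auto
  also have "\<dots> = 8 * \<sigma>\<^sup>2 * inverse (real (Suc i) ^ 2)" by (simp add: field_simps)
  finally have e: "exp (- (?y\<^sup>2 / (2 * \<sigma>\<^sup>2))) \<le> 8 * \<sigma>\<^sup>2 * inverse (real (Suc i) ^ 2)" .
  have "normal_density 0 \<sigma> ?y = 1 / sqrt (2 * pi * \<sigma>\<^sup>2) * exp (- (?y\<^sup>2 / (2 * \<sigma>\<^sup>2)))"
    by (simp add: normal_density_def)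
  also have "\<dots> \<le> 1 / sqrt (2 * pi * \<sigma>\<^sup>2) * (8 * \<sigma>\<^sup>2 * inverse (real (Suc i) ^ 2))"
    by (rule mult_left_mono[OF e]) simp
  finally show ?thesis .
qed

text \<open>Two-sided bounds on the density make its logarithm bounded, so that all later means of
  it exist. The lower bound comes from the unshifted term of the series alone, as the normal density
  decreases with the modulus; the upper bound is the maximum of that term plus the quadratic
  majorant of the others.\<close>

lemma wrapped_normal_has_density:
  assumes \<sigma>: "0 < \<sigma>"
  obtains f :: "real \<Rightarrow> real" and c C where "f \<in> borel_measurable borel" "0 < c"
    "\<And>\<theta>. c \<le> f \<theta>" "\<And>\<theta>. f \<theta> \<le> C" "wrapped_normal \<sigma> = density circle_lborel (\<lambda>\<theta>. ennreal (f \<theta>))"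
proof -
  let ?n = "normal_density 0 \<sigma>" let ?c = "1 / sqrt (2 * pi * \<sigma>\<^sup>2)"
  let ?S = "\<lambda>\<theta>. \<Sum>i. ?n (\<theta> + 2 * pi * zdec i)"
  let ?I = "{-pi..<pi}"
  \<comment> \<open>Off the fundamental domain the value is the lower bound itself, so that both
    bounds hold on the whole line without a side condition.\<close>
  define f where "f = (\<lambda>\<theta>. if \<theta> \<in> ?I then ?S \<theta> else ?n pi)"
  let ?b = "\<lambda>i. ?c * (8 * \<sigma>\<^sup>2 * inverse (real (Suc i) ^ 2))"
  have sb: "summable ?b"
    by (intro summable_mult) (subst summable_Suc_iff, rule inverse_power_summable, simp)
  have nc: "?n x \<le> ?c" for x
  proof -
    have "exp (- (x\<^sup>2 / (2 * \<sigma>\<^sup>2))) \<le> 1" by simp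
    from mult_left_mono[OF this, of ?c] show ?thesis by (simp add: normal_density_def)
  qed
  have s: "summable (\<lambda>i. ?n (\<theta> + 2 * pi * zdec i))" if "\<theta> \<in> ?I" for \<theta>
  proof (subst summable_Suc_iff[symmetric], rule summable_comparison_test'[OF sb])
    fix i show "norm (?n (\<theta> + 2 * pi * zdec (Suc i))) \<le> ?b i"
      using normal_density_translate_le[OF \<sigma> that, of i] by simp
  qed
  have up: "?S \<theta> \<le> ?c + (\<Sum>i. ?b i)" if "\<theta> \<in> ?I" for \<theta>
  proof -
    have "?S \<theta> = ?n (\<theta> + 2 * pi * zdec 0) + (\<Sum>i. ?n (\<theta> + 2 * pi * zdec (Suc i)))"
      using suminf_split_head[OF s[OF that]] by simp
    also have "(\<Sum>i. ?n (\<theta> + 2 * pi * zdec (Suc i))) \<le> (\<Sum>i. ?b i)"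
      using normal_density_translate_le[OF \<sigma> that]
      by (intro suminf_le sb summable_Suc_iff[THEN iffD2, OF s[OF that]])
    finally show ?thesis using nc[of "\<theta> + 2 * pi * zdec 0"] by linarith
  qed
  have lo: "?n pi \<le> ?S \<theta>" if "\<theta> \<in> ?I" for \<theta>
  proof -
    have "\<theta>\<^sup>2 \<le> pi\<^sup>2" using that abs_le_square_iff[of \<theta> pi] by (simp add: abs_le_iff)
    then have "?n pi \<le> ?n \<theta>" unfolding normal_density_def
      using \<sigma> by (intro mult_left_mono) (auto intro!: divide_right_mono)
    also have "?n \<theta> = (\<Sum>i\<in>{0}. ?n (\<theta> + 2 * pi * zdec i))" by (simp add: int_decode_def sum_decode_def)
    also have "\<dots> \<le> ?S \<theta>" by (rule sum_le_suminf[OF s[OF that]]) auto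
    finally show ?thesis .
  qed
  have [measurable]: "f \<in> borel_measurable borel" unfolding f_def by measurable
  show thesis
  proof (rule that)
    show "f \<in> borel_measurable borel" by fact
    show "0 < ?n pi" using \<sigma> by (simp add: normal_density_pos)
    show "?n pi \<le> f \<theta>" for \<theta> using lo by (auto simp: f_def)
    show "f \<theta> \<le> ?c + (\<Sum>i. ?b i)" for \<theta>
      using up nc[of pi] suminf_nonneg[OF sb] by (auto simp: f_def intro: order_trans[OF nc[of pi]])
    show "wrapped_normal \<sigma> = density circle_lborel (\<lambda>\<theta>. ennreal (f \<theta>))"
    proof (rule measure_eqI_nn_integral)
      fix g :: "real \<Rightarrow> ennreal" assume "g \<in> borel_measurable (wrapped_normal \<sigma>)"
      then have [measurable]: "g \<in> borel_measurable borel" by (simp add: wrapped_normal_def)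
      have "(\<integral>\<^sup>+x. g x \<partial>wrapped_normal \<sigma>) = (\<integral>\<^sup>+x. ennreal (?n x) * g (wrap_pi x) \<partial>lborel)"
        unfolding wrapped_normal_def by (subst nn_integral_distr) (auto simp: nn_integral_density)
      also have "\<dots> = (\<integral>\<^sup>+\<theta>. (\<Sum>i. ennreal (?n (\<theta> + 2 * pi * zdec i))) * g \<theta> \<partial>circle_lborel)"
        by (rule nn_integral_wrap_pi) measurable
      also have "\<dots> = (\<integral>\<^sup>+\<theta>. ennreal (f \<theta>) * g \<theta> \<partial>circle_lborel)"
      proof (rule nn_integral_cong_AE, use AE_circle_lborel in eventually_elim)
        case (elim \<theta>)
        have "(\<Sum>i. ennreal (?n (\<theta> + 2 * pi * zdec i))) = ennreal (?S \<theta>)"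
          by (rule suminf_ennreal2[OF _ s[OF elim]]) simp
        with elim show ?case unfolding f_def by (simp only: if_True)
      qed
      finally show "(\<integral>\<^sup>+x. g x \<partial>wrapped_normal \<sigma>) = (\<integral>\<^sup>+x. g x \<partial>density circle_lborel (\<lambda>\<theta>. ennreal (f \<theta>)))"
        by (simp add: nn_integral_density)
    qed (simp add: wrapped_normal_def)
  qed
qed

section \<open>The complex Gaussian noise\<close>

text \<open>Opens the complex plane to Fubini in Cartesian coordinates, where Gaussian integrals
  factor.\<close>

lemma lborel_complex: "(lborel :: complex measure) = distr (lborel \<Otimes>\<^sub>M lborel) borel (\<lambda>(a, b). Complex a b)"
proof (rule lborel_eqI)
  have [measurable]: "(\<lambda>(a, b). Complex a b) \<in> borel_measurable (lborel \<Otimes>\<^sub>M lborel)"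
    unfolding Complex_eq by measurable
  fix l u :: complex assume *: "\<And>b. b \<in> Basis \<Longrightarrow> l \<bullet> b \<le> u \<bullet> b"
  have le: "Re l \<le> Re u" "Im l \<le> Im u"
    using *[of 1] *[of \<i>] by (auto simp: Basis_complex_def)
  have "emeasure (distr (lborel \<Otimes>\<^sub>M lborel) borel (\<lambda>(a, b). Complex a b)) (box l u)
    = emeasure (lborel \<Otimes>\<^sub>M lborel) ((\<lambda>(a, b). Complex a b) -` box l u \<inter> space (lborel \<Otimes>\<^sub>M lborel))"
    by (rule emeasure_distr) auto
  also have "(\<lambda>(a, b). Complex a b) -` box l u \<inter> space (lborel \<Otimes>\<^sub>M lborel) = {Re l<..<Re u} \<times> {Im l<..<Im u}"
    by (auto simp: box_def Basis_complex_def space_pair_measure)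
  also have "emeasure (lborel \<Otimes>\<^sub>M lborel) ({Re l<..<Re u} \<times> {Im l<..<Im u}) =
      ennreal (Re u - Re l) * ennreal (Im u - Im l)"
    using le by (subst lborel.emeasure_pair_measure_Times) auto
  also have "\<dots> = ennreal (\<Prod>b\<in>Basis. (u - l) \<bullet> b)"
    using le by (simp add: Basis_complex_def ennreal_mult')
  finally show "emeasure (distr (lborel \<Otimes>\<^sub>M lborel) borel (\<lambda>(a, b). Complex a b)) (box l u)
    = ennreal (\<Prod>b\<in>Basis. (u - l) \<bullet> b)" .
qed simp

lemma nn_integral_lborel_complex:
  fixes f :: "complex \<Rightarrow> ennreal"
  assumes [measurable]: "f \<in> borel_measurable borel"
  shows "(\<integral>\<^sup>+z. f z \<partial>lborel) = (\<integral>\<^sup>+a. \<integral>\<^sup>+b. f (Complex a b) \<partial>lborel \<partial>lborel)"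
proof -
  have [measurable]: "(\<lambda>(a, b). Complex a b) \<in> borel_measurable (lborel \<Otimes>\<^sub>M lborel)"
    unfolding Complex_eq by measurable
  have m: "(\<lambda>p. f (case p of (a, b) \<Rightarrow> Complex a b)) \<in> borel_measurable (lborel \<Otimes>\<^sub>M lborel)"
    by (rule measurable_compose[where g = f]) measurable
  have "(\<integral>\<^sup>+z. f z \<partial>lborel) = (\<integral>\<^sup>+p. f (case p of (a, b) \<Rightarrow> Complex a b) \<partial>(lborel \<Otimes>\<^sub>M lborel))"
    by (subst lborel_complex, subst nn_integral_distr) auto
  also have "\<dots> = (\<integral>\<^sup>+a. \<integral>\<^sup>+b. f (case (a, b) of (a, b) \<Rightarrow> Complex a b) \<partial>lborel \<partial>lborel)"
    by (rule lborel.nn_integral_fst[OF m, symmetric])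
  finally show ?thesis by simp
qed

definition cgauss :: "complex \<Rightarrow> real" where
  "cgauss z = exp (- (cmod z)\<^sup>2) / pi"

lemma cgauss_pos: "0 < cgauss z" by (simp add: cgauss_def)

lemma cgauss_measurable [measurable]: "cgauss \<in> borel_measurable borel"
  unfolding cgauss_def by measurable

lemma std_complex_normal_density: "std_complex_normal = density lborel (\<lambda>z. ennreal (cgauss z))"
proof -
  let ?n = "normal_density 0 (sqrt (1 / 2))"
  let ?N = "density lborel (\<lambda>x. ennreal (?n x))"
  let ?C = "\<lambda>(a, b). Complex a b"
  have [measurable]: "?C \<in> borel_measurable (lborel \<Otimes>\<^sub>M lborel)"
    unfolding Complex_eq by measurable
  have N: "prob_space ?N" by (rule prob_space_normal_density) simp
  then have sf: "sigma_finite_measure ?N" by (rule prob_space_imp_sigma_finite)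
  have n: "?n x = exp (- x\<^sup>2) / sqrt pi" for x by (simp add: normal_density_def)
  have g: "?n a * ?n b = cgauss (Complex a b)" for a b
  proof -
    have "?n a * ?n b = exp (- a\<^sup>2) * exp (- b\<^sup>2) / (sqrt pi * sqrt pi)" unfolding n by simp
    also have "\<dots> = cgauss (Complex a b)"
      unfolding cgauss_def by (simp add: cmod_power2 exp_add[symmetric])
    finally show ?thesis .
  qed
  have "?N \<Otimes>\<^sub>M ?N = density (lborel \<Otimes>\<^sub>M lborel) (\<lambda>(x, y). ennreal (?n x) * ennreal (?n y))"
    by (intro pair_measure_density sf) (auto intro: lborel.sigma_finite_measure_axioms)
  also have "\<dots> = density (lborel \<Otimes>\<^sub>M lborel) (\<lambda>p. ennreal (cgauss (?C p)))"
    by (rule arg_cong[where f = "density _"]) (auto simp: ennreal_mult'[symmetric] g fun_eq_iff)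
  finally have "std_complex_normal = distr (density (lborel \<Otimes>\<^sub>M lborel) (\<lambda>p. ennreal (cgauss (?C p)))) borel ?C"
    by (simp add: std_complex_normal_def Let_def)
  also have "\<dots> = density (distr (lborel \<Otimes>\<^sub>M lborel) borel ?C) (\<lambda>z. ennreal (cgauss z))"
    by (rule density_distr[symmetric]) auto
  finally show ?thesis by (simp flip: lborel_complex)
qed

section \<open>Gaussian integrals and second moments of the noise\<close>

lemma nn_integral_gauss:
  assumes c: "0 < c"
  shows "(\<integral>\<^sup>+x. ennreal (exp (- (c * x\<^sup>2))) \<partial>lborel) = ennreal (sqrt (pi / c))"
proof -
  define \<sigma> where "\<sigma> = sqrt (1 / (2 * c))"
  have \<sigma>: "0 < \<sigma>" "2 * \<sigma>\<^sup>2 = 1 / c" using c by (auto simp: \<sigma>_def)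
  have e: "exp (- (c * x\<^sup>2)) = sqrt (pi / c) * normal_density 0 \<sigma> x" for x
  proof -
    have "2 * pi * \<sigma>\<^sup>2 = pi / c" using \<sigma>(2) by (simp add: field_simps)
    then show ?thesis unfolding normal_density_def using \<sigma>(2) c by simp
  qed
  have "(\<integral>\<^sup>+x. ennreal (normal_density 0 \<sigma> x) \<partial>lborel) = ennreal (\<integral>x. normal_density 0 \<sigma> x \<partial>lborel)"
    by (rule nn_integral_eq_integral) (use \<sigma> in auto)
  then have "(\<integral>\<^sup>+x. ennreal (normal_density 0 \<sigma> x) \<partial>lborel) = 1"
    using \<sigma> by simp
  then show ?thesis unfolding e
    using c by (simp add: ennreal_mult' nn_integral_cmult)
qed

lemma nn_integral_gauss_complex:
  assumes c: "0 < c"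
  shows "(\<integral>\<^sup>+z. ennreal (exp (- (c * (cmod z)\<^sup>2))) \<partial>lborel) = ennreal (pi / c)"
proof -
  have "(\<integral>\<^sup>+z. ennreal (exp (- (c * (cmod z)\<^sup>2))) \<partial>lborel) =
     (\<integral>\<^sup>+a. \<integral>\<^sup>+b. ennreal (exp (- (c * a\<^sup>2))) * ennreal (exp (- (c * b\<^sup>2))) \<partial>lborel \<partial>lborel)"
    by (subst nn_integral_lborel_complex)
      (auto simp: cmod_power2 algebra_simps exp_add ennreal_mult'[symmetric] exp_diff exp_minus divide_inverse)
  also have "\<dots> = ennreal (sqrt (pi / c)) * ennreal (sqrt (pi / c))"
    using c by (simp add: nn_integral_cmult nn_integral_gauss nn_integral_multc)
  also have "\<dots> = ennreal (pi / c)" using c by (simp add: ennreal_mult'[symmetric])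
  finally show ?thesis .
qed

text \<open>One computation for two uses: the coefficients \<open>1, 0\<close> and
  \<open>0, 1\<close> add up to the energy of the noise, and a unit vector gives the variance of its
  component along a rotated axis.\<close>

lemma nn_integral_std_complex_normal_linear:
  "(\<integral>\<^sup>+w. ennreal ((\<alpha> * Re w + \<beta> * Im w)\<^sup>2) \<partial>std_complex_normal) = ennreal ((\<alpha>\<^sup>2 + \<beta>\<^sup>2) / 2)"
proof -
  let ?\<sigma> = "sqrt (1 / 2)"
  let ?n = "normal_density 0 ?\<sigma>"
  let ?N = "density lborel (\<lambda>x. ennreal (?n x))"
  interpret N: prob_space ?N by (rule prob_space_normal_density) simp
  have \<sigma>: "0 < ?\<sigma>" by simp
  have i1: "integrable ?N (\<lambda>x. x)" "(\<integral>x. x \<partial>?N) = 0"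
    using integrable_normal_moment_nz_1[OF \<sigma>, of 0] integral_normal_moment_nz_1[OF \<sigma>, of 0]
    by (simp_all add: integrable_density integral_density)
  have i2: "integrable ?N (\<lambda>x. x\<^sup>2)" "(\<integral>x. x\<^sup>2 \<partial>?N) = 1 / 2"
    using integrable_normal_moment[OF \<sigma>, of 0 2] integral_normal_moment_even[OF \<sigma>, of 0 1]
    by (simp_all add: integrable_density integral_density)
  \<comment> \<open>The offset \<open>x\<close> lets the formula serve twice: first over the
    imaginary part with the real part in the offset, then over the real part with offset 0.\<close>
  have q: "(\<integral>\<^sup>+b. ennreal ((x + \<beta> * b)\<^sup>2) \<partial>?N) = ennreal (x\<^sup>2 + \<beta>\<^sup>2 / 2)" for x \<beta>
  proof -
    have e: "(x + \<beta> * b)\<^sup>2 = x\<^sup>2 + (2 * x * \<beta>) * b + \<beta>\<^sup>2 * b\<^sup>2" for b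
      by (simp add: power2_eq_square algebra_simps)
    have i: "integrable ?N (\<lambda>b. x\<^sup>2 + (2 * x * \<beta>) * b + \<beta>\<^sup>2 * b\<^sup>2)"
      using i1 i2 by auto
    have v: "(\<integral>b. x\<^sup>2 + (2 * x * \<beta>) * b + \<beta>\<^sup>2 * b\<^sup>2 \<partial>?N) = x\<^sup>2 + \<beta>\<^sup>2 / 2"
      using N.prob_space by (simp add: i1 i2)
    have "(\<integral>\<^sup>+b. ennreal ((x + \<beta> * b)\<^sup>2) \<partial>?N) = ennreal (\<integral>b. (x + \<beta> * b)\<^sup>2 \<partial>?N)"
      by (rule nn_integral_eq_integral) (use i in \<open>simp_all only: e\<close>, simp flip: e)
    then show ?thesis by (simp only: e v)
  qed
  have m: "(\<lambda>(a, b). Complex a b) \<in> borel_measurable (?N \<Otimes>\<^sub>M ?N)"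
    unfolding Complex_eq by measurable
  have [measurable]: "(\<lambda>w. ennreal ((\<alpha> * Re w + \<beta> * Im w)\<^sup>2)) \<in> borel_measurable borel" by measurable
  have "(\<integral>\<^sup>+w. ennreal ((\<alpha> * Re w + \<beta> * Im w)\<^sup>2) \<partial>std_complex_normal)
    = (\<integral>\<^sup>+p. ennreal ((\<alpha> * fst p + \<beta> * snd p)\<^sup>2) \<partial>(?N \<Otimes>\<^sub>M ?N))"
    unfolding std_complex_normal_def Let_def by (subst nn_integral_distr[OF m]) (auto simp: case_prod_beta)
  also have "\<dots> = (\<integral>\<^sup>+a. \<integral>\<^sup>+b. ennreal ((\<alpha> * a + \<beta> * b)\<^sup>2) \<partial>?N \<partial>?N)"
    by (subst N.nn_integral_fst[symmetric]) auto
  also have "\<dots> = (\<integral>\<^sup>+a. ennreal ((\<alpha> * a)\<^sup>2 + \<beta>\<^sup>2 / 2) \<partial>?N)" by (simp only: q)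
  also have "\<dots> = (\<integral>\<^sup>+a. ennreal ((0 + \<alpha> * a)\<^sup>2) + ennreal (\<beta>\<^sup>2 / 2) \<partial>?N)"
    by (rule nn_integral_cong) (simp add: ennreal_plus[symmetric] del: ennreal_plus)
  also have "\<dots> = ennreal (0\<^sup>2 + \<alpha>\<^sup>2 / 2) + ennreal (\<beta>\<^sup>2 / 2)"
    by (subst nn_integral_add) (auto simp: q[of 0, simplified] N.emeasure_space_1[simplified])
  also have "\<dots> = ennreal ((\<alpha>\<^sup>2 + \<beta>\<^sup>2) / 2)"
    by (simp add: ennreal_plus[symmetric] add_divide_distrib del: ennreal_plus)
  finally show ?thesis .
qed

lemma sets_std_complex_normal [measurable_cong, simp]: "sets std_complex_normal = sets borel"
  by (simp add: std_complex_normal_density)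

lemma space_std_complex_normal [simp]: "space std_complex_normal = UNIV"
  by (simp add: std_complex_normal_density)

lemma integrable_std_complex_normal_linear:
  "integrable std_complex_normal (\<lambda>w. (\<alpha> * Re w + \<beta> * Im w)\<^sup>2)" (is ?i)
  "(\<integral>w. (\<alpha> * Re w + \<beta> * Im w)\<^sup>2 \<partial>std_complex_normal) = (\<alpha>\<^sup>2 + \<beta>\<^sup>2) / 2"
proof -
  show ?i
    by (rule integrableI_nonneg) (auto simp: nn_integral_std_complex_normal_linear)
  have "ennreal (\<integral>w. (\<alpha> * Re w + \<beta> * Im w)\<^sup>2 \<partial>std_complex_normal) = ennreal ((\<alpha>\<^sup>2 + \<beta>\<^sup>2) / 2)"
    by (subst nn_integral_eq_integral[symmetric, OF \<open>?i\<close>]) (auto simp: nn_integral_std_complex_normal_linear)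
  then show "(\<integral>w. (\<alpha> * Re w + \<beta> * Im w)\<^sup>2 \<partial>std_complex_normal) = (\<alpha>\<^sup>2 + \<beta>\<^sup>2) / 2"
    by (subst (asm) ennreal_inj) (auto intro!: integral_nonneg_AE)
qed

lemma std_complex_normal_second_moment:
  "integrable std_complex_normal (\<lambda>w. (cmod w)\<^sup>2)"
  "(\<integral>w. (cmod w)\<^sup>2 \<partial>std_complex_normal) = 1"
  using integrable_std_complex_normal_linear[of 1 0] integrable_std_complex_normal_linear[of 0 1]
  unfolding cmod_power2 by auto

lemma std_complex_normal_Im_rotate:
  assumes "cmod c = 1"
  shows "integrable std_complex_normal (\<lambda>w. (Im (w * c))\<^sup>2)"
    and "(\<integral>w. (Im (w * c))\<^sup>2 \<partial>std_complex_normal) = 1 / 2"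
proof -
  have e: "Im (w * c) = Im c * Re w + Re c * Im w" for w by (simp add: algebra_simps)
  have c: "(Im c)\<^sup>2 + (Re c)\<^sup>2 = 1" using assms by (simp add: cmod_def add.commute)
  show "integrable std_complex_normal (\<lambda>w. (Im (w * c))\<^sup>2)"
    and "(\<integral>w. (Im (w * c))\<^sup>2 \<partial>std_complex_normal) = 1 / 2"
    unfolding e using integrable_std_complex_normal_linear[of "Im c" "Re c"] c by auto
qed

lemma std_complex_normal_tail:
  assumes t: "0 < t"
  shows "measure std_complex_normal {w. t \<le> cmod w} \<le> 1 / t\<^sup>2"
proof -
  interpret prob_space std_complex_normal by (rule prob_space_std_complex_normal)
  have "measure std_complex_normal {w. t \<le> cmod w} = (\<integral>w. indicator {w. t \<le> cmod w} w \<partial>std_complex_normal)"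
    by simp
  also have "\<dots> \<le> (\<integral>w. (cmod w)\<^sup>2 / t\<^sup>2 \<partial>std_complex_normal)"
  proof (rule integral_mono)
    fix w show "indicator {w. t \<le> cmod w} w \<le> (cmod w)\<^sup>2 / t\<^sup>2"
      using t power_mono[of t "cmod w" 2] by (auto simp: indicator_def)
  qed (use std_complex_normal_second_moment in \<open>auto simp: emeasure_eq_measure\<close>)
  also have "\<dots> = 1 / t\<^sup>2" using std_complex_normal_second_moment by simp
  finally show ?thesis .
qed

section \<open>Auxiliary phase posterior and output density\<close>

text \<open>This is \<open>t \<le> tan t\<close> below \<open>pi / 2\<close>, read off from
  \<open>arctan u \<le> u\<close>. A positive cosine keeps \<open>|t|\<close> in that range.\<close>

lemma abs_mult_cos_le_abs_sin:
  assumes "\<bar>t\<bar> \<le> pi" "0 < cos t"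
  shows "\<bar>t\<bar> * cos t \<le> \<bar>sin t\<bar>"
proof -
  let ?u = "\<bar>t\<bar>"
  have s0: "0 \<le> sin ?u" using assms by (intro sin_ge_zero) auto
  have u: "0 \<le> ?u" "?u \<le> pi" "cos ?u = cos t" "\<bar>sin t\<bar> = sin ?u"
    using assms s0 by (auto simp: abs_if split: if_splits)
  have "?u < pi / 2"
  proof (rule ccontr)
    assume "\<not> ?u < pi / 2"
    then have "cos ?u \<le> cos (pi / 2)" using u by (intro cos_monotone_0_pi_le) auto
    then show False using assms u by simp
  qed
  then have "arctan (tan ?u) = ?u" using u by (intro arctan_tan) auto
  moreover have "0 \<le> tan ?u" using \<open>?u < pi / 2\<close> u by (intro tan_pos_pi2_le) auto
  ultimately have "?u \<le> tan ?u" using arctan_le_self[of "tan ?u"] by simp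
  then show ?thesis using assms u by (simp add: tan_def field_simps)
qed

text \<open>The cost of the auxiliary phase posterior: quadratic in the component orthogonal to the
  direction of the input as long as the angular deviation is small, and linear otherwise.  The
  quadratic branch is exactly a squared Gaussian, so its mean does not depend on the input.\<close>

definition phase_cost :: "real \<Rightarrow> complex \<Rightarrow> real" where
  "phase_cost \<kappa> z = (if \<kappa> * cmod z \<le> Re z then (Im z)\<^sup>2 else cmod z)"

lemma phase_cost_measurable [measurable]: "phase_cost \<kappa> \<in> borel_measurable borel"
  unfolding phase_cost_def by measurable

lemma phase_cost_nonneg: "0 \<le> phase_cost \<kappa> z"
  by (simp add: phase_cost_def)

lemma phase_cost_cnj: "phase_cost \<kappa> (cnj z) = phase_cost \<kappa> z"
  by (simp add: phase_cost_def)

lemma phase_cost_le: "phase_cost \<kappa> z \<le> (cmod z)\<^sup>2 + cmod z"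
proof -
  have "(Im z)\<^sup>2 \<le> (cmod z)\<^sup>2" by (simp add: cmod_power2)
  then show ?thesis by (auto simp: phase_cost_def add_increasing2 add_increasing)
qed

text \<open>Here \<open>s\<close> is the modulus of the input and \<open>w\<close> the rotated
  noise. The quadratic branch fails only if the noise is comparable with the input. In the right
  half-plane the angle of \<open>z = s + w\<close> then exceeds \<open>arccos \<kappa>\<close>, so
  \<open>sqrt (1 - \<kappa>\<^sup>2) * |z| \<le> |Im z| = |Im w|\<close>, and
  \<open>s \<le> |z| + |w|\<close> produces the constant \<open>K\<close>. In the left half-plane
  already \<open>s \<le> |w|\<close>, and \<open>|z| \<le> 2 * |w| \<le> K * |w|\<close>. The linear
  branch is thus confined to a tail event of the noise.\<close>

lemma phase_cost_shift_le:
  assumes \<kappa>: "0 < \<kappa>" "\<kappa> < 1" and s: "0 \<le> s" and K: "K = 1 + 1 / sqrt (1 - \<kappa>\<^sup>2)"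
  shows "phase_cost \<kappa> (of_real s + w) \<le> (Im w)\<^sup>2 + K * cmod w * indicator {w. s \<le> K * cmod w} w"
proof -
  let ?z = "of_real s + w" and ?k = "sqrt (1 - \<kappa>\<^sup>2)"
  have k2: "\<kappa>\<^sup>2 < 1" using \<kappa> abs_square_less_1[of \<kappa>] by simp
  have k: "0 < ?k" "?k \<le> 1" using k2 by (auto simp: real_sqrt_le_1_iff)
  have K2: "2 \<le> K" using k unfolding K by (simp add: field_simps)
  show ?thesis
  proof (cases "\<kappa> * cmod ?z \<le> Re ?z")
    case True
    then show ?thesis using K2 by (simp add: phase_cost_def)
  next
    case False
    have "cmod ?z \<le> K * cmod w \<and> s \<le> K * cmod w"
    proof (cases "0 \<le> Re ?z")
      case True
      have "(Re ?z)\<^sup>2 \<le> (\<kappa> * cmod ?z)\<^sup>2" using True False by (intro power_mono) auto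
      then have "(1 - \<kappa>\<^sup>2) * (cmod ?z)\<^sup>2 \<le> (Im ?z)\<^sup>2"
        using cmod_power2[of ?z] by (simp add: algebra_simps power_mult_distrib)
      then have "(?k * cmod ?z)\<^sup>2 \<le> (Im w)\<^sup>2"
        using k2 by (simp add: power_mult_distrib)
      then have "?k * cmod ?z \<le> \<bar>Im w\<bar>"
        using k by (subst (asm) abs_le_square_iff[symmetric]) (simp add: abs_mult)
      then have "?k * cmod ?z \<le> cmod w" using abs_Im_le_cmod[of w] by linarith
      then have a: "cmod ?z \<le> cmod w / ?k" using k by (simp add: field_simps)
      have "s = cmod (?z - w)" using s by simp
      also have "\<dots> \<le> cmod ?z + cmod w" by (rule norm_triangle_ineq4)
      also have "\<dots> \<le> K * cmod w" using a unfolding K by (simp add: algebra_simps)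
      finally have "s \<le> K * cmod w" .
      moreover have "cmod w / ?k \<le> K * cmod w" unfolding K by (simp add: algebra_simps)
      ultimately show ?thesis using a by linarith
    next
      case False
      then have sw: "s \<le> cmod w" using abs_Re_le_cmod[of w] by simp
      have "cmod ?z \<le> s + cmod w" using norm_triangle_ineq[of "of_real s" w] s by simp
      then have "cmod ?z \<le> 2 * cmod w" using sw by linarith
      moreover have "2 * cmod w \<le> K * cmod w" using K2 by (intro mult_right_mono) auto
      moreover have "cmod w \<le> 2 * cmod w" by simp
      ultimately show ?thesis using sw by linarith
    qed
    then show ?thesis using False by (simp add: phase_cost_def add_increasing)
  qed
qed

section \<open>The phase posterior and its normaliser\<close>

definition phase_norm :: "real \<Rightarrow> real \<Rightarrow> real" where
  "phase_norm \<kappa> s = enn2real (\<integral>\<^sup>+t. ennreal (exp (- phase_cost \<kappa> (of_real s * cis t))) \<partial>circle_lborel)"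

lemma cis_borel_measurable [measurable]: "cis \<in> borel_measurable borel"
  unfolding cis_conv_exp by measurable

lemma phase_norm_measurable [measurable]: "phase_norm \<kappa> \<in> borel_measurable borel"
proof -
  interpret finite_measure circle_lborel by (rule finite_measure_circle_lborel)
  show ?thesis unfolding phase_norm_def by measurable
qed

lemma phase_norm_eq:
  assumes "0 \<le> s"
  shows "ennreal (phase_norm \<kappa> s) = (\<integral>\<^sup>+t. ennreal (exp (- phase_cost \<kappa> (of_real s * cis t))) \<partial>circle_lborel)"
    and "0 < phase_norm \<kappa> s" and "phase_norm \<kappa> s \<le> 2 * pi"
proof -
  let ?I = "\<integral>\<^sup>+t. ennreal (exp (- phase_cost \<kappa> (of_real s * cis t))) \<partial>circle_lborel"
  have "?I \<le> (\<integral>\<^sup>+t. 1 \<partial>circle_lborel)"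
    by (intro nn_integral_mono) (simp add: phase_cost_nonneg)
  then have up: "?I \<le> ennreal (2 * pi)" by (simp add: emeasure_circle_lborel_UNIV)
  show e: "ennreal (phase_norm \<kappa> s) = ?I"
    unfolding phase_norm_def using up by (intro ennreal_enn2real) (auto simp: le_less_trans)
  show "phase_norm \<kappa> s \<le> 2 * pi"
    using up unfolding e[symmetric] by (subst (asm) ennreal_le_iff) auto
  have "(\<integral>\<^sup>+t. ennreal (exp (- (s\<^sup>2 + s))) \<partial>circle_lborel) \<le> ?I"
  proof (rule nn_integral_mono)
    fix t
    have "phase_cost \<kappa> (of_real s * cis t) \<le> s\<^sup>2 + s"
      using phase_cost_le[of \<kappa> "of_real s * cis t"] assms by (simp add: norm_mult)
    then show "ennreal (exp (- (s\<^sup>2 + s))) \<le> ennreal (exp (- phase_cost \<kappa> (of_real s * cis t)))"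
      by (intro ennreal_leI) simp
  qed
  moreover have "0 < (\<integral>\<^sup>+t. ennreal (exp (- (s\<^sup>2 + s))) \<partial>circle_lborel)"
    by (simp add: emeasure_circle_lborel_UNIV ennreal_mult'[symmetric])
  ultimately have "0 < ennreal (phase_norm \<kappa> s)" unfolding e by (rule less_le_trans[rotated])
  then show "0 < phase_norm \<kappa> s" by simp
qed

text \<open>On the quadratic branch \<open>cos t \<ge> \<kappa>\<close>, hence
  \<open>|sin t| \<ge> \<kappa> * |t|\<close>, and the integral is at most a Gaussian one over the
  whole line, which is the leading term. The linear branch is at most \<open>exp (- s)\<close> on an
  interval of length \<open>2 * pi\<close>.\<close>

lemma phase_norm_le:
  assumes \<kappa>: "0 < \<kappa>" "\<kappa> < 1" and s: "0 < s"
  shows "phase_norm \<kappa> s \<le> sqrt pi / (\<kappa> * s) + 2 * pi * exp (- s)"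
proof -
  have "ennreal (phase_norm \<kappa> s) = (\<integral>\<^sup>+t. ennreal (exp (- phase_cost \<kappa> (of_real s * cis t))) \<partial>circle_lborel)"
    using s by (simp add: phase_norm_eq)
  also have "\<dots> \<le> (\<integral>\<^sup>+t. ennreal (exp (- ((\<kappa> * s)\<^sup>2 * t\<^sup>2))) + ennreal (exp (- s)) \<partial>circle_lborel)"
  proof (rule nn_integral_mono_AE, use AE_circle_lborel in eventually_elim)
    case (elim t)
    let ?z = "of_real s * cis t"
    have z: "cmod ?z = s" "Re ?z = s * cos t" "Im ?z = s * sin t" using s by (auto simp: norm_mult)
    have "exp (- phase_cost \<kappa> ?z) \<le> exp (- ((\<kappa> * s)\<^sup>2 * t\<^sup>2)) + exp (- s)"
    proof (cases "\<kappa> * s \<le> s * cos t")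
      case True
      then have c: "\<kappa> \<le> cos t" using s by (simp add: mult.commute)
      have "\<kappa> * \<bar>t\<bar> \<le> \<bar>t\<bar> * cos t" using mult_left_mono[OF c, of "\<bar>t\<bar>"] by (simp add: mult.commute)
      also have "\<dots> \<le> \<bar>sin t\<bar>" using elim c \<kappa> by (intro abs_mult_cos_le_abs_sin) auto
      finally have "s * (\<kappa> * \<bar>t\<bar>) \<le> s * \<bar>sin t\<bar>" using s by (intro mult_left_mono) auto
      then have "(s * (\<kappa> * \<bar>t\<bar>))\<^sup>2 \<le> (s * \<bar>sin t\<bar>)\<^sup>2"
        using s \<kappa> by (intro power_mono) auto
      then have "(\<kappa> * s)\<^sup>2 * t\<^sup>2 \<le> (s * sin t)\<^sup>2" by (simp add: power_mult_distrib mult_ac)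
      then show ?thesis using True by (simp add: phase_cost_def z add_increasing2)
    next
      case False
      then show ?thesis by (simp add: phase_cost_def z)
    qed
    then show "ennreal (exp (- phase_cost \<kappa> ?z)) \<le> ennreal (exp (- ((\<kappa> * s)\<^sup>2 * t\<^sup>2))) + ennreal (exp (- s))"
      by (simp add: ennreal_plus[symmetric] del: ennreal_plus)
  qed
  also have "\<dots> = (\<integral>\<^sup>+t. ennreal (exp (- ((\<kappa> * s)\<^sup>2 * t\<^sup>2))) \<partial>circle_lborel) + ennreal (exp (- s)) * ennreal (2 * pi)"
    by (subst nn_integral_add) (auto simp: emeasure_circle_lborel_UNIV)
  also have "\<dots> \<le> ennreal (sqrt pi / (\<kappa> * s)) + ennreal (exp (- s)) * ennreal (2 * pi)"
  proof (rule add_right_mono)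
    have "(\<integral>\<^sup>+t. ennreal (exp (- ((\<kappa> * s)\<^sup>2 * t\<^sup>2))) \<partial>circle_lborel) \<le>
        (\<integral>\<^sup>+t. ennreal (exp (- ((\<kappa> * s)\<^sup>2 * t\<^sup>2))) \<partial>lborel)"
      by (subst nn_integral_circle_lborel) (auto intro!: nn_integral_mono split: split_indicator)
    also have "\<dots> = ennreal (sqrt pi / (\<kappa> * s))"
      using s \<kappa> by (subst nn_integral_gauss) (auto simp: real_sqrt_divide)
    finally show "(\<integral>\<^sup>+t. ennreal (exp (- ((\<kappa> * s)\<^sup>2 * t\<^sup>2))) \<partial>circle_lborel) \<le> ennreal (sqrt pi / (\<kappa> * s))" .
  qed
  also have "ennreal (sqrt pi / (\<kappa> * s)) + ennreal (exp (- s)) * ennreal (2 * pi) =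
      ennreal (sqrt pi / (\<kappa> * s) + 2 * pi * exp (- s))"
    using s \<kappa> by (simp add: ennreal_mult'[symmetric] ennreal_plus[symmetric] mult_ac del: ennreal_plus)
  finally show ?thesis
    using s \<kappa> by (subst (asm) ennreal_le_iff) auto
qed

text \<open>\<open>sgn\<close> vanishes at 0. The value 1 there keeps the modulus equal to 1, so
  that multiplication by it is a rotation for every input.\<close>

definition unit_dir :: "complex \<Rightarrow> complex" where
  "unit_dir x = (if x = 0 then 1 else sgn x)"

lemma unit_dir_measurable [measurable]: "unit_dir \<in> borel_measurable borel"
  unfolding unit_dir_def sgn_div_norm by measurable

lemma cmod_unit_dir [simp]: "cmod (unit_dir x) = 1"
  by (simp add: unit_dir_def norm_sgn)

lemma unit_dir_mult_cnj: "x * cnj (unit_dir x) = of_real (cmod x)"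
proof (cases "x = 0")
  case False
  then have "x * cnj (sgn x) = x * cnj x / of_real (cmod x)"
    by (simp add: sgn_eq)
  also have "\<dots> = of_real (cmod x)"
    using False by (simp add: complex_norm_square[symmetric] power2_eq_square)
  finally show ?thesis using False by (simp add: unit_dir_def)
qed (simp add: unit_dir_def)

text \<open>A probability density on the circle in \<open>\<theta>\<close>, largest where the input
  turned by \<open>\<theta>\<close> points along the output. The normaliser depends on the output
  through its modulus only.\<close>

definition phase_posterior :: "real \<Rightarrow> complex \<Rightarrow> complex \<Rightarrow> real \<Rightarrow> real" where
  "phase_posterior \<kappa> x y \<theta> =
     exp (- phase_cost \<kappa> (y * cis (- \<theta>) * cnj (unit_dir x))) / phase_norm \<kappa> (cmod y)"

lemma phase_posterior_pos: "0 < phase_posterior \<kappa> x y \<theta>"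
  unfolding phase_posterior_def by (intro divide_pos_pos phase_norm_eq(2)) auto

lemma cnj_borel_measurable [measurable]: "cnj \<in> borel_measurable borel"
  by (intro borel_measurable_continuous_onI continuous_intros)

lemma phase_posterior_measurable [measurable]:
  assumes [measurable]: "f \<in> borel_measurable M" "g \<in> borel_measurable M" "h \<in> borel_measurable M"
  shows "(\<lambda>x. phase_posterior \<kappa> (f x) (g x) (h x)) \<in> borel_measurable M"
  unfolding phase_posterior_def by measurable

text \<open>In \<open>\<theta>\<close> the posterior is a rotated copy of one fixed profile, so
  rotation invariance absorbs both the argument of the output and the shift \<open>a\<close>. The
  shift is there for coordinate 1, whose phase is \<open>\<theta>c + \<theta>r\<close>. Passing to
  the conjugate only reverses the angle, which \<open>phase_cost\<close> ignores.\<close>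

lemma nn_integral_phase_posterior:
  "(\<integral>\<^sup>+\<theta>. ennreal (phase_posterior \<kappa> x y (\<theta> + a)) \<partial>circle_lborel) = 1"
proof -
  define \<alpha> where "\<alpha> = Arg (y * cnj (unit_dir x))"
  have c: "y * cnj (unit_dir x) = of_real (cmod y) * cis \<alpha>"
    using rcis_cmod_Arg[of "y * cnj (unit_dir x)"] by (simp add: rcis_def \<alpha>_def norm_mult)
  have p: "phase_cost \<kappa> (y * cis (- \<theta>) * cnj (unit_dir x)) = phase_cost \<kappa> (of_real (cmod y) * cis (\<theta> - \<alpha>))" for \<theta>
  proof -
    have "y * cis (- \<theta>) * cnj (unit_dir x) = of_real (cmod y) * cis \<alpha> * cis (- \<theta>)"
      using c by (simp add: mult_ac)
    also have "\<dots> = cnj (of_real (cmod y) * cis (\<theta> - \<alpha>))"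
      by (simp add: cis_cnj cis_mult mult.assoc)
    finally show ?thesis by (simp only: phase_cost_cnj)
  qed
  have e: "ennreal (phase_posterior \<kappa> x y (\<theta> + a)) =
      ennreal (exp (- phase_cost \<kappa> (of_real (cmod y) * cis (wrap_pi (\<theta> + (a - \<alpha>)))))) / ennreal (phase_norm \<kappa> (cmod y))" for \<theta>
    unfolding phase_posterior_def p cis_wrap_pi add_diff_eq
    by (rule divide_ennreal[symmetric]) (auto simp: phase_norm_eq)
  have "(\<integral>\<^sup>+\<theta>. ennreal (phase_posterior \<kappa> x y (\<theta> + a)) \<partial>circle_lborel) =
      (\<integral>\<^sup>+\<theta>. ennreal (exp (- phase_cost \<kappa> (of_real (cmod y) * cis (wrap_pi (\<theta> + (a - \<alpha>)))))) \<partial>circle_lborel) / ennreal (phase_norm \<kappa> (cmod y))"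
    unfolding e by (rule nn_integral_divide) measurable
  also have "(\<integral>\<^sup>+\<theta>. ennreal (exp (- phase_cost \<kappa> (of_real (cmod y) * cis (wrap_pi (\<theta> + (a - \<alpha>)))))) \<partial>circle_lborel)
    = (\<integral>\<^sup>+\<theta>. ennreal (exp (- phase_cost \<kappa> (of_real (cmod y) * cis \<theta>))) \<partial>circle_lborel)"
    by (rule nn_integral_circle_lborel_rotate) measurable
  also have "\<dots> = ennreal (phase_norm \<kappa> (cmod y))" by (simp add: phase_norm_eq)
  finally show ?thesis
    using phase_norm_eq(2)[of "cmod y" \<kappa>] by (simp add: ennreal_divide_self)
qed

text \<open>The weight \<open>1 / s\<close> yields the high-power asymptotics; below the radius \<open>R\<close> it is replaced by
  a constant \<open>A\<close>, so that inputs of small modulus are penalised at a vanishing cost.\<close>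

definition radial_weight :: "real \<Rightarrow> real \<Rightarrow> real \<Rightarrow> real" where
  "radial_weight A R s = (if s < R then A else 1 / s)"

lemma radial_weight_measurable [measurable]: "radial_weight A R \<in> borel_measurable borel"
  unfolding radial_weight_def by measurable

lemma radial_weight_pos: "0 < A \<Longrightarrow> 0 < R \<Longrightarrow> 0 < radial_weight A R s"
  by (simp add: radial_weight_def)

section \<open>Normalisation of the radial output density\<close>

definition radial_norm :: "real \<Rightarrow> real \<Rightarrow> real \<Rightarrow> real" where
  "radial_norm A R \<tau> = enn2real (\<integral>\<^sup>+z. ennreal (exp (- (cmod z)\<^sup>2 / \<tau>) * radial_weight A R (cmod z)) \<partial>lborel)"

lemma nn_integral_inverse_quadratic_le:
  assumes a: "0 < a"
  shows "(\<integral>\<^sup>+t. ennreal (1 / (t\<^sup>2 + a\<^sup>2)) \<partial>lborel) \<le> ennreal (pi / a)"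
proof -
  let ?f = "\<lambda>t. 1 / (t\<^sup>2 + a\<^sup>2)"
  have pos: "0 < t\<^sup>2 + a\<^sup>2" for t using a by (simp add: add_nonneg_pos)
  have lim: "filterlim (\<lambda>t. t / a) at_top at_top"
    using filterlim_tendsto_pos_mult_at_top[OF tendsto_const[of "inverse a"] _ filterlim_ident] a
    by (simp add: divide_inverse mult.commute)
  have "((\<lambda>t. arctan (t / a) / a) \<longlongrightarrow> (pi / 2) / a) at_top"
    using a lim by (intro tendsto_divide filterlim_compose[OF tendsto_arctan_at_top lim]) auto
  then have "(\<integral>\<^sup>+t. ennreal (?f t) * indicator {0..} t \<partial>lborel) = ennreal (pi / 2 / a - arctan (0 / a) / a)"
  proof (intro nn_integral_FTC_atLeast)
    fix t :: real
    have "((\<lambda>t. arctan (t / a) / a) has_real_derivative (1 / (1 + (t / a)\<^sup>2) * (1 / a)) / a) (at t)"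
      using a by (auto intro!: derivative_eq_intros simp: divide_simps)
    also have "(1 / (1 + (t / a)\<^sup>2) * (1 / a)) / a = ?f t"
      using a pos[of t] by (simp add: divide_simps power2_eq_square)
    finally show "((\<lambda>t. arctan (t / a) / a) has_real_derivative ?f t) (at t)" .
  qed (use pos in \<open>auto simp: less_imp_le\<close>)
  then have half: "(\<integral>\<^sup>+t. ennreal (?f t) * indicator {0..} t \<partial>lborel) = ennreal (pi / 2 / a)" by simp
  have "(\<integral>\<^sup>+t. ennreal (?f t) * indicator {..0} t \<partial>lborel) =
      (\<integral>\<^sup>+t. ennreal (?f t) * indicator {..0} t \<partial>distr lborel borel uminus)"
    by (simp add: lborel_distr_uminus)
  also have "\<dots> = (\<integral>\<^sup>+t. ennreal (?f (- t)) * indicator {..0} (- t) \<partial>lborel)"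
    by (rule nn_integral_distr) measurable
  also have "\<dots> = (\<integral>\<^sup>+t. ennreal (?f t) * indicator {0..} t \<partial>lborel)"
    by (intro nn_integral_cong) (auto simp: indicator_def)
  finally have neg: "(\<integral>\<^sup>+t. ennreal (?f t) * indicator {..0} t \<partial>lborel) = ennreal (pi / 2 / a)"
    by (simp only: half)
  have "(\<integral>\<^sup>+t. ennreal (?f t) \<partial>lborel) \<le>
     (\<integral>\<^sup>+t. ennreal (?f t) * indicator {0..} t + ennreal (?f t) * indicator {..0} t \<partial>lborel)"
    by (intro nn_integral_mono) (auto split: split_indicator)
  also have "\<dots> = ennreal (pi / 2 / a) + ennreal (pi / 2 / a)"
    by (subst nn_integral_add) (simp_all only: half neg, measurable)
  also have "\<dots> = ennreal (pi / a)"
    using a by (simp add: ennreal_plus[symmetric] del: ennreal_plus)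
  finally show ?thesis .
qed

text \<open>The factor \<open>1 / |z|\<close> is written as \<open>1 / sqrt pi\<close> times the
  integral of \<open>exp (- t\<^sup>2 * |z|\<^sup>2)\<close> over \<open>t\<close>. After exchanging
  the integrals the plane integral is \<open>pi / (t\<^sup>2 + 1 / \<tau>)\<close>, and an
  arctangent remains. At \<open>z = 0\<close> the integrand on the left is 0 by the convention for
  division by zero.\<close>

lemma nn_integral_gauss_over_norm_le:
  assumes \<tau>: "0 < \<tau>"
  shows "(\<integral>\<^sup>+(z::complex). ennreal (exp (- (cmod z)\<^sup>2 / \<tau>) * (1 / cmod z)) \<partial>lborel) \<le> ennreal (pi * sqrt pi * sqrt \<tau>)"
proof -
  have e: "ennreal (exp (- (cmod z)\<^sup>2 / \<tau>) * (1 / cmod z)) \<le>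
     ennreal (1 / sqrt pi) * (\<integral>\<^sup>+t. ennreal (exp (- ((t\<^sup>2 + 1 / \<tau>) * (cmod z)\<^sup>2))) \<partial>lborel)" for z
  proof (cases "z = 0")
    case False
    have "(\<integral>\<^sup>+t. ennreal (exp (- ((t\<^sup>2 + 1 / \<tau>) * (cmod z)\<^sup>2))) \<partial>lborel) =
       (\<integral>\<^sup>+t. ennreal (exp (- (cmod z)\<^sup>2 / \<tau>)) * ennreal (exp (- ((cmod z)\<^sup>2 * t\<^sup>2))) \<partial>lborel)"
      by (intro nn_integral_cong) (simp add: ennreal_mult'[symmetric] exp_add[symmetric] algebra_simps)
    also have "\<dots> = ennreal (exp (- (cmod z)\<^sup>2 / \<tau>)) * ennreal (sqrt (pi / (cmod z)\<^sup>2))"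
      using False by (subst nn_integral_cmult) (auto simp: nn_integral_gauss)
    also have "\<dots> = ennreal (exp (- (cmod z)\<^sup>2 / \<tau>) * (sqrt pi / cmod z))"
      by (subst ennreal_mult'[symmetric]) (auto simp: real_sqrt_divide)
    finally show ?thesis by (simp add: ennreal_mult'[symmetric])
  qed simp
  have "(\<integral>\<^sup>+(z::complex). ennreal (exp (- (cmod z)\<^sup>2 / \<tau>) * (1 / cmod z)) \<partial>lborel) \<le>
    (\<integral>\<^sup>+(z::complex). ennreal (1 / sqrt pi) * (\<integral>\<^sup>+t. ennreal (exp (- ((t\<^sup>2 + 1 / \<tau>) * (cmod z)\<^sup>2))) \<partial>lborel) \<partial>lborel)"
    by (intro nn_integral_mono e)
  also have "\<dots> = ennreal (1 / sqrt pi) * (\<integral>\<^sup>+(z::complex). \<integral>\<^sup>+t. ennreal (exp (- ((t\<^sup>2 + 1 / \<tau>) * (cmod z)\<^sup>2))) \<partial>lborel \<partial>lborel)"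
    by (rule nn_integral_cmult) measurable
  also have "(\<integral>\<^sup>+(z::complex). \<integral>\<^sup>+t. ennreal (exp (- ((t\<^sup>2 + 1 / \<tau>) * (cmod z)\<^sup>2))) \<partial>lborel \<partial>lborel) =
     (\<integral>\<^sup>+t. \<integral>\<^sup>+(z::complex). ennreal (exp (- ((t\<^sup>2 + 1 / \<tau>) * (cmod z)\<^sup>2))) \<partial>lborel \<partial>lborel)"
    by (rule lborel_pair.Fubini') measurable
  also have "\<dots> = (\<integral>\<^sup>+t. ennreal pi * ennreal (1 / (t\<^sup>2 + (1 / sqrt \<tau>)\<^sup>2)) \<partial>lborel)"
    using \<tau> by (intro nn_integral_cong) (subst nn_integral_gauss_complex,
      auto simp: add_nonneg_pos ennreal_mult'[symmetric] power_divide)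
  also have "\<dots> = ennreal pi * (\<integral>\<^sup>+t. ennreal (1 / (t\<^sup>2 + (1 / sqrt \<tau>)\<^sup>2)) \<partial>lborel)"
    by (rule nn_integral_cmult) measurable
  also have "\<dots> \<le> ennreal pi * ennreal (pi / (1 / sqrt \<tau>))"
    using \<tau> by (intro mult_left_mono nn_integral_inverse_quadratic_le) auto
  also have "ennreal (1 / sqrt pi) * (ennreal pi * ennreal (pi / (1 / sqrt \<tau>))) = ennreal (1 / sqrt pi * (pi * (pi * sqrt \<tau>)))"
    using \<tau> by (simp add: ennreal_mult'[symmetric])
  also have "1 / sqrt pi * (pi * (pi * sqrt \<tau>)) = pi * sqrt pi * sqrt \<tau>"
  proof -
    have "pi = sqrt pi * sqrt pi" by simp
    then show ?thesis by (simp add: divide_simps) 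
  qed
  finally show ?thesis by (simp add: mult_left_mono)
qed

text \<open>The weight \<open>1 / |z|\<close> contributes the order \<open>sqrt \<tau>\<close>. The
  disc of radius \<open>R\<close> adds an amount that does not grow with \<open>\<tau>\<close>,
  because its indicator is at most \<open>exp 1 * exp (- |z|\<^sup>2 / R\<^sup>2)\<close>. This is
  why raising the density there is free in the limit.\<close>

lemma radial_norm_bounds:
  assumes \<tau>: "0 < \<tau>" and A: "0 < A" and R: "0 < R"
  shows "ennreal (radial_norm A R \<tau>) =
      (\<integral>\<^sup>+z. ennreal (exp (- (cmod z)\<^sup>2 / \<tau>) * radial_weight A R (cmod z)) \<partial>lborel)" (is "_ = ?I")
    and "radial_norm A R \<tau> \<le> pi * sqrt pi * sqrt \<tau> + A * (pi * R\<^sup>2 * exp 1)"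
    and "0 < radial_norm A R \<tau>"
proof -
  let ?B = "pi * sqrt pi * sqrt \<tau> + A * (pi * R\<^sup>2 * exp 1)"
  have "?I \<le> (\<integral>\<^sup>+(z::complex). ennreal (exp (- (cmod z)\<^sup>2 / \<tau>) * (1 / cmod z)) + ennreal (A * exp 1) * ennreal (exp (- (1 / R\<^sup>2 * (cmod z)\<^sup>2))) \<partial>lborel)"
  proof (rule nn_integral_mono)
    fix z :: complex
    have "exp (- (cmod z)\<^sup>2 / \<tau>) * radial_weight A R (cmod z) \<le>
        exp (- (cmod z)\<^sup>2 / \<tau>) * (1 / cmod z) + A * exp 1 * exp (- (1 / R\<^sup>2 * (cmod z)\<^sup>2))"
    proof (cases "cmod z < R")
      case True
      then have "(cmod z)\<^sup>2 \<le> R\<^sup>2" by (intro power_mono) auto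
      then have "1 / R\<^sup>2 * (cmod z)\<^sup>2 \<le> 1" using R by simp
      then have "1 \<le> exp (1 - 1 / R\<^sup>2 * (cmod z)\<^sup>2)" by simp
      then have 1: "1 \<le> exp 1 * exp (- (1 / R\<^sup>2 * (cmod z)\<^sup>2))" by (simp add: exp_add[symmetric])
      have "exp (- (cmod z)\<^sup>2 / \<tau>) * A \<le> 1 * A" using \<tau> A by (intro mult_right_mono) auto
      also have "\<dots> \<le> A * (exp 1 * exp (- (1 / R\<^sup>2 * (cmod z)\<^sup>2)))"
        using mult_left_mono[OF 1, of A] A by simp
      finally show ?thesis using True by (simp add: radial_weight_def add_increasing mult.assoc)
    next
      case False
      then show ?thesis using A by (simp add: radial_weight_def)
    qed
    then show "ennreal (exp (- (cmod z)\<^sup>2 / \<tau>) * radial_weight A R (cmod z)) \<le>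
        ennreal (exp (- (cmod z)\<^sup>2 / \<tau>) * (1 / cmod z)) + ennreal (A * exp 1) * ennreal (exp (- (1 / R\<^sup>2 * (cmod z)\<^sup>2)))"
      using A by (simp add: ennreal_mult'[symmetric] ennreal_plus[symmetric] del: ennreal_plus)
  qed
  also have "\<dots> = (\<integral>\<^sup>+(z::complex). ennreal (exp (- (cmod z)\<^sup>2 / \<tau>) * (1 / cmod z)) \<partial>lborel) +
      (\<integral>\<^sup>+(z::complex). ennreal (A * exp 1) * ennreal (exp (- (1 / R\<^sup>2 * (cmod z)\<^sup>2))) \<partial>lborel)"
    by (rule nn_integral_add) measurable
  also have "(\<integral>\<^sup>+(z::complex). ennreal (A * exp 1) * ennreal (exp (- (1 / R\<^sup>2 * (cmod z)\<^sup>2))) \<partial>lborel)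
      = ennreal (A * exp 1) * ennreal (pi / (1 / R\<^sup>2))"
    by (subst nn_integral_cmult, measurable, subst nn_integral_gauss_complex) (use R in auto)
  also have "ennreal (A * exp 1) * ennreal (pi / (1 / R\<^sup>2)) = ennreal (A * (pi * R\<^sup>2 * exp 1))"
    using A by (simp add: ennreal_mult'[symmetric] mult_ac)
  finally have "?I \<le> (\<integral>\<^sup>+(z::complex). ennreal (exp (- (cmod z)\<^sup>2 / \<tau>) * (1 / cmod z)) \<partial>lborel) + ennreal (A * (pi * R\<^sup>2 * exp 1))" .
  also have "\<dots> \<le> ennreal (pi * sqrt pi * sqrt \<tau>) + ennreal (A * (pi * R\<^sup>2 * exp 1))"
    by (intro add_right_mono nn_integral_gauss_over_norm_le \<tau>)
  also have "\<dots> = ennreal ?B"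
    using A \<tau> by (simp add: ennreal_plus[symmetric] del: ennreal_plus)
  finally have up: "?I \<le> ennreal ?B" .
  show e: "ennreal (radial_norm A R \<tau>) = ?I"
    unfolding radial_norm_def using up by (intro ennreal_enn2real) (auto simp: le_less_trans)
  show "radial_norm A R \<tau> \<le> ?B"
    using up A \<tau> unfolding e[symmetric] by (subst (asm) ennreal_le_iff) auto
  have "?I \<noteq> 0"
  proof
    assume "?I = 0"
    then have "AE (z::complex) in lborel. ennreal (exp (- (cmod z)\<^sup>2 / \<tau>) * radial_weight A R (cmod z)) = 0"
      by (subst (asm) nn_integral_0_iff_AE) auto
    then have "AE (z::complex) in lborel. False"
    proof (rule AE_mp, intro AE_I2 impI)
      fix z :: complex assume "ennreal (exp (- (cmod z)\<^sup>2 / \<tau>) * radial_weight A R (cmod z)) = 0"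
      then show False using radial_weight_pos[OF A R, of "cmod z"] 
        by (metis ennreal_eq_0_iff exp_gt_zero mult_pos_pos not_le)
    qed
    then show False by (simp add: eventually_False ae_filter_eq_bot_iff)
  qed
  then have "0 < ennreal (radial_norm A R \<tau>)" unfolding e by (simp add: zero_less_iff_neq_zero)
  then show "0 < radial_norm A R \<tau>" by simp
qed

section \<open>Change of measure for one block\<close>

lemma sets_wrapped_normal [simp, measurable_cong]: "sets (wrapped_normal \<sigma>) = sets borel"
  by (simp add: wrapped_normal_def)

lemma space_wrapped_normal [simp]: "space (wrapped_normal \<sigma>) = UNIV"
  by (simp add: wrapped_normal_def)

abbreviation noise_block :: "nat \<Rightarrow> (nat \<Rightarrow> complex) measure" where
  "noise_block M \<equiv> PiM {..<M} (\<lambda>_. std_complex_normal)"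

abbreviation vec_borel :: "nat \<Rightarrow> (nat \<Rightarrow> complex) measure" where
  "vec_borel M \<equiv> PiM {..<M} (\<lambda>_. borel)"

section \<open>Change of measure and resampling in product spaces\<close>

lemma measurable_component_borel:
  assumes "m \<in> I" "sets (N m) = sets borel"
  shows "(\<lambda>x. x m) \<in> borel_measurable (PiM I N)"
  using measurable_component_singleton[OF assms(1), of N] measurable_cong_sets[OF refl assms(2)] by blast

text \<open>Reweighting and transporting every factor does the same to the product, as comparison on
  boxes shows. It is applied to the noise coordinates of a block, which are tilted so that the
  outputs follow the reference law.\<close>

lemma nn_integral_PiM_change_measure:
  fixes A :: "'i \<Rightarrow> 'a measure" and B :: "'i \<Rightarrow> 'b measure"
  assumes I: "finite I" and A: "product_sigma_finite A" and B: "product_sigma_finite B"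
    and T [measurable]: "\<And>i. i \<in> I \<Longrightarrow> T i \<in> measurable (A i) (B i)"
    and h [measurable]: "\<And>i. i \<in> I \<Longrightarrow> h i \<in> borel_measurable (A i)"
    and eq: "\<And>i. i \<in> I \<Longrightarrow> distr (density (A i) (h i)) (B i) (T i) = B i"
    and H [measurable]: "H \<in> borel_measurable (PiM I B)"
  shows "(\<integral>\<^sup>+a. (\<Prod>i\<in>I. h i (a i)) * H (\<lambda>i\<in>I. T i (a i)) \<partial>PiM I A) = (\<integral>\<^sup>+b. H b \<partial>PiM I B)"
proof -
  interpret A: product_sigma_finite A by fact
  interpret B: product_sigma_finite B by fact
  let ?T = "\<lambda>a. \<lambda>i\<in>I. T i (a i)" and ?h = "\<lambda>a. \<Prod>i\<in>I. h i (a i)"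
  have hm [measurable]: "?h \<in> borel_measurable (PiM I A)"
  proof (rule borel_measurable_prod_ennreal)
    fix i assume i: "i \<in> I"
    show "(\<lambda>a. h i (a i)) \<in> borel_measurable (PiM I A)"
      by (rule measurable_compose[OF measurable_component_singleton[OF i, of A] h[OF i]])
  qed
  have Tm [measurable]: "?T \<in> measurable (PiM I A) (PiM I B)"
  proof (rule measurable_restrict)
    fix i assume i: "i \<in> I"
    show "(\<lambda>a. T i (a i)) \<in> measurable (PiM I A) (B i)"
      by (rule measurable_compose[OF measurable_component_singleton[OF i, of A] T[OF i]])
  qed
  let ?D = "distr (density (PiM I A) ?h) (PiM I B) ?T"
  have "?D = PiM I B"
  proof (rule B.PiM_eqI[OF I])
    fix E assume E: "\<And>i. i \<in> I \<Longrightarrow> E i \<in> sets (B i)"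
    have [measurable]: "Pi\<^sub>E I E \<in> sets (PiM I B)" using E I by (intro sets_PiM_I_finite) auto
    have "emeasure ?D (Pi\<^sub>E I E) = (\<integral>\<^sup>+b. indicator (Pi\<^sub>E I E) b \<partial>?D)" by simp
    also have "\<dots> = (\<integral>\<^sup>+a. indicator (Pi\<^sub>E I E) (?T a) \<partial>density (PiM I A) ?h)"
      by (rule nn_integral_distr) auto
    also have "\<dots> = (\<integral>\<^sup>+a. ?h a * indicator (Pi\<^sub>E I E) (?T a) \<partial>PiM I A)"
      by (rule nn_integral_density) measurable
    also have "\<dots> = (\<integral>\<^sup>+a. (\<Prod>i\<in>I. h i (a i) * indicator (E i) (T i (a i))) \<partial>PiM I A)"
    proof (rule nn_integral_cong)
      fix a
      have "indicator (Pi\<^sub>E I E) (?T a) = (\<Prod>i\<in>I. indicator (E i) (T i (a i)) :: ennreal)"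
      proof (cases "\<forall>i\<in>I. T i (a i) \<in> E i")
        case False
        then have "(\<Prod>i\<in>I. indicator (E i) (T i (a i)) :: ennreal) = 0"
          by (intro prod_zero I) (auto simp: indicator_def)
        with False show ?thesis by (auto simp: indicator_def PiE_iff)
      qed (auto simp: indicator_def PiE_iff)
      then show "?h a * indicator (Pi\<^sub>E I E) (?T a) = (\<Prod>i\<in>I. h i (a i) * indicator (E i) (T i (a i)))"
        by (simp add: prod.distrib)
    qed
    also have "\<dots> = (\<Prod>i\<in>I. \<integral>\<^sup>+x. h i x * indicator (E i) (T i x) \<partial>A i)"
      by (rule A.product_nn_integral_prod[OF I]) (use E in measurable)
    also have "\<dots> = (\<Prod>i\<in>I. emeasure (B i) (E i))"
    proof (rule prod.cong[OF refl])
      fix i assume i: "i \<in> I"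
      note [measurable] = h[OF i] T[OF i] E[OF i]
      have "emeasure (B i) (E i) = (\<integral>\<^sup>+b. indicator (E i) b \<partial>distr (density (A i) (h i)) (B i) (T i))"
        using eq[OF i] E[OF i] by simp
      also have "\<dots> = (\<integral>\<^sup>+x. indicator (E i) (T i x) \<partial>density (A i) (h i))"
        by (rule nn_integral_distr) auto
      also have "\<dots> = (\<integral>\<^sup>+x. h i x * indicator (E i) (T i x) \<partial>A i)"
        by (rule nn_integral_density) measurable
      finally show "(\<integral>\<^sup>+x. h i x * indicator (E i) (T i x) \<partial>A i) = emeasure (B i) (E i)" ..
    qed
    finally show "emeasure ?D (Pi\<^sub>E I E) = (\<Prod>i\<in>I. emeasure (B i) (E i))" .
  qed simp
  then have "(\<integral>\<^sup>+b. H b \<partial>PiM I B) = (\<integral>\<^sup>+b. H b \<partial>?D)" by simp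
  also have "\<dots> = (\<integral>\<^sup>+a. H (?T a) \<partial>density (PiM I A) ?h)"
    by (rule nn_integral_distr) auto
  also have "\<dots> = (\<integral>\<^sup>+a. ?h a * H (?T a) \<partial>PiM I A)"
    by (rule nn_integral_density) measurable
  finally show ?thesis ..
qed

text \<open>Redrawing one coordinate independently preserves the product law. In this form a single
  block can be integrated out while the noise remains one infinite sequence, the same for every
  number of blocks.\<close>

lemma nn_integral_PiM_resample:
  assumes M: "\<And>i. i \<in> I \<Longrightarrow> prob_space (M i)" and i: "i \<in> I"
    and G [measurable]: "G \<in> borel_measurable (PiM I M)"
  shows "(\<integral>\<^sup>+d. G d \<partial>PiM I M) = (\<integral>\<^sup>+d. \<integral>\<^sup>+e. G (d(i := e)) \<partial>M i \<partial>PiM I M)"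
proof -
  interpret i: prob_space "M i" using M i by auto
  interpret PP: prob_space "PiM I M" using M by (rule prob_space_PiM)
  interpret pp: pair_prob_space "M i" "PiM I M" ..
  have ins: "insert i I = I" using i by auto
  have eq: "distr (M i \<Otimes>\<^sub>M PiM I M) (PiM I M) (\<lambda>(x, X). X(i := x)) = PiM I M"
    using distr_pair_PiM_eq_PiM[of I M i] M i by (simp add: ins)
  have [measurable]: "(\<lambda>(x, X). X(i := x)) \<in> measurable (M i \<Otimes>\<^sub>M PiM I M) (PiM I M)"
    using measurable_fun_upd[of I I i snd "M i \<Otimes>\<^sub>M PiM I M" M fst] i
    by (auto simp: case_prod_beta')
  have m: "(\<lambda>p. G ((snd p)(i := fst p))) \<in> borel_measurable (M i \<Otimes>\<^sub>M PiM I M)"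
    using measurable_compose[OF _ G, of "\<lambda>(x, X). X(i := x)" "M i \<Otimes>\<^sub>M PiM I M"] by (simp add: case_prod_beta')
  have "(\<integral>\<^sup>+d. G d \<partial>PiM I M) = (\<integral>\<^sup>+d. G d \<partial>distr (M i \<Otimes>\<^sub>M PiM I M) (PiM I M) (\<lambda>(x, X). X(i := x)))"
    by (simp only: eq)
  also have "\<dots> = (\<integral>\<^sup>+p. G ((snd p)(i := fst p)) \<partial>(M i \<Otimes>\<^sub>M PiM I M))"
    by (subst nn_integral_distr) (auto simp: case_prod_beta')
  also have "\<dots> = (\<integral>\<^sup>+d. \<integral>\<^sup>+e. G (d(i := e)) \<partial>M i \<partial>PiM I M)"
    using pp.nn_integral_snd[OF m] by simp
  finally show ?thesis .
qed

definition out_density :: "real \<Rightarrow> real \<Rightarrow> real \<Rightarrow> nat \<Rightarrow> complex \<Rightarrow> real" where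
  "out_density A R \<tau> m z = (if m < 2 then exp (- (cmod z)\<^sup>2 / \<tau>) * radial_weight A R (cmod z) / radial_norm A R \<tau>
     else exp (- (cmod z)\<^sup>2 / \<tau>) / (pi * \<tau>))"

lemma out_density_measurable [measurable]: "out_density A R \<tau> m \<in> borel_measurable borel"
  unfolding out_density_def by measurable

definition out_measure :: "real \<Rightarrow> real \<Rightarrow> real \<Rightarrow> nat \<Rightarrow> complex measure" where
  "out_measure A R \<tau> m = density lborel (\<lambda>z. ennreal (out_density A R \<tau> m z))"

lemma sets_out_measure [simp, measurable_cong]: "sets (out_measure A R \<tau> m) = sets borel"
  by (simp add: out_measure_def)

lemma space_out_measure [simp]: "space (out_measure A R \<tau> m) = UNIV"
  by (simp add: out_measure_def)

text \<open>Likelihood ratio of one block between the true law of (phase increments, noise) and the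
  product of the output measure with the phase posteriors.\<close>

definition block_lik :: "(real \<Rightarrow> real) \<Rightarrow> (real \<Rightarrow> real) \<Rightarrow> real \<Rightarrow> real \<Rightarrow> real \<Rightarrow> real \<Rightarrow> nat \<Rightarrow>
    (nat \<Rightarrow> complex) \<Rightarrow> real \<Rightarrow> real \<Rightarrow> real \<Rightarrow> real \<Rightarrow> (nat \<Rightarrow> complex) \<Rightarrow> real" where
  "block_lik fc fr \<kappa> A R \<tau> M \<xi> \<delta>c \<delta>r \<theta>c \<theta>r w =
     1 / fc \<delta>c * (1 / fr \<delta>r) *
     ((\<Prod>m<M. out_density A R \<tau> m (cis (wrap_pi (\<theta>c + real m * \<theta>r)) * \<xi> m + w m) / cgauss (w m)) *
      (phase_posterior \<kappa> (\<xi> 0) (cis \<theta>c * \<xi> 0 + w 0) \<theta>c *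
       phase_posterior \<kappa> (\<xi> 1) (cis (\<theta>c + \<theta>r) * \<xi> 1 + w 1) (\<theta>c + \<theta>r)))"

text \<open>\<open>lo\<close> and \<open>hi\<close> bound both increment densities at once. The
  remaining parameters are left free: the estimate needs a careful choice of them, whereas absolute
  continuity follows from any choice.\<close>

locale dual_bound =
  fixes M :: nat and \<sigma>c \<sigma>r \<kappa> A R \<tau> lo hi :: real and fc fr :: "real \<Rightarrow> real"
  assumes M: "2 \<le> M" and \<sigma>: "0 < \<sigma>c" "0 < \<sigma>r" and pos: "0 < A" "0 < R" "0 < \<tau>" and lo: "0 < lo"
    and \<kappa>: "0 < \<kappa>" "\<kappa> < 1"
    and fc_m [measurable]: "fc \<in> borel_measurable borel" and fr_m [measurable]: "fr \<in> borel_measurable borel"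
    and fc: "\<And>t. lo \<le> fc t" "\<And>t. fc t \<le> hi" "wrapped_normal \<sigma>c = density circle_lborel (\<lambda>t. ennreal (fc t))"
    and fr: "\<And>t. lo \<le> fr t" "\<And>t. fr t \<le> hi" "wrapped_normal \<sigma>r = density circle_lborel (\<lambda>t. ennreal (fr t))"
begin

abbreviation "outd \<equiv> out_density A R \<tau>"
abbreviation "outM \<equiv> out_measure A R \<tau>"
abbreviation "outV \<equiv> PiM {..<M} outM"
abbreviation "lik \<equiv> block_lik fc fr \<kappa> A R \<tau> M"

lemma fc_pos: "0 < fc t" and fr_pos: "0 < fr t"
  using fc(1)[of t] fr(1)[of t] lo by linarith+

lemma outd_pos: "0 < outd m z"
  unfolding out_density_def
  using pos radial_weight_pos[OF pos(1,2)] radial_norm_bounds(3)[OF pos(3,1,2)] by simp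

lemma prob_space_outM: "prob_space (outM m)"
proof
  have "emeasure (outM m) (space (outM m)) = (\<integral>\<^sup>+z. ennreal (outd m z) \<partial>lborel)"
    by (simp add: out_measure_def emeasure_density)
  also have "\<dots> = 1"
  proof (cases "m < 2")
    case True
    have n: "0 < radial_norm A R \<tau>" by (rule radial_norm_bounds(3)) (rule pos)+
    have "(\<integral>\<^sup>+z. ennreal (outd m z) \<partial>lborel) =
        (\<integral>\<^sup>+z. ennreal (exp (- (cmod z)\<^sup>2 / \<tau>) * radial_weight A R (cmod z)) / ennreal (radial_norm A R \<tau>) \<partial>lborel)"
      using True n radial_weight_pos[OF pos(1,2)]
      by (intro nn_integral_cong) (simp add: out_density_def divide_ennreal less_imp_le)
    also have "\<dots> = ennreal (radial_norm A R \<tau>) / ennreal (radial_norm A R \<tau>)"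
      by (subst nn_integral_divide) (auto simp: radial_norm_bounds(1)[OF pos(3,1,2)])
    also have "\<dots> = 1" using n by (simp add: ennreal_divide_self)
    finally show ?thesis .
  next
    case False
    have "(\<integral>\<^sup>+z. ennreal (outd m z) \<partial>lborel) =
        (\<integral>\<^sup>+(z::complex). ennreal (exp (- (1 / \<tau> * (cmod z)\<^sup>2))) * ennreal (1 / (pi * \<tau>)) \<partial>lborel)"
      using False pos by (intro nn_integral_cong) (simp add: out_density_def ennreal_mult'[symmetric])
    also have "\<dots> = ennreal (pi / (1 / \<tau>)) * ennreal (1 / (pi * \<tau>))"
      by (subst nn_integral_multc, measurable, subst nn_integral_gauss_complex) (use pos in auto)
    also have "\<dots> = 1" using pos by (simp add: ennreal_mult'[symmetric])
    finally show ?thesis .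
  qed
  finally show "emeasure (outM m) (space (outM m)) = 1" .
qed

lemma product_sigma_finite_outM: "product_sigma_finite outM"
  by (intro product_sigma_finite.intro prob_space_imp_sigma_finite prob_space_outM)

lemma noise_ratio_measurable:
  "(\<lambda>w. ennreal (outd m (c + w) / cgauss w)) \<in> borel_measurable std_complex_normal"
  by measurable

text \<open>Tilted by the ratio of the output density to the noise density, the received value
  \<open>c + w\<close> follows the output law whatever the centre \<open>c\<close> is. Hence input
  and phase disappear from the result.\<close>

lemma distr_noise_outM:
  "distr (density std_complex_normal (\<lambda>w. ennreal (outd m (c + w) / cgauss w))) (outM m) (\<lambda>w. c + w) = outM m"
proof (rule measure_eqI_nn_integral)
  let ?D = "density std_complex_normal (\<lambda>w. ennreal (outd m (c + w) / cgauss w))"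
  fix g :: "complex \<Rightarrow> ennreal" assume "g \<in> borel_measurable (distr ?D (outM m) (\<lambda>w. c + w))"
  then have [measurable]: "g \<in> borel_measurable borel" by (simp cong: measurable_cong_sets)
  have "(\<integral>\<^sup>+y. g y \<partial>distr ?D (outM m) (\<lambda>w. c + w)) = (\<integral>\<^sup>+w. g (c + w) \<partial>?D)"
    by (rule nn_integral_distr) auto
  also have "\<dots> = (\<integral>\<^sup>+w. ennreal (outd m (c + w) / cgauss w) * g (c + w) \<partial>std_complex_normal)"
    by (rule nn_integral_density) measurable
  also have "\<dots> = (\<integral>\<^sup>+w. ennreal (cgauss w) * (ennreal (outd m (c + w) / cgauss w) * g (c + w)) \<partial>lborel)"
    unfolding std_complex_normal_density by (rule nn_integral_density) measurable
  also have "\<dots> = (\<integral>\<^sup>+w. ennreal (outd m (w + c)) * g (w + c) \<partial>lborel)"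
    using cgauss_pos outd_pos
    by (intro nn_integral_cong)
      (simp add: mult.assoc[symmetric] ennreal_mult'[symmetric] less_imp_le less_imp_neq[symmetric] add.commute)
  also have "\<dots> = (\<integral>\<^sup>+w. ennreal (outd m w) * g w \<partial>lborel)"
    by (rule nn_integral_lborel_translate[of "\<lambda>w. ennreal (outd m w) * g w"]) measurable
  finally show "(\<integral>\<^sup>+y. g y \<partial>distr ?D (outM m) (\<lambda>w. c + w)) = (\<integral>\<^sup>+y. g y \<partial>outM m)"
    by (simp add: out_measure_def nn_integral_density)
qed simp

text \<open>Dividing by the increment density leaves Lebesgue measure on the circle, and rotation
  invariance then forgets the previous phase \<open>a\<close>. This removes the memory of the phase
  processes.\<close>

lemma nn_integral_wrapped_normal_divide:
  assumes [measurable]: "H \<in> borel_measurable borel"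
  shows "(\<integral>\<^sup>+\<delta>. ennreal (1 / fc \<delta>) * H (wrap_pi (\<delta> + a)) \<partial>wrapped_normal \<sigma>c) = (\<integral>\<^sup>+\<theta>. H \<theta> \<partial>circle_lborel)"
    and "(\<integral>\<^sup>+\<delta>. ennreal (1 / fr \<delta>) * H (wrap_pi (\<delta> + a)) \<partial>wrapped_normal \<sigma>r) = (\<integral>\<^sup>+\<theta>. H \<theta> \<partial>circle_lborel)"
proof -
  have "(\<integral>\<^sup>+\<delta>. ennreal (1 / f \<delta>) * H (wrap_pi (\<delta> + a)) \<partial>density circle_lborel (\<lambda>t. ennreal (f t))) = (\<integral>\<^sup>+\<theta>. H \<theta> \<partial>circle_lborel)"
    if [measurable]: "f \<in> borel_measurable borel" and p: "\<And>t. 0 < f t" for f :: "real \<Rightarrow> real"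
  proof -
    have "(\<integral>\<^sup>+\<delta>. ennreal (1 / f \<delta>) * H (wrap_pi (\<delta> + a)) \<partial>density circle_lborel (\<lambda>t. ennreal (f t)))
      = (\<integral>\<^sup>+\<delta>. ennreal (f \<delta>) * (ennreal (1 / f \<delta>) * H (wrap_pi (\<delta> + a))) \<partial>circle_lborel)"
      by (rule nn_integral_density) measurable
    also have "\<dots> = (\<integral>\<^sup>+\<delta>. H (wrap_pi (\<delta> + a)) \<partial>circle_lborel)"
      using p by (intro nn_integral_cong)
        (simp add: mult.assoc[symmetric] ennreal_mult'[symmetric] less_imp_le less_imp_neq[symmetric])
    finally show ?thesis by (simp add: nn_integral_circle_lborel_rotate)
  qed
  from this[OF fc_m fc_pos] this[OF fr_m fr_pos]
  show "(\<integral>\<^sup>+\<delta>. ennreal (1 / fc \<delta>) * H (wrap_pi (\<delta> + a)) \<partial>wrapped_normal \<sigma>c) = (\<integral>\<^sup>+\<theta>. H \<theta> \<partial>circle_lborel)"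
    and "(\<integral>\<^sup>+\<delta>. ennreal (1 / fr \<delta>) * H (wrap_pi (\<delta> + a)) \<partial>wrapped_normal \<sigma>r) = (\<integral>\<^sup>+\<theta>. H \<theta> \<partial>circle_lborel)"
    by (simp_all add: fc fr)
qed

text \<open>The noise is integrated first, with the phases held fixed. The two posteriors depend on
  the noise through the outputs only, so they travel along with \<open>F\<close>.\<close>

lemma nn_integral_noise_lik:
  assumes F [measurable]: "F \<in> borel_measurable (vec_borel M)"
  shows "(\<integral>\<^sup>+w. F (\<lambda>m\<in>{..<M}. cis (wrap_pi (\<theta>c + real m * \<theta>r)) * \<xi> m + w m) * ennreal (lik \<xi> \<delta>c \<delta>r \<theta>c \<theta>r w)
      \<partial>noise_block M) =
    ennreal (1 / fc \<delta>c) * (ennreal (1 / fr \<delta>r) *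
     (\<integral>\<^sup>+y. F y * (ennreal (phase_posterior \<kappa> (\<xi> 0) (y 0) \<theta>c) * ennreal (phase_posterior \<kappa> (\<xi> 1) (y 1) (\<theta>c + \<theta>r))) \<partial>outV))"
proof -
  let ?c = "\<lambda>m. cis (wrap_pi (\<theta>c + real m * \<theta>r)) * \<xi> m"
  let ?T = "\<lambda>w. \<lambda>m\<in>{..<M}. ?c m + w m"
  let ?H = "\<lambda>y. F y * (ennreal (phase_posterior \<kappa> (\<xi> 0) (y 0) \<theta>c) * ennreal (phase_posterior \<kappa> (\<xi> 1) (y 1) (\<theta>c + \<theta>r)))"
  have s: "sets (outV) = sets (vec_borel M)"
    by (intro sets_PiM_cong) auto
  have Fm [measurable]: "F \<in> borel_measurable (outV)"
    using F measurable_cong_sets[OF s refl] by blast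
  have c01 [measurable]: "(\<lambda>y. y 0) \<in> borel_measurable (outV)" "(\<lambda>y. y 1) \<in> borel_measurable (outV)"
    using M by (auto intro!: measurable_component_singleton[of _ _ outM, simplified measurable_cong_sets[OF refl sets_out_measure]])
  have Hm: "?H \<in> borel_measurable (outV)" by measurable
  have lik: "ennreal (lik \<xi> \<delta>c \<delta>r \<theta>c \<theta>r w) = ennreal (1 / fc \<delta>c) * (ennreal (1 / fr \<delta>r) *
      ((\<Prod>m<M. ennreal (outd m (?c m + w m) / cgauss (w m))) *
       (ennreal (phase_posterior \<kappa> (\<xi> 0) (?T w 0) \<theta>c) * ennreal (phase_posterior \<kappa> (\<xi> 1) (?T w 1) (\<theta>c + \<theta>r)))))" for w
  proof -
    have "(\<Prod>m<M. ennreal (outd m (?c m + w m) / cgauss (w m))) = ennreal (\<Prod>m<M. outd m (?c m + w m) / cgauss (w m))"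
      using outd_pos cgauss_pos by (intro prod_ennreal) (simp add: less_imp_le)
    moreover have "?T w 0 = cis \<theta>c * \<xi> 0 + w 0" "?T w 1 = cis (\<theta>c + \<theta>r) * \<xi> 1 + w 1" using M by auto
    moreover have "0 \<le> (\<Prod>m<M. outd m (?c m + w m) / cgauss (w m))"
      using outd_pos cgauss_pos by (intro prod_nonneg) (simp add: less_imp_le)
    moreover have "0 \<le> 1 / fc \<delta>c" "0 \<le> 1 / fr \<delta>r"
      using fc_pos[of \<delta>c] fr_pos[of \<delta>r] by auto
    ultimately show ?thesis
      unfolding block_lik_def
      by (simp only: mult.assoc ennreal_mult' ennreal_mult'[OF less_imp_le[OF phase_posterior_pos]])
  qed
  have "(\<integral>\<^sup>+w. F (?T w) * ennreal (lik \<xi> \<delta>c \<delta>r \<theta>c \<theta>r w) \<partial>noise_block M) =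
    (\<integral>\<^sup>+w. ennreal (1 / fc \<delta>c) * (ennreal (1 / fr \<delta>r) * ((\<Prod>m<M. ennreal (outd m (?c m + w m) / cgauss (w m))) * ?H (?T w))) \<partial>noise_block M)"
    unfolding lik by (intro nn_integral_cong) (simp only: mult_ac)
  also have "\<dots> = ennreal (1 / fc \<delta>c) * (ennreal (1 / fr \<delta>r) *
      (\<integral>\<^sup>+w. (\<Prod>m<M. ennreal (outd m (?c m + w m) / cgauss (w m))) * ?H (?T w) \<partial>noise_block M))"
  proof -
    have [measurable]: "?T \<in> measurable (noise_block M) (outV)"
      by (intro measurable_restrict) (auto intro!: borel_measurable_add measurable_component_borel
        simp: measurable_cong_sets[OF refl sets_out_measure])
    have [measurable]: "(\<lambda>w. ?H (?T w)) \<in> borel_measurable (noise_block M)"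
      by (rule measurable_compose[OF _ Hm]) measurable
    have [measurable]: "(\<lambda>w. \<Prod>m<M. ennreal (outd m (?c m + w m) / cgauss (w m))) \<in> borel_measurable (noise_block M)"
    proof (rule borel_measurable_prod_ennreal)
      fix m assume m: "m \<in> {..<M}"
      have [measurable]: "(\<lambda>w. w m) \<in> borel_measurable (noise_block M)"
        by (rule measurable_component_borel[OF m]) simp
      show "(\<lambda>w. ennreal (outd m (?c m + w m) / cgauss (w m))) \<in> borel_measurable (noise_block M)"
        by measurable
    qed
    show ?thesis by (subst nn_integral_cmult, measurable, subst nn_integral_cmult, measurable)
  qed
  also have "(\<integral>\<^sup>+w. (\<Prod>m<M. ennreal (outd m (?c m + w m) / cgauss (w m))) * ?H (?T w) \<partial>noise_block M)
     = (\<integral>\<^sup>+y. ?H y \<partial>outV)"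
  proof (rule nn_integral_PiM_change_measure[where B = outM and A = "\<lambda>_. std_complex_normal"
          and T = "\<lambda>m w. ?c m + w" and h = "\<lambda>m w. ennreal (outd m (?c m + w) / cgauss w)"])
    show "product_sigma_finite (\<lambda>_::nat. std_complex_normal)"
      by (intro product_sigma_finite.intro prob_space_imp_sigma_finite prob_space_std_complex_normal)
    show "(\<lambda>w. ?c m + w) \<in> measurable std_complex_normal (outM m)" for m by measurable
    show "(\<lambda>w. ennreal (outd m (?c m + w) / cgauss w)) \<in> borel_measurable std_complex_normal" for m
      by (rule noise_ratio_measurable)
  qed (simp_all add: product_sigma_finite_outM distr_noise_outM Hm del: cis_wrap_pi One_nat_def)
  finally show ?thesis .
qed

text \<open>Neither the input nor the previous phases \<open>a\<close> and \<open>b\<close> survive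
  on the right, which is what allows the induction over blocks. Once both phases range freely over
  the circle, the posterior of \<open>\<theta>c + \<theta>r\<close> integrates to 1 in
  \<open>\<theta>r\<close> for fixed \<open>\<theta>c\<close>, and afterwards the posterior of
  \<open>\<theta>c\<close> integrates to 1. Coordinates 0 and 1 thus determine the pair through a
  triangular change of variables of determinant 1.\<close>

lemma nn_integral_block_lik:
  assumes F [measurable]: "F \<in> borel_measurable (vec_borel M)"
  shows "(\<integral>\<^sup>+\<delta>c. \<integral>\<^sup>+\<delta>r. \<integral>\<^sup>+w.
      F (\<lambda>m\<in>{..<M}. cis (wrap_pi (wrap_pi (\<delta>c + a) + real m * wrap_pi (\<delta>r + b))) * \<xi> m + w m) *
      ennreal (lik \<xi> \<delta>c \<delta>r (wrap_pi (\<delta>c + a)) (wrap_pi (\<delta>r + b)) w)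
      \<partial>noise_block M \<partial>wrapped_normal \<sigma>r \<partial>wrapped_normal \<sigma>c) = (\<integral>\<^sup>+y. F y \<partial>outV)"
proof -
  let ?p0 = "\<lambda>y \<theta>c. ennreal (phase_posterior \<kappa> (\<xi> 0) (y 0) \<theta>c)"
  let ?p1 = "\<lambda>y \<theta>c \<theta>r. ennreal (phase_posterior \<kappa> (\<xi> 1) (y 1) (\<theta>c + \<theta>r))"
  let ?J = "\<lambda>\<theta>c \<theta>r. \<integral>\<^sup>+y. F y * (?p0 y \<theta>c * ?p1 y \<theta>c \<theta>r) \<partial>outV"
  interpret O: prob_space "outV" by (intro prob_space_PiM prob_space_outM)
  interpret a: finite_measure circle_lborel by (rule finite_measure_circle_lborel)
  interpret Oa: pair_sigma_finite "outV" circle_lborel ..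
  interpret aO: pair_sigma_finite circle_lborel "outV" ..
  have s: "sets (outV) = sets (vec_borel M)"
    by (intro sets_PiM_cong) auto
  have Fm [measurable]: "F \<in> borel_measurable (outV)"
    using F measurable_cong_sets[OF s refl] by blast
  have c01 [measurable]: "(\<lambda>y. y 0) \<in> borel_measurable (outV)" "(\<lambda>y. y 1) \<in> borel_measurable (outV)"
    using M by (auto intro!: measurable_component_singleton[of _ _ outM, simplified measurable_cong_sets[OF refl sets_out_measure]])
  have Jm [measurable]: "(\<lambda>p. ?J (fst p) (snd p)) \<in> borel_measurable (borel \<Otimes>\<^sub>M borel)"
    by measurable
  have "(\<integral>\<^sup>+\<delta>c. \<integral>\<^sup>+\<delta>r. \<integral>\<^sup>+w.
      F (\<lambda>m\<in>{..<M}. cis (wrap_pi (wrap_pi (\<delta>c + a) + real m * wrap_pi (\<delta>r + b))) * \<xi> m + w m) *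
      ennreal (lik \<xi> \<delta>c \<delta>r (wrap_pi (\<delta>c + a)) (wrap_pi (\<delta>r + b)) w)
      \<partial>noise_block M \<partial>wrapped_normal \<sigma>r \<partial>wrapped_normal \<sigma>c)
    = (\<integral>\<^sup>+\<delta>c. \<integral>\<^sup>+\<delta>r. ennreal (1 / fc \<delta>c) * (ennreal (1 / fr \<delta>r) * ?J (wrap_pi (\<delta>c + a)) (wrap_pi (\<delta>r + b))) \<partial>wrapped_normal \<sigma>r \<partial>wrapped_normal \<sigma>c)"
    by (simp only: nn_integral_noise_lik[OF F])
  also have "\<dots> = (\<integral>\<^sup>+\<delta>c. ennreal (1 / fc \<delta>c) * (\<integral>\<^sup>+\<delta>r. ennreal (1 / fr \<delta>r) * ?J (wrap_pi (\<delta>c + a)) (wrap_pi (\<delta>r + b)) \<partial>wrapped_normal \<sigma>r) \<partial>wrapped_normal \<sigma>c)"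
    by (intro nn_integral_cong nn_integral_cmult) measurable
  also have "\<dots> = (\<integral>\<^sup>+\<delta>c. ennreal (1 / fc \<delta>c) * (\<integral>\<^sup>+\<theta>r. ?J (wrap_pi (\<delta>c + a)) \<theta>r \<partial>circle_lborel) \<partial>wrapped_normal \<sigma>c)"
  proof (intro nn_integral_cong)
    fix \<delta>c
    have "(\<integral>\<^sup>+\<delta>r. ennreal (1 / fr \<delta>r) * ?J (wrap_pi (\<delta>c + a)) (wrap_pi (\<delta>r + b)) \<partial>wrapped_normal \<sigma>r) =
        (\<integral>\<^sup>+\<theta>r. ?J (wrap_pi (\<delta>c + a)) \<theta>r \<partial>circle_lborel)"
      by (rule nn_integral_wrapped_normal_divide(2)[of "?J (wrap_pi (\<delta>c + a))"]) measurable
    then show "ennreal (1 / fc \<delta>c) * (\<integral>\<^sup>+\<delta>r. ennreal (1 / fr \<delta>r) * ?J (wrap_pi (\<delta>c + a)) (wrap_pi (\<delta>r + b)) \<partial>wrapped_normal \<sigma>r) =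
        ennreal (1 / fc \<delta>c) * (\<integral>\<^sup>+\<theta>r. ?J (wrap_pi (\<delta>c + a)) \<theta>r \<partial>circle_lborel)" by (simp only:)
  qed
  also have "\<dots> = (\<integral>\<^sup>+\<theta>c. \<integral>\<^sup>+\<theta>r. ?J \<theta>c \<theta>r \<partial>circle_lborel \<partial>circle_lborel)"
    by (rule nn_integral_wrapped_normal_divide(1)[of "\<lambda>\<theta>c. \<integral>\<^sup>+\<theta>r. ?J \<theta>c \<theta>r \<partial>circle_lborel"]) measurable
  also have "\<dots> = (\<integral>\<^sup>+\<theta>c. \<integral>\<^sup>+y. \<integral>\<^sup>+\<theta>r. F y * (?p0 y \<theta>c * ?p1 y \<theta>c \<theta>r) \<partial>circle_lborel \<partial>outV \<partial>circle_lborel)"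
    by (intro nn_integral_cong Oa.Fubini') measurable
  also have "\<dots> = (\<integral>\<^sup>+\<theta>c. \<integral>\<^sup>+y. F y * ?p0 y \<theta>c \<partial>outV \<partial>circle_lborel)"
  proof (intro nn_integral_cong)
    fix \<theta>c y
    have "(\<integral>\<^sup>+\<theta>r. F y * (?p0 y \<theta>c * ?p1 y \<theta>c \<theta>r) \<partial>circle_lborel) = (\<integral>\<^sup>+\<theta>r. (F y * ?p0 y \<theta>c) * ?p1 y \<theta>c \<theta>r \<partial>circle_lborel)"
      by (simp only: mult.assoc)
    also have "\<dots> = F y * ?p0 y \<theta>c * (\<integral>\<^sup>+\<theta>r. ?p1 y \<theta>c \<theta>r \<partial>circle_lborel)"
      by (rule nn_integral_cmult) measurable
    also have "(\<integral>\<^sup>+\<theta>r. ?p1 y \<theta>c \<theta>r \<partial>circle_lborel) = 1"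
      using nn_integral_phase_posterior[of \<kappa> "\<xi> 1" "y 1" \<theta>c] by (simp add: add.commute)
    finally show "(\<integral>\<^sup>+\<theta>r. F y * (?p0 y \<theta>c * ?p1 y \<theta>c \<theta>r) \<partial>circle_lborel) = F y * ?p0 y \<theta>c" by simp
  qed
  also have "\<dots> = (\<integral>\<^sup>+y. \<integral>\<^sup>+\<theta>c. F y * ?p0 y \<theta>c \<partial>circle_lborel \<partial>outV)"
    by (rule aO.Fubini'[symmetric]) measurable
  also have "\<dots> = (\<integral>\<^sup>+y. F y \<partial>outV)"
  proof (intro nn_integral_cong)
    fix y
    have "(\<integral>\<^sup>+\<theta>c. F y * ?p0 y \<theta>c \<partial>circle_lborel) = F y * (\<integral>\<^sup>+\<theta>c. ?p0 y \<theta>c \<partial>circle_lborel)"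
      by (rule nn_integral_cmult) measurable
    also have "(\<integral>\<^sup>+\<theta>c. ?p0 y \<theta>c \<partial>circle_lborel) = 1"
      using nn_integral_phase_posterior[of \<kappa> "\<xi> 0" "y 0" 0] by simp
    finally show "(\<integral>\<^sup>+\<theta>c. F y * ?p0 y \<theta>c \<partial>circle_lborel) = F y" by simp
  qed
  finally show ?thesis .
qed

end

section \<open>Change of measure for a sequence of blocks\<close>

text \<open>Two invariances under redrawing combine into one for the product: Fubini moves the fresh
  draw for the first component past the second component.\<close>

lemma resample_pair:
  assumes N1: "sigma_finite_measure N1" and N2: "sigma_finite_measure N2"
    and E1: "sigma_finite_measure E1" and E2: "sigma_finite_measure E2"
    and u1 [measurable]: "(\<lambda>p. u1 (fst p) (snd p)) \<in> measurable (N1 \<Otimes>\<^sub>M E1) N1"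
    and u2 [measurable]: "(\<lambda>p. u2 (fst p) (snd p)) \<in> measurable (N2 \<Otimes>\<^sub>M E2) N2"
    and r1: "\<And>G. G \<in> borel_measurable N1 \<Longrightarrow> (\<integral>\<^sup>+x. G x \<partial>N1) = (\<integral>\<^sup>+x. \<integral>\<^sup>+e. G (u1 x e) \<partial>E1 \<partial>N1)"
    and r2: "\<And>G. G \<in> borel_measurable N2 \<Longrightarrow> (\<integral>\<^sup>+x. G x \<partial>N2) = (\<integral>\<^sup>+x. \<integral>\<^sup>+e. G (u2 x e) \<partial>E2 \<partial>N2)"
    and G: "G \<in> borel_measurable (N1 \<Otimes>\<^sub>M N2)"
  shows "(\<integral>\<^sup>+p. G p \<partial>(N1 \<Otimes>\<^sub>M N2)) =
    (\<integral>\<^sup>+p. \<integral>\<^sup>+e. G (u1 (fst p) (fst e), u2 (snd p) (snd e)) \<partial>(E1 \<Otimes>\<^sub>M E2) \<partial>(N1 \<Otimes>\<^sub>M N2))"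
proof -
  interpret N1: sigma_finite_measure N1 by fact
  interpret N2: sigma_finite_measure N2 by fact
  interpret E1: sigma_finite_measure E1 by fact
  interpret E2: sigma_finite_measure E2 by fact
  interpret E12: pair_sigma_finite E1 E2 ..
  interpret N2E1: pair_sigma_finite N2 E1 ..
  interpret E1N2: pair_sigma_finite E1 N2 ..
  have E12sf: "sigma_finite_measure (E1 \<Otimes>\<^sub>M E2)" ..
  define g where "g = (\<lambda>x1 x2. G (x1, x2))"
  have g [measurable]: "(\<lambda>p. g (fst p) (snd p)) \<in> borel_measurable (N1 \<Otimes>\<^sub>M N2)"
    using G by (simp add: g_def)
  have g': "(\<lambda>z. g (a z) (b z)) \<in> borel_measurable Z"
    if "a \<in> measurable Z N1" "b \<in> measurable Z N2" for a b and Z :: "'z measure"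
    using measurable_compose[OF measurable_Pair[OF that] g] by simp
  have u1': "(\<lambda>z. u1 (a z) (b z)) \<in> measurable Z N1"
    if "a \<in> measurable Z N1" "b \<in> measurable Z E1" for a b and Z :: "'z measure"
    using measurable_compose[OF measurable_Pair[OF that] u1] by simp
  have u2': "(\<lambda>z. u2 (a z) (b z)) \<in> measurable Z N2"
    if "a \<in> measurable Z N2" "b \<in> measurable Z E2" for a b and Z :: "'z measure"
    using measurable_compose[OF measurable_Pair[OF that] u2] by simp
  have e1m: "(\<lambda>x2. g (u1 x1 e1) x2) \<in> borel_measurable N2"
    if "x1 \<in> space N1" "e1 \<in> space E1" for x1 e1
    using that by (intro g' u1') auto
  have "(\<integral>\<^sup>+p. \<integral>\<^sup>+e. g (u1 (fst p) (fst e)) (u2 (snd p) (snd e)) \<partial>(E1 \<Otimes>\<^sub>M E2) \<partial>(N1 \<Otimes>\<^sub>M N2))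
    = (\<integral>\<^sup>+x1. \<integral>\<^sup>+x2. \<integral>\<^sup>+e. g (u1 x1 (fst e)) (u2 x2 (snd e)) \<partial>(E1 \<Otimes>\<^sub>M E2) \<partial>N2 \<partial>N1)"
    by (subst N2.nn_integral_fst[symmetric], rule sigma_finite_measure.borel_measurable_nn_integral[OF E12sf],
        unfold case_prod_beta', intro g' u1' u2') auto
  also have "\<dots> = (\<integral>\<^sup>+x1. \<integral>\<^sup>+x2. \<integral>\<^sup>+e1. \<integral>\<^sup>+e2. g (u1 x1 e1) (u2 x2 e2) \<partial>E2 \<partial>E1 \<partial>N2 \<partial>N1)"
  proof (intro nn_integral_cong)
    fix x1 x2 assume [measurable]: "x1 \<in> space N1" "x2 \<in> space N2"
    show "(\<integral>\<^sup>+e. g (u1 x1 (fst e)) (u2 x2 (snd e)) \<partial>(E1 \<Otimes>\<^sub>M E2)) = (\<integral>\<^sup>+e1. \<integral>\<^sup>+e2. g (u1 x1 e1) (u2 x2 e2) \<partial>E2 \<partial>E1)"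
      by (subst E2.nn_integral_fst[symmetric]) (auto intro!: g' u1' u2')
  qed
  also have "\<dots> = (\<integral>\<^sup>+x1. \<integral>\<^sup>+e1. \<integral>\<^sup>+x2. \<integral>\<^sup>+e2. g (u1 x1 e1) (u2 x2 e2) \<partial>E2 \<partial>N2 \<partial>E1 \<partial>N1)"
  proof (intro nn_integral_cong E1N2.Fubini')
    fix x1 assume x1: "x1 \<in> space N1"
    show "(\<lambda>(e1, x2). \<integral>\<^sup>+e2. g (u1 x1 e1) (u2 x2 e2) \<partial>E2) \<in> borel_measurable (E1 \<Otimes>\<^sub>M N2)"
      unfolding case_prod_beta'
      by (rule E2.borel_measurable_nn_integral, unfold case_prod_beta', intro g' u1' u2') (use x1 in auto)
  qed
  also have "\<dots> = (\<integral>\<^sup>+x1. \<integral>\<^sup>+e1. \<integral>\<^sup>+x2. g (u1 x1 e1) x2 \<partial>N2 \<partial>E1 \<partial>N1)"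
    by (intro nn_integral_cong r2[symmetric] e1m)
  also have "\<dots> = (\<integral>\<^sup>+x1. \<integral>\<^sup>+x2. g x1 x2 \<partial>N2 \<partial>N1)"
    by (rule r1[symmetric]) (rule N2.borel_measurable_nn_integral, simp add: g_def G split_beta')
  also have "\<dots> = (\<integral>\<^sup>+p. G p \<partial>(N1 \<Otimes>\<^sub>M N2))"
    unfolding g_def by (rule N2.nn_integral_fst[OF G])
  finally show ?thesis by (simp add: g_def)
qed

lemma prob_space_phase_source: "0 < \<sigma> \<Longrightarrow> prob_space (phase_source \<sigma>)"
  unfolding phase_source_def
  by (intro prob_space_pair prob_space_uniform_phase prob_space_PiM prob_space_wrapped_normal)

lemma prob_space_additive_noise: "prob_space (additive_noise M)"
  unfolding additive_noise_def by (intro prob_space_PiM prob_space_std_complex_normal)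

lemma sets_uniform_phase [simp, measurable_cong]: "sets uniform_phase = sets borel"
  by (simp add: uniform_phase_def)

lemma space_uniform_phase [simp]: "space uniform_phase = UNIV"
  by (simp add: uniform_phase_def)

section \<open>Redrawing the noise of a single block\<close>

definition set_incr :: "nat \<Rightarrow> real \<times> (nat \<Rightarrow> real) \<Rightarrow> real \<Rightarrow> real \<times> (nat \<Rightarrow> real)" where
  "set_incr k s \<delta> = (fst s, (snd s)(k := \<delta>))"

lemma set_incr_measurable:
  assumes "k \<ge> 1"
  shows "(\<lambda>p. set_incr k (fst p) (snd p)) \<in> measurable (phase_source \<sigma> \<Otimes>\<^sub>M wrapped_normal \<sigma>) (phase_source \<sigma>)"
  unfolding set_incr_def phase_source_def
proof (intro measurable_Pair)
  have "insert k {1..} = {1..}" using assms by auto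
  then show "(\<lambda>p. (snd (fst p))(k := snd p)) \<in> measurable ((uniform_phase \<Otimes>\<^sub>M PiM {1..} (\<lambda>_. wrapped_normal \<sigma>)) \<Otimes>\<^sub>M wrapped_normal \<sigma>) (PiM {1..} (\<lambda>_. wrapped_normal \<sigma>))"
    by (intro measurable_fun_upd[where J = "{1..}"]) auto
qed measurable

lemma nn_integral_phase_source_resample:
  assumes \<sigma>: "0 < \<sigma>" and k: "k \<ge> 1" and G: "G \<in> borel_measurable (phase_source \<sigma>)"
  shows "(\<integral>\<^sup>+s. G s \<partial>phase_source \<sigma>) = (\<integral>\<^sup>+s. \<integral>\<^sup>+\<delta>. G (set_incr k s \<delta>) \<partial>wrapped_normal \<sigma> \<partial>phase_source \<sigma>)"
proof -
  let ?D = "PiM {1..} (\<lambda>_::nat. wrapped_normal \<sigma>)"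
  interpret D: prob_space ?D by (intro prob_space_PiM prob_space_wrapped_normal \<sigma>)
  interpret W: prob_space "wrapped_normal \<sigma>" by (intro prob_space_wrapped_normal \<sigma>)
  have G': "G \<in> borel_measurable (uniform_phase \<Otimes>\<^sub>M ?D)" using G by (simp add: phase_source_def)
  have m: "(\<lambda>p. G (set_incr k (fst p) (snd p))) \<in> borel_measurable (phase_source \<sigma> \<Otimes>\<^sub>M wrapped_normal \<sigma>)"
    by (rule measurable_compose[OF set_incr_measurable[OF k] G])
  have "(\<integral>\<^sup>+s. G s \<partial>phase_source \<sigma>) = (\<integral>\<^sup>+a. \<integral>\<^sup>+d. G (a, d) \<partial>?D \<partial>uniform_phase)"
    unfolding phase_source_def by (rule D.nn_integral_fst[OF G', symmetric])
  also have "\<dots> = (\<integral>\<^sup>+a. \<integral>\<^sup>+d. \<integral>\<^sup>+\<delta>. G (a, d(k := \<delta>)) \<partial>wrapped_normal \<sigma> \<partial>?D \<partial>uniform_phase)"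
    by (intro nn_integral_cong nn_integral_PiM_resample measurable_compose[OF _ G'])
      (use k \<sigma> in \<open>auto intro: prob_space_wrapped_normal\<close>)
  also have "\<dots> = (\<integral>\<^sup>+s. \<integral>\<^sup>+\<delta>. G (set_incr k s \<delta>) \<partial>wrapped_normal \<sigma> \<partial>phase_source \<sigma>)"
    unfolding phase_source_def
    by (subst D.nn_integral_fst[symmetric])
      (use m in \<open>auto simp: set_incr_def phase_source_def case_prod_beta' intro!: W.borel_measurable_nn_integral\<close>)
  finally show ?thesis .
qed

lemma phase_set_incr_less: "j < k \<Longrightarrow> phase (set_incr k s \<delta>) j = phase s j"
  by (induction j) (auto simp: set_incr_def)

lemma phase_set_incr_Suc: "phase (set_incr (Suc j) s \<delta>) (Suc j) = wrap_pi (\<delta> + phase s j)"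
  using phase_set_incr_less[of j "Suc j" s \<delta>] by (simp add: set_incr_def)

definition set_block :: "nat \<Rightarrow> noise_sample \<Rightarrow> real \<times> real \<times> (nat \<Rightarrow> complex) \<Rightarrow> noise_sample" where
  "set_block k \<nu> e = (set_incr k (fst \<nu>) (fst e), set_incr k (fst (snd \<nu>)) (fst (snd e)), (snd (snd \<nu>))(k := snd (snd e)))"

lemma nn_integral_channel_noise_resample:
  assumes \<sigma>: "0 < \<sigma>c" "0 < \<sigma>r" and k: "k \<ge> 1" and G: "G \<in> borel_measurable (channel_noise M \<sigma>c \<sigma>r)"
  shows "(\<integral>\<^sup>+\<nu>. G \<nu> \<partial>channel_noise M \<sigma>c \<sigma>r) = (\<integral>\<^sup>+\<nu>. \<integral>\<^sup>+e. G (set_block k \<nu> e)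
     \<partial>(wrapped_normal \<sigma>c \<Otimes>\<^sub>M wrapped_normal \<sigma>r \<Otimes>\<^sub>M noise_block M) \<partial>channel_noise M \<sigma>c \<sigma>r)"
proof -
  let ?W1 = "noise_block M"
  have W1: "prob_space ?W1" by (intro prob_space_PiM prob_space_std_complex_normal)
  have ins: "insert k {1..} = {1..}" using k by auto
  have wm: "(\<lambda>p. (fst p)(k := snd p)) \<in> measurable (additive_noise M \<Otimes>\<^sub>M ?W1) (additive_noise M)"
    unfolding additive_noise_def
    by (intro measurable_fun_upd[where J = "{1..}"]) (use ins in auto)
  note sf = prob_space_imp_sigma_finite prob_space_phase_source prob_space_additive_noise
      prob_space_wrapped_normal \<sigma> W1 prob_space_pair
  have inner: "(\<integral>\<^sup>+p. H p \<partial>(phase_source \<sigma>r \<Otimes>\<^sub>M additive_noise M)) =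
    (\<integral>\<^sup>+p. \<integral>\<^sup>+e. H (set_incr k (fst p) (fst e), (snd p)(k := snd e)) \<partial>(wrapped_normal \<sigma>r \<Otimes>\<^sub>M ?W1) \<partial>(phase_source \<sigma>r \<Otimes>\<^sub>M additive_noise M))"
    if H: "H \<in> borel_measurable (phase_source \<sigma>r \<Otimes>\<^sub>M additive_noise M)" for H
  proof (rule resample_pair[where ?u2.0 = "\<lambda>w e. w(k := e)"])
    fix Q :: "(nat \<Rightarrow> nat \<Rightarrow> complex) \<Rightarrow> ennreal" assume "Q \<in> borel_measurable (additive_noise M)"
    then show "(\<integral>\<^sup>+x. Q x \<partial>additive_noise M) = (\<integral>\<^sup>+x. \<integral>\<^sup>+e. Q (x(k := e)) \<partial>?W1 \<partial>additive_noise M)"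
      unfolding additive_noise_def by (intro nn_integral_PiM_resample) (use k W1 in auto)
  qed (use set_incr_measurable[OF k] wm H nn_integral_phase_source_resample[OF \<sigma>(2) k] in \<open>auto intro!: sf\<close>)
  have "(\<integral>\<^sup>+\<nu>. G \<nu> \<partial>channel_noise M \<sigma>c \<sigma>r) = (\<integral>\<^sup>+p. G p \<partial>(phase_source \<sigma>c \<Otimes>\<^sub>M (phase_source \<sigma>r \<Otimes>\<^sub>M additive_noise M)))"
    by (simp add: channel_noise_def)
  also have "\<dots> = (\<integral>\<^sup>+p. \<integral>\<^sup>+e. G (set_incr k (fst p) (fst e), set_incr k (fst (snd p)) (fst (snd e)), (snd (snd p))(k := snd (snd e)))
     \<partial>(wrapped_normal \<sigma>c \<Otimes>\<^sub>M (wrapped_normal \<sigma>r \<Otimes>\<^sub>M ?W1)) \<partial>(phase_source \<sigma>c \<Otimes>\<^sub>M (phase_source \<sigma>r \<Otimes>\<^sub>M additive_noise M)))"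
  proof (rule resample_pair[where ?u2.0 = "\<lambda>p e. (set_incr k (fst p) (fst e), (snd p)(k := snd e))"])
    show "(\<lambda>p. (set_incr k (fst (fst p)) (fst (snd p)), (snd (fst p))(k := snd (snd p))))
      \<in> measurable ((phase_source \<sigma>r \<Otimes>\<^sub>M additive_noise M) \<Otimes>\<^sub>M (wrapped_normal \<sigma>r \<Otimes>\<^sub>M ?W1)) (phase_source \<sigma>r \<Otimes>\<^sub>M additive_noise M)"
    proof (rule measurable_Pair)
      have "(\<lambda>p. (fst (fst p), fst (snd p))) \<in> measurable ((phase_source \<sigma>r \<Otimes>\<^sub>M additive_noise M) \<Otimes>\<^sub>M (wrapped_normal \<sigma>r \<Otimes>\<^sub>M ?W1)) (phase_source \<sigma>r \<Otimes>\<^sub>M wrapped_normal \<sigma>r)"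
        by measurable
      from measurable_compose[OF this set_incr_measurable[OF k]]
      show "(\<lambda>p. set_incr k (fst (fst p)) (fst (snd p))) \<in> measurable ((phase_source \<sigma>r \<Otimes>\<^sub>M additive_noise M) \<Otimes>\<^sub>M (wrapped_normal \<sigma>r \<Otimes>\<^sub>M ?W1)) (phase_source \<sigma>r)"
        by simp
      have "(\<lambda>p. (snd (fst p), snd (snd p))) \<in> measurable ((phase_source \<sigma>r \<Otimes>\<^sub>M additive_noise M) \<Otimes>\<^sub>M (wrapped_normal \<sigma>r \<Otimes>\<^sub>M ?W1)) (additive_noise M \<Otimes>\<^sub>M ?W1)"
        by measurable
      from measurable_compose[OF this wm]
      show "(\<lambda>p. (snd (fst p))(k := snd (snd p))) \<in> measurable ((phase_source \<sigma>r \<Otimes>\<^sub>M additive_noise M) \<Otimes>\<^sub>M (wrapped_normal \<sigma>r \<Otimes>\<^sub>M ?W1)) (additive_noise M)"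
        by simp
    qed
    show "G \<in> borel_measurable (phase_source \<sigma>c \<Otimes>\<^sub>M (phase_source \<sigma>r \<Otimes>\<^sub>M additive_noise M))"
      using G by (simp add: channel_noise_def)
  qed (use set_incr_measurable[OF k] inner nn_integral_phase_source_resample[OF \<sigma>(1) k] in \<open>auto intro!: sf\<close>)
  finally show ?thesis by (simp add: set_block_def channel_noise_def)
qed

lemma phase_source_measurable [measurable]:
  "(\<lambda>s. phase s k) \<in> borel_measurable (phase_source \<sigma>)"
  using phase_measurable[of k] measurable_cong_sets[OF sets_phase_source refl] by blast

lemma increment_measurable:
  assumes "1 \<le> k" shows "(\<lambda>s. snd s k) \<in> borel_measurable (phase_source \<sigma>)"
  unfolding phase_source_def
  by (rule measurable_compose[OF measurable_snd]) (rule measurable_component_borel, use assms in auto)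

lemma additive_noise_component:
  assumes "1 \<le> k" "m < M" shows "(\<lambda>w. w k m) \<in> borel_measurable (additive_noise M)"
  unfolding additive_noise_def
  by (rule measurable_compose[OF measurable_component_singleton[of k]])
    (use assms in \<open>auto intro!: measurable_component_borel\<close>)

lemma block_space_component:
  assumes "k \<in> {1..n}" "m < M" shows "(\<lambda>x. x k m) \<in> borel_measurable (block_space M n)"
  unfolding block_space_def
  by (rule measurable_compose[OF measurable_component_singleton[of k]])
    (use assms in \<open>auto intro!: measurable_component_borel\<close>)

lemma channel_noise_coordinates:
  "(\<lambda>\<nu>. phase (fst \<nu>) k) \<in> borel_measurable (channel_noise M \<sigma>c \<sigma>r)"
  "(\<lambda>\<nu>. phase (fst (snd \<nu>)) k) \<in> borel_measurable (channel_noise M \<sigma>c \<sigma>r)"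
  "1 \<le> k \<Longrightarrow> (\<lambda>\<nu>. snd (fst \<nu>) k) \<in> borel_measurable (channel_noise M \<sigma>c \<sigma>r)"
  "1 \<le> k \<Longrightarrow> (\<lambda>\<nu>. snd (fst (snd \<nu>)) k) \<in> borel_measurable (channel_noise M \<sigma>c \<sigma>r)"
  "1 \<le> k \<Longrightarrow> m < M \<Longrightarrow> (\<lambda>\<nu>. snd (snd \<nu>) k m) \<in> borel_measurable (channel_noise M \<sigma>c \<sigma>r)"
  unfolding channel_noise_def
  by (rule measurable_compose[OF _ phase_source_measurable] measurable_compose[OF _ increment_measurable]
      measurable_compose[OF _ additive_noise_component[where k = k and m = m and M = M]]; measurable)+

text \<open>Asks only for measurable input coordinates, so it covers a fixed array
  \<open>\<lambda>_. x\<close> outside the block space as well as a random input. Sections at a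
  fixed input rely on this.\<close>

lemma channel_output_measurable':
  assumes X: "\<And>k m. k \<in> {1..n} \<Longrightarrow> m < M \<Longrightarrow> (\<lambda>z. X z k m) \<in> borel_measurable Z"
    and V: "V \<in> measurable Z (channel_noise M \<sigma>c \<sigma>r)"
  shows "(\<lambda>z. channel_output M n (X z, V z)) \<in> measurable Z (block_space M n)"
  unfolding block_space_def channel_output_def case_prod_beta fst_conv snd_conv
proof (intro measurable_restrict)
  fix k m assume k: "k \<in> {1..n}" and m: "m \<in> {..<M}"
  have [measurable]: "(\<lambda>z. X z k m) \<in> borel_measurable Z" using X k m by auto
  have [measurable]: "(\<lambda>z. phase (fst (V z)) k) \<in> borel_measurable Z"
    "(\<lambda>z. phase (fst (snd (V z))) k) \<in> borel_measurable Z"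
    "(\<lambda>z. snd (snd (V z)) k m) \<in> borel_measurable Z"
    using k m by (auto intro!: measurable_compose[OF V channel_noise_coordinates(1)]
      measurable_compose[OF V channel_noise_coordinates(2)] measurable_compose[OF V channel_noise_coordinates(5)])
  show "(\<lambda>z. cis (wrap_pi (phase (fst (V z)) k + real m * phase (fst (snd (V z))) k)) * X z k m + snd (snd (V z)) k m)
      \<in> borel_measurable Z" by measurable
qed

context dual_bound
begin

lemma block_lik_measurable:
  assumes X: "\<And>m. m < M \<Longrightarrow> (\<lambda>z. X z m) \<in> borel_measurable Z" and W: "\<And>m. m < M \<Longrightarrow> (\<lambda>z. W z m) \<in> borel_measurable Z"
    and [measurable]: "dc \<in> borel_measurable Z" "dr \<in> borel_measurable Z" "tc \<in> borel_measurable Z" "tr \<in> borel_measurable Z"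
  shows "(\<lambda>z. lik (X z) (dc z) (dr z) (tc z) (tr z) (W z)) \<in> borel_measurable Z"
proof -
  have [measurable]: "(\<lambda>z. X z 0) \<in> borel_measurable Z" "(\<lambda>z. X z 1) \<in> borel_measurable Z"
    "(\<lambda>z. W z 0) \<in> borel_measurable Z" "(\<lambda>z. W z 1) \<in> borel_measurable Z"
    using M X W by auto
  have [measurable]: "(\<lambda>z. \<Prod>m<M. outd m (cis (wrap_pi (tc z + real m * tr z)) * X z m + W z m) / cgauss (W z m)) \<in> borel_measurable Z"
  proof (rule borel_measurable_prod)
    fix m assume "m \<in> {..<M}"
    then have [measurable]: "(\<lambda>z. X z m) \<in> borel_measurable Z" "(\<lambda>z. W z m) \<in> borel_measurable Z"
      using X W by auto
    show "(\<lambda>z. outd m (cis (wrap_pi (tc z + real m * tr z)) * X z m + W z m) / cgauss (W z m)) \<in> borel_measurable Z"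
      by measurable
  qed
  show ?thesis unfolding block_lik_def by measurable
qed

text \<open>Reference law over true law, the reciprocal of the product in the overview. In this
  direction its weighted mean under the true noise can be evaluated exactly.\<close>

definition sample_lik :: "nat \<Rightarrow> (nat \<Rightarrow> nat \<Rightarrow> complex) \<Rightarrow> noise_sample \<Rightarrow> real" where
  "sample_lik n x \<nu> = (\<Prod>k\<in>{1..n}. lik (x k) (snd (fst \<nu>) k) (snd (fst (snd \<nu>)) k)
      (phase (fst \<nu>) k) (phase (fst (snd \<nu>)) k) (snd (snd \<nu>) k))"

lemma lik_pos: "0 < lik \<xi> \<delta>c \<delta>r \<theta>c \<theta>r w"
  unfolding block_lik_def using fc_pos fr_pos outd_pos cgauss_pos phase_posterior_pos
  by (intro mult_pos_pos prod_pos divide_pos_pos) auto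

lemma sample_lik_pos: "0 < sample_lik n x \<nu>"
  unfolding sample_lik_def by (intro prod_pos ballI lik_pos)

lemma sample_lik_measurable:
  assumes X: "\<And>k m. k \<in> {1..n} \<Longrightarrow> m < M \<Longrightarrow> (\<lambda>z. X z k m) \<in> borel_measurable Z"
    and V: "V \<in> measurable Z (channel_noise M \<sigma>c \<sigma>r)"
  shows "(\<lambda>z. sample_lik n (X z) (V z)) \<in> borel_measurable Z"
  unfolding sample_lik_def
proof (rule borel_measurable_prod)
  fix k assume k: "k \<in> {1..n}"
  show "(\<lambda>z. lik (X z k) (snd (fst (V z)) k) (snd (fst (snd (V z))) k) (phase (fst (V z)) k)
      (phase (fst (snd (V z))) k) (snd (snd (V z)) k)) \<in> borel_measurable Z"
  proof (rule block_lik_measurable)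
    show "(\<lambda>z. X z k m) \<in> borel_measurable Z" if "m < M" for m using X k that by auto
    show "(\<lambda>z. snd (snd (V z)) k m) \<in> borel_measurable Z" if "m < M" for m
      using k that by (intro measurable_compose[OF V channel_noise_coordinates(5)]) auto
    show "(\<lambda>z. snd (fst (V z)) k) \<in> borel_measurable Z" "(\<lambda>z. snd (fst (snd (V z))) k) \<in> borel_measurable Z"
      using k by (auto intro!: measurable_compose[OF V channel_noise_coordinates(3)] measurable_compose[OF V channel_noise_coordinates(4)])
    show "(\<lambda>z. phase (fst (V z)) k) \<in> borel_measurable Z" "(\<lambda>z. phase (fst (snd (V z))) k) \<in> borel_measurable Z"
      by (rule measurable_compose[OF V channel_noise_coordinates(1)] measurable_compose[OF V channel_noise_coordinates(2)])+
  qed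
qed

definition out_blocks :: "nat \<Rightarrow> (nat \<Rightarrow> nat \<Rightarrow> complex) measure" where
  "out_blocks n = PiM {1..n} (\<lambda>_. outV)"

lemma sets_PiM_outM: "sets (outV) = sets (vec_borel M)"
  by (intro sets_PiM_cong) auto

lemma sets_out_blocks: "sets (out_blocks n) = sets (block_space M n)"
  unfolding out_blocks_def block_space_def by (intro sets_PiM_cong sets_PiM_outM refl)

lemma prob_space_out_blocks: "prob_space (out_blocks n)"
  unfolding out_blocks_def by (intro prob_space_PiM prob_space_outM)

text \<open>Induction on the number of blocks with the input array fixed. The noise of the last
  block is redrawn; earlier outputs and earlier factors do not notice, since phases depend on past
  increments only. The last factor then turns the law of the last output into \<open>outV\<close>,
  whatever the past. The right-hand side is the same for all inputs, so the output measure is a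
  genuine common reference.\<close>

theorem nn_integral_sample_lik:
  assumes F: "F \<in> borel_measurable (block_space M n)"
  shows "(\<integral>\<^sup>+\<nu>. F (channel_output M n (x, \<nu>)) * ennreal (sample_lik n x \<nu>) \<partial>channel_noise M \<sigma>c \<sigma>r) = (\<integral>\<^sup>+y. F y \<partial>out_blocks n)"
  using F
proof (induction n arbitrary: F)
  case 0
  interpret prob_space "channel_noise M \<sigma>c \<sigma>r" by (rule prob_space_channel_noise[OF \<sigma>])
  interpret ps: product_sigma_finite "\<lambda>_::nat. outV"
    by (intro product_sigma_finite.intro prob_space_imp_sigma_finite prob_space_PiM prob_space_outM)
  \<comment> \<open>With an empty index set the block space consists of the single point
    \<open>\<lambda>_. undefined\<close>, and the empty product is 1.\<close>
  have o: "channel_output M 0 p = (\<lambda>_. undefined)" for p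
    by (auto simp: channel_output_def case_prod_beta)
  show ?case unfolding out_blocks_def
    by (simp add: o sample_lik_def PiM_empty nn_integral_count_space_finite emeasure_space_1)
next
  case (Suc n)
  let ?N = "channel_noise M \<sigma>c \<sigma>r" and ?O = "outV"
  let ?W1 = "noise_block M"
  let ?E = "wrapped_normal \<sigma>c \<Otimes>\<^sub>M wrapped_normal \<sigma>r \<Otimes>\<^sub>M ?W1"
  let ?\<eta> = "\<lambda>\<nu> e. \<lambda>m\<in>{..<M}. cis (wrap_pi (wrap_pi (fst e + phase (fst \<nu>) n) + real m * wrap_pi (fst (snd e) + phase (fst (snd \<nu>)) n))) * x (Suc n) m + snd (snd e) m"
  let ?l = "\<lambda>\<nu> e. lik (x (Suc n)) (fst e) (fst (snd e)) (wrap_pi (fst e + phase (fst \<nu>) n)) (wrap_pi (fst (snd e) + phase (fst (snd \<nu>)) n)) (snd (snd e))"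
  interpret N: prob_space ?N by (rule prob_space_channel_noise[OF \<sigma>])
  interpret O: prob_space ?O by (intro prob_space_PiM prob_space_outM)
  interpret W1: prob_space ?W1 by (intro prob_space_PiM prob_space_std_complex_normal)
  interpret wr: prob_space "wrapped_normal \<sigma>r" by (rule prob_space_wrapped_normal[OF \<sigma>(2)])
  interpret wrW: pair_prob_space "wrapped_normal \<sigma>r" ?W1 ..
  interpret ps: product_sigma_finite "\<lambda>_::nat. ?O"
    by (intro product_sigma_finite.intro prob_space_imp_sigma_finite O.prob_space_axioms)
  have ins: "{1..Suc n} = insert (Suc n) {1..n}" by auto
  have Fm: "F \<in> borel_measurable (PiM (insert (Suc n) {1..n}) (\<lambda>_. vec_borel M))"
    using Suc.prems by (simp only: block_space_def ins)
  have outm: "(\<lambda>\<nu>. channel_output M n (x, \<nu>)) \<in> measurable ?N (block_space M n)"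
    by (rule channel_output_measurable'[where X = "\<lambda>_. x" and V = "\<lambda>\<nu>. \<nu>" and \<sigma>c = \<sigma>c and \<sigma>r = \<sigma>r]) auto
  have likm: "(\<lambda>\<nu>. sample_lik n x \<nu>) \<in> borel_measurable ?N" for n
    by (rule sample_lik_measurable[where X = "\<lambda>_. x" and V = "\<lambda>\<nu>. \<nu>"]) auto
  have outm': "(\<lambda>\<nu>. channel_output M (Suc n) (x, \<nu>)) \<in> measurable ?N (block_space M (Suc n))"
    by (rule channel_output_measurable'[where X = "\<lambda>_. x" and V = "\<lambda>\<nu>. \<nu>" and \<sigma>c = \<sigma>c and \<sigma>r = \<sigma>r]) auto
  have out: "channel_output M (Suc n) (x, set_block (Suc n) \<nu> e) = (channel_output M n (x, \<nu>))(Suc n := ?\<eta> \<nu> e)" for \<nu> e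
  proof
    fix k show "channel_output M (Suc n) (x, set_block (Suc n) \<nu> e) k = ((channel_output M n (x, \<nu>))(Suc n := ?\<eta> \<nu> e)) k"
      by (cases "k = Suc n"; cases "k \<in> {1..n}")
        (auto simp: channel_output_def set_block_def case_prod_beta phase_set_incr_less phase_set_incr_Suc simp del: phase.simps)
  qed
  have lik: "sample_lik (Suc n) x (set_block (Suc n) \<nu> e) = sample_lik n x \<nu> * ?l \<nu> e" for \<nu> e
  proof -
    have "(\<Prod>k\<in>{1..n}. lik (x k) (snd (fst (set_block (Suc n) \<nu> e)) k) (snd (fst (snd (set_block (Suc n) \<nu> e))) k)
        (phase (fst (set_block (Suc n) \<nu> e)) k) (phase (fst (snd (set_block (Suc n) \<nu> e))) k) (snd (snd (set_block (Suc n) \<nu> e)) k))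
      = sample_lik n x \<nu>"
      unfolding sample_lik_def
      by (rule prod.cong[OF refl]) (auto simp: set_block_def phase_set_incr_less, auto simp: set_incr_def)
    moreover have "snd (set_incr (Suc n) s d) (Suc n) = d" for s d by (simp add: set_incr_def)
    ultimately show ?thesis
      by (subst sample_lik_def)
        (simp add: ins phase_set_incr_Suc set_block_def mult.commute del: phase.simps)
  qed
  have Fn: "(\<lambda>y. \<integral>\<^sup>+\<eta>. F (y(Suc n := \<eta>)) \<partial>?O) \<in> borel_measurable (block_space M n)"
  proof (rule O.borel_measurable_nn_integral)
    have "(\<lambda>p. (fst p)(Suc n := snd p)) \<in> measurable (block_space M n \<Otimes>\<^sub>M ?O) (PiM (insert (Suc n) {1..n}) (\<lambda>_. vec_borel M))"
      unfolding block_space_def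
      by (rule measurable_fun_upd[where J = "{1..n}"]) (auto simp: measurable_cong_sets[OF refl sets_PiM_outM[symmetric]])
    from measurable_compose[OF this Fm]
    show "(\<lambda>(y, \<eta>). F (y(Suc n := \<eta>))) \<in> borel_measurable (block_space M n \<Otimes>\<^sub>M ?O)"
      by (simp add: case_prod_beta')
  qed
  have inner: "(\<integral>\<^sup>+e. F (channel_output M (Suc n) (x, set_block (Suc n) \<nu> e)) * ennreal (sample_lik (Suc n) x (set_block (Suc n) \<nu> e)) \<partial>?E)
      = (\<integral>\<^sup>+\<eta>. F ((channel_output M n (x, \<nu>))(Suc n := \<eta>)) \<partial>?O) * ennreal (sample_lik n x \<nu>)"
    if \<nu>: "\<nu> \<in> space ?N" for \<nu>
  proof -
    let ?y = "channel_output M n (x, \<nu>)"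
    have y: "?y \<in> space (PiM {1..n} (\<lambda>_. vec_borel M))"
      using measurable_space[OF outm \<nu>] by (simp add: block_space_def)
    have F1: "(\<lambda>\<eta>. F (?y(Suc n := \<eta>))) \<in> borel_measurable (vec_borel M)"
      by (rule measurable_compose[OF measurable_component_update[OF y] Fm]) simp
    have wm: "(\<lambda>e. snd (snd e) m) \<in> borel_measurable ?E" if "m < M" for m
      by (rule measurable_compose[OF _ measurable_component_borel[of m "{..<M}" "\<lambda>_. std_complex_normal"]]) (use that in auto)
    have \<eta>m: "(\<lambda>e. ?\<eta> \<nu> e) \<in> measurable ?E (vec_borel M)"
    proof (rule measurable_restrict)
      fix m assume "m \<in> {..<M}"
      then have [measurable]: "(\<lambda>e. snd (snd e) m) \<in> borel_measurable ?E" using wm by auto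
      show "(\<lambda>e. cis (wrap_pi (wrap_pi (fst e + phase (fst \<nu>) n) + real m * wrap_pi (fst (snd e) + phase (fst (snd \<nu>)) n))) * x (Suc n) m + snd (snd e) m) \<in> borel_measurable ?E"
        by measurable
    qed
    have m1: "(\<lambda>e. F (?y(Suc n := ?\<eta> \<nu> e))) \<in> borel_measurable ?E"
      by (rule measurable_compose[OF \<eta>m F1])
    have m2: "(\<lambda>e. ?l \<nu> e) \<in> borel_measurable ?E"
      by (rule block_lik_measurable) (use wm in auto)
    have m3: "(\<lambda>e. F (?y(Suc n := ?\<eta> \<nu> e)) * ennreal (?l \<nu> e)) \<in> borel_measurable ?E"
      using m1 m2 by measurable
    have "(\<integral>\<^sup>+e. F (channel_output M (Suc n) (x, set_block (Suc n) \<nu> e)) * ennreal (sample_lik (Suc n) x (set_block (Suc n) \<nu> e)) \<partial>?E)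
      = (\<integral>\<^sup>+e. ennreal (sample_lik n x \<nu>) * (F (?y(Suc n := ?\<eta> \<nu> e)) * ennreal (?l \<nu> e)) \<partial>?E)"
      unfolding out lik using sample_lik_pos[of n x \<nu>] lik_pos
      by (intro nn_integral_cong) (simp only: ennreal_mult' less_imp_le mult_ac)
    also have "\<dots> = ennreal (sample_lik n x \<nu>) * (\<integral>\<^sup>+e. F (?y(Suc n := ?\<eta> \<nu> e)) * ennreal (?l \<nu> e) \<partial>?E)"
      by (rule nn_integral_cmult[OF m3])
    also have "(\<integral>\<^sup>+e. F (?y(Suc n := ?\<eta> \<nu> e)) * ennreal (?l \<nu> e) \<partial>?E) =
       (\<integral>\<^sup>+\<delta>c. \<integral>\<^sup>+p. F (?y(Suc n := ?\<eta> \<nu> (\<delta>c, p))) * ennreal (?l \<nu> (\<delta>c, p)) \<partial>(wrapped_normal \<sigma>r \<Otimes>\<^sub>M ?W1) \<partial>wrapped_normal \<sigma>c)"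
      by (rule sigma_finite_measure.nn_integral_fst[OF prob_space_imp_sigma_finite[OF wrW.prob_space_axioms] m3, symmetric])
    also have "\<dots> = (\<integral>\<^sup>+\<delta>c. \<integral>\<^sup>+\<delta>r. \<integral>\<^sup>+w. F (?y(Suc n := ?\<eta> \<nu> (\<delta>c, \<delta>r, w))) * ennreal (?l \<nu> (\<delta>c, \<delta>r, w)) \<partial>?W1 \<partial>wrapped_normal \<sigma>r \<partial>wrapped_normal \<sigma>c)"
    proof (rule nn_integral_cong)
      fix \<delta>c
      have "(\<lambda>p. F (?y(Suc n := ?\<eta> \<nu> (\<delta>c, p))) * ennreal (?l \<nu> (\<delta>c, p))) \<in> borel_measurable (wrapped_normal \<sigma>r \<Otimes>\<^sub>M ?W1)"
        by (rule measurable_compose[OF _ m3]) auto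
      from W1.nn_integral_fst[OF this]
      show "(\<integral>\<^sup>+p. F (?y(Suc n := ?\<eta> \<nu> (\<delta>c, p))) * ennreal (?l \<nu> (\<delta>c, p)) \<partial>(wrapped_normal \<sigma>r \<Otimes>\<^sub>M ?W1)) =
        (\<integral>\<^sup>+\<delta>r. \<integral>\<^sup>+w. F (?y(Suc n := ?\<eta> \<nu> (\<delta>c, \<delta>r, w))) * ennreal (?l \<nu> (\<delta>c, \<delta>r, w)) \<partial>?W1 \<partial>wrapped_normal \<sigma>r)"
        by (rule sym)
    qed
    also have "\<dots> = (\<integral>\<^sup>+\<eta>. F (?y(Suc n := \<eta>)) \<partial>?O)"
      unfolding fst_conv snd_conv by (rule nn_integral_block_lik[OF F1])
    finally show ?thesis by (simp only: mult.commute)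
  qed
  have "(\<integral>\<^sup>+\<nu>. F (channel_output M (Suc n) (x, \<nu>)) * ennreal (sample_lik (Suc n) x \<nu>) \<partial>?N) =
    (\<integral>\<^sup>+\<nu>. \<integral>\<^sup>+e. F (channel_output M (Suc n) (x, set_block (Suc n) \<nu> e)) * ennreal (sample_lik (Suc n) x (set_block (Suc n) \<nu> e)) \<partial>?E \<partial>?N)"
    by (rule nn_integral_channel_noise_resample[OF \<sigma>, of "Suc n"])
      (use measurable_compose[OF outm' Suc.prems] likm in \<open>auto intro!: borel_measurable_times_ennreal\<close>)
  also have "\<dots> = (\<integral>\<^sup>+\<nu>. (\<integral>\<^sup>+\<eta>. F ((channel_output M n (x, \<nu>))(Suc n := \<eta>)) \<partial>?O) * ennreal (sample_lik n x \<nu>) \<partial>?N)"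
    by (rule nn_integral_cong) (rule inner)
  also have "\<dots> = (\<integral>\<^sup>+y. \<integral>\<^sup>+\<eta>. F (y(Suc n := \<eta>)) \<partial>?O \<partial>out_blocks n)"
    by (rule Suc.IH[OF Fn])
  also have "\<dots> = (\<integral>\<^sup>+y. F y \<partial>out_blocks (Suc n))"
    unfolding out_blocks_def ins
  proof (rule ps.product_nn_integral_insert[symmetric])
    show "F \<in> borel_measurable (PiM (insert (Suc n) {1..n}) (\<lambda>_. ?O))"
      using Suc.prems
      unfolding ins[symmetric] measurable_cong_sets[OF sets_out_blocks[of "Suc n", unfolded out_blocks_def] refl] .
  qed auto
  finally show ?case .
qed

end

section \<open>Dual bound on the information\<close>

definition out_law :: "nat \<Rightarrow> real \<Rightarrow> real \<Rightarrow> nat \<Rightarrow> (nat \<Rightarrow> nat \<Rightarrow> complex) measure \<Rightarrow> (nat \<Rightarrow> nat \<Rightarrow> complex) measure" where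
  "out_law M \<sigma>c \<sigma>r n P = distr (P \<Otimes>\<^sub>M channel_noise M \<sigma>c \<sigma>r) (block_space M n) (channel_output M n)"

definition joint_law :: "nat \<Rightarrow> real \<Rightarrow> real \<Rightarrow> nat \<Rightarrow> (nat \<Rightarrow> nat \<Rightarrow> complex) measure \<Rightarrow>
    ((nat \<Rightarrow> nat \<Rightarrow> complex) \<times> (nat \<Rightarrow> nat \<Rightarrow> complex)) measure" where
  "joint_law M \<sigma>c \<sigma>r n P = distr (P \<Otimes>\<^sub>M channel_noise M \<sigma>c \<sigma>r) (block_space M n \<Otimes>\<^sub>M block_space M n)
     (\<lambda>\<omega>. (fst \<omega>, channel_output M n \<omega>))"

abbreviation info_deriv where
  "info_deriv M \<sigma>c \<sigma>r n P \<equiv> RN_deriv (P \<Otimes>\<^sub>M out_law M \<sigma>c \<sigma>r n P) (joint_law M \<sigma>c \<sigma>r n P)"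

text \<open>Kept in nats, so that \<open>ln 2\<close> enters only when the result is compared with
  \<open>block_information\<close>.\<close>

definition info_nats where
  "info_nats M \<sigma>c \<sigma>r n P = (\<integral>z. ln (enn2real (info_deriv M \<sigma>c \<sigma>r n P z)) \<partial>joint_law M \<sigma>c \<sigma>r n P)"

text \<open>Carried along with every bound: it guarantees that \<open>info_nats\<close> is a true
  mean and not the default value of the integral.\<close>

abbreviation info_integrable where
  "info_integrable M \<sigma>c \<sigma>r n P \<equiv> integrable (joint_law M \<sigma>c \<sigma>r n P) (\<lambda>z. ln (enn2real (info_deriv M \<sigma>c \<sigma>r n P z)))"

locale channel_input =
  fixes M n :: nat and \<sigma>c \<sigma>r :: real and P :: "(nat \<Rightarrow> nat \<Rightarrow> complex) measure"
  assumes sigma: "0 < \<sigma>c" "0 < \<sigma>r" and P: "prob_space P" and sets_P: "sets P = sets (block_space M n)"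
begin

abbreviation "N \<equiv> channel_noise M \<sigma>c \<sigma>r"
abbreviation "Y \<equiv> channel_output M n"

sublocale PN: pair_prob_space P N
  using P prob_space_channel_noise[OF sigma] by (simp add: pair_prob_space_def pair_sigma_finite_def prob_space_imp_sigma_finite)

lemma Y_measurable [measurable]: "Y \<in> measurable (P \<Otimes>\<^sub>M N) (block_space M n)"
  by (rule channel_output_measurable[OF sets_P])

lemma X_measurable [measurable]: "fst \<in> measurable (P \<Otimes>\<^sub>M N) (block_space M n)"
  using measurable_fst[of P N] measurable_cong_sets[OF refl sets_P] by blast

lemma XY_measurable: "(\<lambda>\<omega>. (fst \<omega>, Y \<omega>)) \<in> measurable (P \<Otimes>\<^sub>M N) (block_space M n \<Otimes>\<^sub>M block_space M n)"
  by measurable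

lemma Y_section_measurable: "(\<lambda>\<nu>. Y (x, \<nu>)) \<in> measurable N (block_space M n)"
  by (rule channel_output_measurable'[where X = "\<lambda>_. x" and V = "\<lambda>\<nu>. \<nu>" and \<sigma>c = \<sigma>c and \<sigma>r = \<sigma>r]) auto

lemma prob_space_out_law: "prob_space (out_law M \<sigma>c \<sigma>r n P)"
  unfolding out_law_def by (rule PN.prob_space_distr) measurable

lemma prob_space_joint_law: "prob_space (joint_law M \<sigma>c \<sigma>r n P)"
  unfolding joint_law_def by (rule PN.prob_space_distr) measurable

lemma sets_out_law [simp]: "sets (out_law M \<sigma>c \<sigma>r n P) = sets (block_space M n)"
  by (simp add: out_law_def)

lemma sets_joint_law: "sets (joint_law M \<sigma>c \<sigma>r n P) = sets (P \<Otimes>\<^sub>M out_law M \<sigma>c \<sigma>r n P)"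
  by (simp add: joint_law_def sets_P cong: sets_pair_measure_cong)

lemma sets_joint_law': "sets (joint_law M \<sigma>c \<sigma>r n P) = sets (block_space M n \<Otimes>\<^sub>M block_space M n)"
  by (simp add: joint_law_def)

lemma distr_X: "distr (P \<Otimes>\<^sub>M N) (block_space M n) fst = P"
proof -
  have "distr (P \<Otimes>\<^sub>M N) (block_space M n) fst = distr (P \<Otimes>\<^sub>M N) P fst"
    by (rule distr_cong) (auto simp: sets_P)
  then show ?thesis by (simp add: PN.M2.distr_pair_fst)
qed

lemma prob_space_product: "prob_space (P \<Otimes>\<^sub>M out_law M \<sigma>c \<sigma>r n P)"
  by (intro prob_space_pair P prob_space_out_law)

lemma block_information_eq:
  "block_information M \<sigma>c \<sigma>r n P = info_nats M \<sigma>c \<sigma>r n P / ln 2"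
  unfolding block_information_def PN.mutual_information_def KL_divergence_def entropy_density_def distr_X
  by (simp add: out_law_def joint_law_def log_def comp_def info_nats_def)

end

context dual_bound
begin

text \<open>The likelihood is strictly positive, so for each single input the output law and the
  reference measure have the same null sets.\<close>

lemma AE_out_blocks_section:
  assumes D: "D \<in> sets (block_space M n)"
  shows "(\<integral>\<^sup>+\<nu>. indicator D (channel_output M n (x, \<nu>)) \<partial>channel_noise M \<sigma>c \<sigma>r) = 0 \<longleftrightarrow> emeasure (out_blocks n) D = 0"
proof -
  let ?N = "channel_noise M \<sigma>c \<sigma>r"
  have [measurable]: "(\<lambda>\<nu>. channel_output M n (x, \<nu>)) \<in> measurable ?N (block_space M n)"
    by (rule channel_output_measurable'[where X = "\<lambda>_. x" and V = "\<lambda>\<nu>. \<nu>" and \<sigma>c = \<sigma>c and \<sigma>r = \<sigma>r]) auto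
  have [measurable]: "(\<lambda>\<nu>. sample_lik n x \<nu>) \<in> borel_measurable ?N"
    by (rule sample_lik_measurable[where X = "\<lambda>_. x" and V = "\<lambda>\<nu>. \<nu>"]) auto
  note D [measurable]
  have "emeasure (out_blocks n) D = (\<integral>\<^sup>+y. indicator D y \<partial>out_blocks n)"
    using D by (simp add: sets_out_blocks)
  also have "\<dots> = (\<integral>\<^sup>+\<nu>. indicator D (channel_output M n (x, \<nu>)) * ennreal (sample_lik n x \<nu>) \<partial>?N)"
    by (rule nn_integral_sample_lik[symmetric]) measurable
  finally have "emeasure (out_blocks n) D = 0 \<longleftrightarrow>
      (AE \<nu> in ?N. indicator D (channel_output M n (x, \<nu>)) * ennreal (sample_lik n x \<nu>) = 0)"
    by (simp add: nn_integral_0_iff_AE)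
  also have "\<dots> \<longleftrightarrow> (AE \<nu> in ?N. indicator D (channel_output M n (x, \<nu>)) = (0::ennreal))"
  proof -
    have "ennreal (sample_lik n x \<nu>) \<noteq> 0" for \<nu> using sample_lik_pos[of n x \<nu>] by simp
    then show ?thesis by simp
  qed
  also have "\<dots> \<longleftrightarrow> (\<integral>\<^sup>+\<nu>. indicator D (channel_output M n (x, \<nu>)) \<partial>?N) = 0"
    by (subst nn_integral_0_iff_AE) auto
  finally show ?thesis ..
qed

context
  fixes n :: nat and P :: "(nat \<Rightarrow> nat \<Rightarrow> complex) measure"
  assumes P: "prob_space P" and sets_P: "sets P = sets (block_space M n)"
begin

interpretation channel_input M n \<sigma>c \<sigma>r P
  by (rule channel_input.intro) (rule \<sigma> P sets_P)+

lemma out_law_null_iff: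
  assumes D: "D \<in> sets (block_space M n)"
  shows "emeasure (out_law M \<sigma>c \<sigma>r n P) D = 0 \<longleftrightarrow> emeasure (out_blocks n) D = 0"
proof -
  note D [measurable]
  have "emeasure (out_law M \<sigma>c \<sigma>r n P) D = (\<integral>\<^sup>+y. indicator D y \<partial>out_law M \<sigma>c \<sigma>r n P)" by simp
  also have "\<dots> = (\<integral>\<^sup>+\<omega>. indicator D (Y \<omega>) \<partial>(P \<Otimes>\<^sub>M N))"
    unfolding out_law_def by (rule nn_integral_distr) auto
  also have "\<dots> = (\<integral>\<^sup>+x. \<integral>\<^sup>+\<nu>. indicator D (Y (x, \<nu>)) \<partial>N \<partial>P)"
    by (rule PN.M2.nn_integral_fst[symmetric]) measurable
  finally have e: "emeasure (out_law M \<sigma>c \<sigma>r n P) D = (\<integral>\<^sup>+x. \<integral>\<^sup>+\<nu>. indicator D (Y (x, \<nu>)) \<partial>N \<partial>P)" .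
  have m: "(\<lambda>x. \<integral>\<^sup>+\<nu>. indicator D (Y (x, \<nu>)) \<partial>N :: ennreal) \<in> borel_measurable P" by measurable
  show ?thesis
    unfolding e nn_integral_0_iff_AE[OF m] AE_out_blocks_section[OF D] by simp
qed

text \<open>Makes the Radon-Nikodym derivative the actual density of the joint law. A null set of
  the product of the marginals has null sections for almost every input, and the conditional output
  laws have the same null sets as the marginal one, namely those of the reference measure.\<close>

lemma joint_law_absolutely_continuous:
  "absolutely_continuous (P \<Otimes>\<^sub>M out_law M \<sigma>c \<sigma>r n P) (joint_law M \<sigma>c \<sigma>r n P)"
  unfolding absolutely_continuous_def
proof (rule subsetI)
  interpret O: prob_space "out_law M \<sigma>c \<sigma>r n P" by (rule prob_space_out_law)
  fix D assume A0: "D \<in> null_sets (P \<Otimes>\<^sub>M out_law M \<sigma>c \<sigma>r n P)"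
  then have D: "D \<in> sets (block_space M n \<Otimes>\<^sub>M block_space M n)"
    using sets_joint_law sets_joint_law' by (metis null_setsD2)
  note D [measurable]
  have D' [measurable]: "D \<in> sets (P \<Otimes>\<^sub>M out_law M \<sigma>c \<sigma>r n P)" using A0 by auto
  have sec: "{y \<in> space (block_space M n). (x, y) \<in> D} \<in> sets (block_space M n)" if "x \<in> space P" for x
  proof -
    have "x \<in> space (block_space M n)" using that sets_eq_imp_space_eq[OF sets_P] by simp
    then have "(\<lambda>y. (x, y)) \<in> measurable (block_space M n) (block_space M n \<Otimes>\<^sub>M block_space M n)"
      by measurable
    from measurable_sets[OF this D] show ?thesis by (simp add: vimage_def Int_def conj_commute)
  qed
  have "0 = emeasure (P \<Otimes>\<^sub>M out_law M \<sigma>c \<sigma>r n P) D" using A0 by auto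
  also have "\<dots> = (\<integral>\<^sup>+x. emeasure (out_law M \<sigma>c \<sigma>r n P) (Pair x -` D) \<partial>P)"
    by (rule O.emeasure_pair_measure_alt[OF D'])
  finally have ae: "AE x in P. emeasure (out_law M \<sigma>c \<sigma>r n P) (Pair x -` D) = 0"
    using nn_integral_0_iff_AE[OF O.measurable_emeasure_Pair[OF D']] by simp
  have "emeasure (joint_law M \<sigma>c \<sigma>r n P) D = (\<integral>\<^sup>+z. indicator D z \<partial>joint_law M \<sigma>c \<sigma>r n P)"
    using D by (simp add: sets_joint_law')
  also have "\<dots> = (\<integral>\<^sup>+\<omega>. indicator D (fst \<omega>, Y \<omega>) \<partial>(P \<Otimes>\<^sub>M N))"
    unfolding joint_law_def by (rule nn_integral_distr) auto
  also have "\<dots> = (\<integral>\<^sup>+x. \<integral>\<^sup>+\<nu>. indicator D (fst (x, \<nu>), Y (x, \<nu>)) \<partial>N \<partial>P)"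
    by (rule PN.M2.nn_integral_fst[symmetric]) measurable
  also have "\<dots> = (\<integral>\<^sup>+x. 0 \<partial>P)"
  proof (rule nn_integral_cong_AE, use ae AE_space in eventually_elim)
    case (elim x)
    let ?S = "{y \<in> space (block_space M n). (x, y) \<in> D}"
    have "Pair x -` D = ?S"
      using sets.sets_into_space[OF D] by (auto simp: space_pair_measure)
    then have "emeasure (out_blocks n) ?S = 0"
      using out_law_null_iff[OF sec[OF elim(2)]] elim by simp
    then have "(\<integral>\<^sup>+\<nu>. indicator ?S (Y (x, \<nu>)) \<partial>N) = 0"
      using AE_out_blocks_section[OF sec[OF elim(2)], of x] by simp
    also have "(\<integral>\<^sup>+\<nu>. indicator ?S (Y (x, \<nu>)) \<partial>N) = (\<integral>\<^sup>+\<nu>. indicator D (x, Y (x, \<nu>)) \<partial>N)"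
      using measurable_space[OF Y_section_measurable] by (intro nn_integral_cong) (auto simp: indicator_def)
    finally show ?case by simp
  qed
  finally show "D \<in> null_sets (joint_law M \<sigma>c \<sigma>r n P)"
    using D by (auto simp: null_sets_def sets_joint_law')
qed

text \<open>Verifies the hypothesis of \<open>KL_upper\<close>. By the choice of \<open>U\<close>,
  the mean of the derivative times \<open>exp (- U)\<close> is at most its integral against
  \<open>P\<close> times the reference output measure. With \<open>h\<close> the derivative of the
  reference measure against the true output law, that integral is the mean of \<open>h\<close> under
  the joint law, which is the total mass 1 of the reference measure.\<close>

theorem information_upper:
  assumes U: "integrable (P \<Otimes>\<^sub>M N) U" and UL: "\<And>\<omega>. exp (- U \<omega>) \<le> sample_lik n (fst \<omega>) (snd \<omega>)"
  shows "info_integrable M \<sigma>c \<sigma>r n P"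
    and "info_nats M \<sigma>c \<sigma>r n P \<le> (\<integral>\<omega>. U \<omega> \<partial>(P \<Otimes>\<^sub>M N))"
proof -
  let ?O = "out_law M \<sigma>c \<sigma>r n P" and ?J = "joint_law M \<sigma>c \<sigma>r n P" and ?Q = "out_blocks n"
  let ?\<rho> = "info_deriv M \<sigma>c \<sigma>r n P"
  interpret O: prob_space ?O by (rule prob_space_out_law)
  interpret Q: prob_space ?Q by (rule prob_space_out_blocks)
  interpret J: prob_space ?J by (rule prob_space_joint_law)
  interpret PO: pair_prob_space P ?O ..
  have acQ: "absolutely_continuous ?O ?Q"
    unfolding absolutely_continuous_def
    by (rule subsetI) (use out_law_null_iff in \<open>auto simp: null_sets_def sets_out_blocks\<close>)
  have sQO: "sets ?Q = sets ?O" by (simp add: sets_out_blocks)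
  define h where "h = RN_deriv ?O ?Q"
  have hO: "h \<in> borel_measurable ?O" unfolding h_def by simp
  have hB [measurable]: "h \<in> borel_measurable (block_space M n)"
    using hO measurable_cong_sets[OF sets_out_law refl] by blast
  have hQ: "(\<integral>\<^sup>+y. f y \<partial>?Q) = (\<integral>\<^sup>+y. h y * f y \<partial>?O)" if "f \<in> borel_measurable ?O" for f
    unfolding h_def by (rule O.RN_deriv_nn_integral[OF acQ sQO that])
  have \<rho>m [measurable]: "?\<rho> \<in> borel_measurable (block_space M n \<Otimes>\<^sub>M block_space M n)"
    using borel_measurable_RN_deriv[of "P \<Otimes>\<^sub>M ?O" ?J] measurable_cong_sets[OF sets_joint_law refl] measurable_cong_sets[OF sets_joint_law' refl] by blast
  have \<rho>s: "(\<lambda>y. ?\<rho> (x, y)) \<in> borel_measurable (block_space M n)" if "x \<in> space P" for x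
  proof -
    have "x \<in> space (block_space M n)" using that sets_eq_imp_space_eq[OF sets_P] by simp
    then show ?thesis by measurable
  qed
  have likm: "(\<lambda>\<omega>. sample_lik n (fst \<omega>) (snd \<omega>)) \<in> borel_measurable (P \<Otimes>\<^sub>M N)"
    by (rule sample_lik_measurable) (auto intro!: measurable_compose[OF X_measurable block_space_component])
  have "(\<integral>\<^sup>+\<omega>. ?\<rho> (fst \<omega>, Y \<omega>) * ennreal (exp (- U \<omega>)) \<partial>(P \<Otimes>\<^sub>M N))
    \<le> (\<integral>\<^sup>+\<omega>. ?\<rho> (fst \<omega>, Y \<omega>) * ennreal (sample_lik n (fst \<omega>) (snd \<omega>)) \<partial>(P \<Otimes>\<^sub>M N))"
    by (intro nn_integral_mono mult_left_mono ennreal_leI UL) simp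
  also have "\<dots> = (\<integral>\<^sup>+x. \<integral>\<^sup>+\<nu>. ?\<rho> (fst (x, \<nu>), Y (x, \<nu>)) * ennreal (sample_lik n (fst (x, \<nu>)) (snd (x, \<nu>))) \<partial>N \<partial>P)"
    by (rule PN.M2.nn_integral_fst[symmetric]) (use likm in measurable)
  also have "\<dots> = (\<integral>\<^sup>+x. \<integral>\<^sup>+y. ?\<rho> (x, y) \<partial>?Q \<partial>P)"
    unfolding fst_conv snd_conv by (intro nn_integral_cong nn_integral_sample_lik \<rho>s)
  also have "\<dots> = (\<integral>\<^sup>+x. \<integral>\<^sup>+y. h y * ?\<rho> (x, y) \<partial>?O \<partial>P)"
    by (intro nn_integral_cong hQ) (use \<rho>s measurable_cong_sets[OF sets_out_law refl] in blast)
  also have "\<dots> = (\<integral>\<^sup>+z. h (snd z) * ?\<rho> z \<partial>(P \<Otimes>\<^sub>M ?O))"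
    by (subst O.nn_integral_fst[symmetric]) (use hO in \<open>auto simp: case_prod_beta'\<close>)
  also have "\<dots> = (\<integral>\<^sup>+z. ?\<rho> z * h (snd z) \<partial>(P \<Otimes>\<^sub>M ?O))" by (simp only: mult.commute)
  also have "\<dots> = (\<integral>\<^sup>+z. h (snd z) \<partial>?J)"
    by (rule PO.RN_deriv_nn_integral[OF joint_law_absolutely_continuous sets_joint_law, symmetric])
      (rule measurable_compose[OF measurable_snd hO])
  also have "\<dots> = (\<integral>\<^sup>+\<omega>. h (Y \<omega>) \<partial>(P \<Otimes>\<^sub>M N))"
    unfolding joint_law_def by (subst nn_integral_distr) auto
  also have "\<dots> = (\<integral>\<^sup>+y. h y \<partial>?O)"
    unfolding out_law_def by (rule nn_integral_distr[symmetric]) (use hO in \<open>auto simp: out_law_def\<close>)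
  also have "\<dots> = 1"
    using hQ[of "\<lambda>_. 1"] Q.emeasure_space_1 by simp
  finally have le: "(\<integral>\<^sup>+\<omega>. ?\<rho> (fst \<omega>, Y \<omega>) * ennreal (exp (- U \<omega>)) \<partial>(P \<Otimes>\<^sub>M N)) \<le> 1" .
  have T: "(\<lambda>\<omega>. (fst \<omega>, Y \<omega>)) \<in> measurable (P \<Otimes>\<^sub>M N) ?J"
    using XY_measurable measurable_cong_sets[OF refl sets_joint_law'] by blast
  have d: "distr (P \<Otimes>\<^sub>M N) ?J (\<lambda>\<omega>. (fst \<omega>, Y \<omega>)) = ?J"
    by (subst (2) joint_law_def) (rule distr_cong, auto simp: sets_joint_law')
  note K = KL_upper[OF prob_space_product prob_space_joint_law sets_joint_law joint_law_absolutely_continuous T d U le PN.prob_space_axioms]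
  show "integrable ?J (\<lambda>z. ln (enn2real (?\<rho> z)))" by (rule K(1))
  show "info_nats M \<sigma>c \<sigma>r n P \<le> (\<integral>\<omega>. U \<omega> \<partial>(P \<Otimes>\<^sub>M N))"
    unfolding info_nats_def by (rule K(2))
qed

end

end

section \<open>Laws and means of the single noise components\<close>

lemma nn_integral_pair4:
  assumes "sigma_finite_measure S1" "sigma_finite_measure S2" "sigma_finite_measure W"
    and f: "f \<in> borel_measurable (P \<Otimes>\<^sub>M S1 \<Otimes>\<^sub>M S2 \<Otimes>\<^sub>M W)"
  shows "(\<integral>\<^sup>+\<omega>. f \<omega> \<partial>(P \<Otimes>\<^sub>M S1 \<Otimes>\<^sub>M S2 \<Otimes>\<^sub>M W)) =
    (\<integral>\<^sup>+x. \<integral>\<^sup>+a. \<integral>\<^sup>+b. \<integral>\<^sup>+w. f (x, a, b, w) \<partial>W \<partial>S2 \<partial>S1 \<partial>P)"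
proof -
  interpret S1: sigma_finite_measure S1 by fact
  interpret S2: sigma_finite_measure S2 by fact
  interpret W: sigma_finite_measure W by fact
  interpret S2W: pair_sigma_finite S2 W ..
  have SW: "sigma_finite_measure (S2 \<Otimes>\<^sub>M W)" ..
  then interpret SW: sigma_finite_measure "S2 \<Otimes>\<^sub>M W" .
  interpret S1SW: pair_sigma_finite S1 "S2 \<Otimes>\<^sub>M W" ..
  have SSW: "sigma_finite_measure (S1 \<Otimes>\<^sub>M S2 \<Otimes>\<^sub>M W)" ..
  have "(\<integral>\<^sup>+\<omega>. f \<omega> \<partial>(P \<Otimes>\<^sub>M S1 \<Otimes>\<^sub>M S2 \<Otimes>\<^sub>M W)) = (\<integral>\<^sup>+x. \<integral>\<^sup>+q. f (x, q) \<partial>(S1 \<Otimes>\<^sub>M S2 \<Otimes>\<^sub>M W) \<partial>P)"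
    by (rule sigma_finite_measure.nn_integral_fst[OF SSW f, symmetric])
  also have "\<dots> = (\<integral>\<^sup>+x. \<integral>\<^sup>+a. \<integral>\<^sup>+q. f (x, a, q) \<partial>(S2 \<Otimes>\<^sub>M W) \<partial>S1 \<partial>P)"
    by (intro nn_integral_cong sigma_finite_measure.nn_integral_fst[OF SW, symmetric] measurable_compose[OF _ f]) auto
  also have "\<dots> = (\<integral>\<^sup>+x. \<integral>\<^sup>+a. \<integral>\<^sup>+b. \<integral>\<^sup>+w. f (x, a, b, w) \<partial>W \<partial>S2 \<partial>S1 \<partial>P)"
    by (intro nn_integral_cong W.nn_integral_fst[symmetric] measurable_compose[OF _ f]) auto
  finally show ?thesis .
qed

lemma distr_additive_noise_component:
  assumes "1 \<le> k" "m < M"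
  shows "distr (additive_noise M) borel (\<lambda>w. w k m) = std_complex_normal"
proof -
  let ?W1 = "noise_block M"
  have W1: "prob_space ?W1" by (intro prob_space_PiM prob_space_std_complex_normal)
  have "distr (additive_noise M) ?W1 (\<lambda>w. w k) = ?W1"
    unfolding additive_noise_def by (rule distr_PiM_component) (use assms W1 in auto)
  then have "distr (additive_noise M) borel (\<lambda>w. w k m) = distr ?W1 borel (\<lambda>v. v m)"
    using distr_distr[of "\<lambda>v. v m" ?W1 borel "\<lambda>w. w k" "additive_noise M"] assms
    by (simp add: comp_def additive_noise_def measurable_component_borel)
  also have "\<dots> = distr ?W1 std_complex_normal (\<lambda>v. v m)"
    by (rule distr_cong) auto
  also have "\<dots> = std_complex_normal"
    by (rule distr_PiM_component) (use assms prob_space_std_complex_normal in auto)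
  finally show ?thesis .
qed

lemma distr_phase_source_increment:
  assumes "0 < \<sigma>" "1 \<le> k"
  shows "distr (phase_source \<sigma>) borel (\<lambda>s. snd s k) = wrapped_normal \<sigma>"
proof -
  let ?D = "PiM {1..} (\<lambda>_::nat. wrapped_normal \<sigma>)"
  have D: "prob_space ?D" by (intro prob_space_PiM prob_space_wrapped_normal assms)
  have "distr (phase_source \<sigma>) ?D snd = ?D"
    unfolding phase_source_def
    by (rule distr_pair_snd[OF prob_space_uniform_phase prob_space_imp_sigma_finite[OF D]])
  then have "distr (phase_source \<sigma>) borel (\<lambda>s. snd s k) = distr ?D borel (\<lambda>d. d k)"
    using distr_distr[of "\<lambda>d. d k" ?D borel snd "phase_source \<sigma>"] assms
    by (simp add: comp_def phase_source_def measurable_component_borel)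
  also have "\<dots> = distr ?D (wrapped_normal \<sigma>) (\<lambda>d. d k)"
    by (rule distr_cong) auto
  also have "\<dots> = wrapped_normal \<sigma>"
    by (rule distr_PiM_component) (use assms prob_space_wrapped_normal in auto)
  finally show ?thesis .
qed

context channel_input
begin

lemma nn_integral_noise_component:
  assumes k: "k \<in> {1..n}" and m: "m < M" and G: "G \<in> borel_measurable ((borel \<Otimes>\<^sub>M borel) \<Otimes>\<^sub>M borel)"
  shows "(\<integral>\<^sup>+\<omega>. G ((fst \<omega> k m, phase (fst (snd \<omega>)) k + real m * phase (fst (snd (snd \<omega>))) k), snd (snd (snd \<omega>)) k m) \<partial>(P \<Otimes>\<^sub>M N)) =
    (\<integral>\<^sup>+\<omega>. \<integral>\<^sup>+w. G ((fst \<omega> k m, phase (fst (snd \<omega>)) k + real m * phase (fst (snd (snd \<omega>))) k), w) \<partial>std_complex_normal \<partial>(P \<Otimes>\<^sub>M N))"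
proof -
  interpret CN: prob_space std_complex_normal by (rule prob_space_std_complex_normal)
  interpret W: prob_space "additive_noise M" by (rule prob_space_additive_noise)
  note sf = prob_space_imp_sigma_finite[OF prob_space_phase_source[OF sigma(1)]]
    prob_space_imp_sigma_finite[OF prob_space_phase_source[OF sigma(2)]] W.sigma_finite_measure_axioms
  have k1: "1 \<le> k" using k by simp
  have [measurable]: "(\<lambda>\<omega>. fst \<omega> k m) \<in> borel_measurable (P \<Otimes>\<^sub>M N)"
    by (rule measurable_compose[OF X_measurable block_space_component[OF k m]])
  have [measurable]: "(\<lambda>\<omega>. phase (fst (snd \<omega>)) k) \<in> borel_measurable (P \<Otimes>\<^sub>M N)"
    "(\<lambda>\<omega>. phase (fst (snd (snd \<omega>))) k) \<in> borel_measurable (P \<Otimes>\<^sub>M N)"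
    "(\<lambda>\<omega>. snd (snd (snd \<omega>)) k m) \<in> borel_measurable (P \<Otimes>\<^sub>M N)"
    using channel_noise_coordinates(1)[of k M \<sigma>c \<sigma>r] channel_noise_coordinates(2)[of k M \<sigma>c \<sigma>r]
      channel_noise_coordinates(5)[OF k1 m, of \<sigma>c \<sigma>r]
    by (auto intro: measurable_compose[OF measurable_snd])
  note G [measurable]
  let ?Z = "\<lambda>\<omega>. (fst \<omega> k m, phase (fst (snd \<omega>)) k + real m * phase (fst (snd (snd \<omega>))) k)"
  have m1: "(\<lambda>\<omega>. G (?Z \<omega>, snd (snd (snd \<omega>)) k m)) \<in> borel_measurable (P \<Otimes>\<^sub>M N)" by measurable
  have m2: "(\<lambda>\<omega>. \<integral>\<^sup>+w. G (?Z \<omega>, w) \<partial>std_complex_normal) \<in> borel_measurable (P \<Otimes>\<^sub>M N)" by measurable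
  have comp: "(\<integral>\<^sup>+w. G (z, w k m) \<partial>additive_noise M) = (\<integral>\<^sup>+w. G (z, w) \<partial>std_complex_normal)" for z
  proof -
    have gm: "(\<lambda>w. G (z, w)) \<in> borel_measurable borel"
      by (rule measurable_compose[OF _ G], rule measurable_Pair1') (simp add: space_pair_measure)
    have "(\<integral>\<^sup>+w. G (z, w) \<partial>std_complex_normal) = (\<integral>\<^sup>+w. G (z, w) \<partial>distr (additive_noise M) borel (\<lambda>w. w k m))"
      by (simp add: distr_additive_noise_component[OF k1 m])
    also have "\<dots> = (\<integral>\<^sup>+w. G (z, w k m) \<partial>additive_noise M)"
      by (rule nn_integral_distr) (use gm in \<open>auto intro!: additive_noise_component k1 m\<close>)
    finally show ?thesis ..
  qed
  show ?thesis
    unfolding channel_noise_def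
    by (subst nn_integral_pair4[OF sf m1[unfolded channel_noise_def]], subst nn_integral_pair4[OF sf m2[unfolded channel_noise_def]])
      (simp add: comp W.emeasure_space_1)
qed

text \<open>Conditioning on input and phase of one coordinate, of which the additive noise is
  independent: a bound on the mean over the noise that is uniform in the phase passes to the full
  expectation. The quadratic growth in \<open>bd\<close> supplies the integrability for
  Fubini.\<close>

lemma integral_noise_component_le:
  assumes k: "k \<in> {1..n}" and m: "m < M"
    and u: "(\<lambda>p. u (fst (fst p)) (snd (fst p)) (snd p)) \<in> borel_measurable ((borel \<Otimes>\<^sub>M borel) \<Otimes>\<^sub>M borel)"
    and bd: "\<And>x \<phi> w. \<bar>u x \<phi> w\<bar> \<le> C0 + C1 * (cmod x)\<^sup>2 + C2 * (cmod w)\<^sup>2" and C: "0 \<le> C0" "0 \<le> C1" "0 \<le> C2"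
    and le: "\<And>x \<phi>. (\<integral>w. u x \<phi> w \<partial>std_complex_normal) \<le> b0 + b1 * (cmod x)\<^sup>2"
    and X: "integrable P (\<lambda>x. (cmod (x k m))\<^sup>2)"
  shows "integrable (P \<Otimes>\<^sub>M N) (\<lambda>\<omega>. u (fst \<omega> k m) (phase (fst (snd \<omega>)) k + real m * phase (fst (snd (snd \<omega>))) k) (snd (snd (snd \<omega>)) k m))" (is "integrable _ ?u")
    and "(\<integral>\<omega>. u (fst \<omega> k m) (phase (fst (snd \<omega>)) k + real m * phase (fst (snd (snd \<omega>))) k) (snd (snd (snd \<omega>)) k m) \<partial>(P \<Otimes>\<^sub>M N)) \<le> b0 + b1 * (\<integral>x. (cmod (x k m))\<^sup>2 \<partial>P)"
proof -
  interpret CN: prob_space std_complex_normal by (rule prob_space_std_complex_normal)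
  have k1: "1 \<le> k" using k by simp
  have Xm [measurable]: "(\<lambda>\<omega>. fst \<omega> k m) \<in> borel_measurable (P \<Otimes>\<^sub>M N)"
    by (rule measurable_compose[OF X_measurable block_space_component[OF k m]])
  have [measurable]: "(\<lambda>\<omega>. phase (fst (snd \<omega>)) k) \<in> borel_measurable (P \<Otimes>\<^sub>M N)"
    "(\<lambda>\<omega>. phase (fst (snd (snd \<omega>))) k) \<in> borel_measurable (P \<Otimes>\<^sub>M N)"
    "(\<lambda>\<omega>. snd (snd (snd \<omega>)) k m) \<in> borel_measurable (P \<Otimes>\<^sub>M N)"
    using channel_noise_coordinates(1)[of k M \<sigma>c \<sigma>r] channel_noise_coordinates(2)[of k M \<sigma>c \<sigma>r]
      channel_noise_coordinates(5)[OF k1 m, of \<sigma>c \<sigma>r]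
    by (auto intro: measurable_compose[OF measurable_snd])
  let ?Z = "\<lambda>\<omega>. (fst \<omega> k m, phase (fst (snd \<omega>)) k + real m * phase (fst (snd (snd \<omega>))) k)"
  let ?J = "\<lambda>\<omega>. (?Z \<omega>, snd (snd (snd \<omega>)) k m)"
  let ?v = "\<lambda>p. u (fst (fst p)) (snd (fst p)) (snd p)"
  let ?A = "distr (P \<Otimes>\<^sub>M N) (borel \<Otimes>\<^sub>M borel) ?Z"
  note u [measurable]
  have Zm [measurable]: "?Z \<in> measurable (P \<Otimes>\<^sub>M N) (borel \<Otimes>\<^sub>M borel)" by measurable
  have Jm [measurable]: "?J \<in> measurable (P \<Otimes>\<^sub>M N) ((borel \<Otimes>\<^sub>M borel) \<Otimes>\<^sub>M borel)" by measurable
  interpret A: prob_space ?A by (rule PN.prob_space_distr) measurable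
  interpret AC: pair_prob_space ?A std_complex_normal ..
  have law: "distr (P \<Otimes>\<^sub>M N) ((borel \<Otimes>\<^sub>M borel) \<Otimes>\<^sub>M borel) ?J = ?A \<Otimes>\<^sub>M std_complex_normal"
  proof (rule measure_eqI_nn_integral)
    show s: "sets (distr (P \<Otimes>\<^sub>M N) ((borel \<Otimes>\<^sub>M borel) \<Otimes>\<^sub>M borel) ?J) = sets (?A \<Otimes>\<^sub>M std_complex_normal)"
      unfolding sets_distr by (intro sets_pair_measure_cong) auto
    fix g :: "(complex \<times> real) \<times> complex \<Rightarrow> ennreal"
    assume gD: "g \<in> borel_measurable (distr (P \<Otimes>\<^sub>M N) ((borel \<Otimes>\<^sub>M borel) \<Otimes>\<^sub>M borel) ?J)"
    then have g [measurable]: "g \<in> borel_measurable ((borel \<Otimes>\<^sub>M borel) \<Otimes>\<^sub>M borel)" by simp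
    have g': "g \<in> borel_measurable (?A \<Otimes>\<^sub>M std_complex_normal)" using gD measurable_cong_sets[OF s refl] by blast
    have "(\<integral>\<^sup>+p. g p \<partial>distr (P \<Otimes>\<^sub>M N) ((borel \<Otimes>\<^sub>M borel) \<Otimes>\<^sub>M borel) ?J) = (\<integral>\<^sup>+\<omega>. g (?J \<omega>) \<partial>(P \<Otimes>\<^sub>M N))"
      by (rule nn_integral_distr) auto
    also have "\<dots> = (\<integral>\<^sup>+\<omega>. \<integral>\<^sup>+w. g (?Z \<omega>, w) \<partial>std_complex_normal \<partial>(P \<Otimes>\<^sub>M N))"
      by (rule nn_integral_noise_component[OF k m g])
    also have "\<dots> = (\<integral>\<^sup>+z. \<integral>\<^sup>+w. g (z, w) \<partial>std_complex_normal \<partial>?A)"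
      by (rule nn_integral_distr[symmetric]) measurable
    also have "\<dots> = (\<integral>\<^sup>+p. g p \<partial>(?A \<Otimes>\<^sub>M std_complex_normal))"
      by (rule CN.nn_integral_fst[OF g'])
    finally show "(\<integral>\<^sup>+p. g p \<partial>distr (P \<Otimes>\<^sub>M N) ((borel \<Otimes>\<^sub>M borel) \<Otimes>\<^sub>M borel) ?J) = (\<integral>\<^sup>+p. g p \<partial>(?A \<Otimes>\<^sub>M std_complex_normal))" .
  qed
  have X1: "integrable (P \<Otimes>\<^sub>M N) (\<lambda>\<omega>. (cmod (fst \<omega> k m))\<^sup>2)"
    and X2: "(\<integral>\<omega>. (cmod (fst \<omega> k m))\<^sup>2 \<partial>(P \<Otimes>\<^sub>M N)) = (\<integral>x. (cmod (x k m))\<^sup>2 \<partial>P)"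
  proof -
    have d: "distr (P \<Otimes>\<^sub>M N) P fst = P" by (rule PN.M2.distr_pair_fst)
    have [measurable]: "(\<lambda>x. (cmod (x k m))\<^sup>2) \<in> borel_measurable P" using X by auto
    show "integrable (P \<Otimes>\<^sub>M N) (\<lambda>\<omega>. (cmod (fst \<omega> k m))\<^sup>2)"
      using X integrable_distr_eq[of fst "P \<Otimes>\<^sub>M N" P "\<lambda>x. (cmod (x k m))\<^sup>2"] by (simp add: d)
    show "(\<integral>\<omega>. (cmod (fst \<omega> k m))\<^sup>2 \<partial>(P \<Otimes>\<^sub>M N)) = (\<integral>x. (cmod (x k m))\<^sup>2 \<partial>P)"
      using integral_distr[of fst "P \<Otimes>\<^sub>M N" P "\<lambda>x. (cmod (x k m))\<^sup>2"] by (simp add: d)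
  qed
  have A1: "integrable ?A (\<lambda>z. (cmod (fst z))\<^sup>2)"
    by (subst integrable_distr_eq) (use X1 in auto)
  have A2: "(\<integral>z. (cmod (fst z))\<^sup>2 \<partial>?A) = (\<integral>x. (cmod (x k m))\<^sup>2 \<partial>P)"
    by (subst integral_distr) (use X2 in auto)
  have uA: "?v \<in> borel_measurable (?A \<Otimes>\<^sub>M std_complex_normal)"
    using u measurable_cong_sets[OF arg_cong[where f = sets, OF law, unfolded sets_distr] refl] by blast
  have W2: "integrable std_complex_normal (\<lambda>w. (cmod w)\<^sup>2)" by (rule std_complex_normal_second_moment)
  have intA: "integrable (?A \<Otimes>\<^sub>M std_complex_normal) ?v"
  proof (rule Bochner_Integration.integrable_bound)
    have "integrable (?A \<Otimes>\<^sub>M std_complex_normal) (\<lambda>p. (cmod (snd p))\<^sup>2)"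
    proof (rule integrableI_nonneg)
      have "(\<integral>\<^sup>+p. ennreal ((cmod (snd p))\<^sup>2) \<partial>(?A \<Otimes>\<^sub>M std_complex_normal)) =
          (\<integral>\<^sup>+z. \<integral>\<^sup>+w. ennreal ((cmod w)\<^sup>2) \<partial>std_complex_normal \<partial>?A)"
        by (subst CN.nn_integral_fst[symmetric]) auto
      also have "\<dots> = (\<integral>\<^sup>+w. ennreal ((cmod w)\<^sup>2) \<partial>std_complex_normal)"
        by (simp add: A.emeasure_space_1[simplified])
      also have "\<dots> < \<infinity>" using W2 by (simp add: integrable_iff_bounded)
      finally show "(\<integral>\<^sup>+p. ennreal ((cmod (snd p))\<^sup>2) \<partial>(?A \<Otimes>\<^sub>M std_complex_normal)) < \<infinity>" .
    qed auto
    moreover have "integrable (?A \<Otimes>\<^sub>M std_complex_normal) (\<lambda>p. (cmod (fst (fst p)))\<^sup>2)"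
    proof (rule integrableI_nonneg)
      have "(\<integral>\<^sup>+p. ennreal ((cmod (fst (fst p)))\<^sup>2) \<partial>(?A \<Otimes>\<^sub>M std_complex_normal)) =
          (\<integral>\<^sup>+z. \<integral>\<^sup>+w. ennreal ((cmod (fst z))\<^sup>2) \<partial>std_complex_normal \<partial>?A)"
        by (subst CN.nn_integral_fst[symmetric]) auto
      also have "\<dots> = (\<integral>\<^sup>+z. ennreal ((cmod (fst z))\<^sup>2) \<partial>?A)"
        by (simp add: CN.emeasure_space_1[simplified])
      also have "\<dots> < \<infinity>" using A1 by (simp add: integrable_iff_bounded)
      finally show "(\<integral>\<^sup>+p. ennreal ((cmod (fst (fst p)))\<^sup>2) \<partial>(?A \<Otimes>\<^sub>M std_complex_normal)) < \<infinity>" .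
    qed auto
    ultimately show "integrable (?A \<Otimes>\<^sub>M std_complex_normal) (\<lambda>p. C0 + C1 * (cmod (fst (fst p)))\<^sup>2 + C2 * (cmod (snd p))\<^sup>2)"
      by auto
    show "AE p in ?A \<Otimes>\<^sub>M std_complex_normal. norm (?v p) \<le> norm (C0 + C1 * (cmod (fst (fst p)))\<^sup>2 + C2 * (cmod (snd p))\<^sup>2)"
      using bd C by (intro AE_I2) (simp add: abs_of_nonneg)
  qed (rule uA)
  have "integrable (distr (P \<Otimes>\<^sub>M N) ((borel \<Otimes>\<^sub>M borel) \<Otimes>\<^sub>M borel) ?J) ?v" by (simp only: law intA)
  then show "integrable (P \<Otimes>\<^sub>M N) ?u"
    by (subst (asm) integrable_distr_eq) auto
  have "(\<integral>\<omega>. ?u \<omega> \<partial>(P \<Otimes>\<^sub>M N)) = (\<integral>p. ?v p \<partial>distr (P \<Otimes>\<^sub>M N) ((borel \<Otimes>\<^sub>M borel) \<Otimes>\<^sub>M borel) ?J)"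
    by (subst integral_distr) auto
  also have "\<dots> = (\<integral>p. ?v p \<partial>(?A \<Otimes>\<^sub>M std_complex_normal))" by (simp only: law)
  also have "\<dots> = (\<integral>z. \<integral>w. u (fst z) (snd z) w \<partial>std_complex_normal \<partial>?A)"
    using AC.integral_fst'[OF intA] by simp
  also have "\<dots> \<le> (\<integral>z. b0 + b1 * (cmod (fst z))\<^sup>2 \<partial>?A)"
    using AC.integrable_fst'[OF intA] A1 le by (intro integral_mono) auto
  also have "\<dots> = b0 + b1 * (\<integral>x. (cmod (x k m))\<^sup>2 \<partial>P)"
    using A1 A.prob_space by (simp add: A2)
  finally show "(\<integral>\<omega>. ?u \<omega> \<partial>(P \<Otimes>\<^sub>M N)) \<le> b0 + b1 * (\<integral>x. (cmod (x k m))\<^sup>2 \<partial>P)" .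
qed

lemma distr_noise:
  assumes "g \<in> measurable N L"
  shows "distr (P \<Otimes>\<^sub>M N) L (\<lambda>\<omega>. g (snd \<omega>)) = distr N L g"
  using distr_distr[OF assms measurable_snd[of P N]]
  by (simp add: comp_def distr_pair_snd[OF P PN.M2.sigma_finite_measure_axioms])

lemma integral_increment:
  assumes k: "1 \<le> k" and f [measurable]: "f \<in> borel_measurable borel"
    and bd: "\<And>t. \<bar>f t\<bar> \<le> (B::real)"
  shows "integrable (P \<Otimes>\<^sub>M N) (\<lambda>\<omega>. f (snd (fst (snd \<omega>)) k))"
    and "(\<integral>\<omega>. f (snd (fst (snd \<omega>)) k) \<partial>(P \<Otimes>\<^sub>M N)) = (\<integral>t. f t \<partial>wrapped_normal \<sigma>c)"
    and "integrable (P \<Otimes>\<^sub>M N) (\<lambda>\<omega>. f (snd (fst (snd (snd \<omega>))) k))"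
    and "(\<integral>\<omega>. f (snd (fst (snd (snd \<omega>))) k) \<partial>(P \<Otimes>\<^sub>M N)) = (\<integral>t. f t \<partial>wrapped_normal \<sigma>r)"
proof -
  let ?C = "phase_source \<sigma>c" and ?R = "phase_source \<sigma>r" and ?W = "additive_noise M"
  interpret R: prob_space ?R by (rule prob_space_phase_source[OF sigma(2)])
  interpret W: prob_space ?W by (rule prob_space_additive_noise)
  have RW: "prob_space (?R \<Otimes>\<^sub>M ?W)" by (intro prob_space_pair R.prob_space_axioms W.prob_space_axioms)
  note m = channel_noise_coordinates(3,4)[OF k, of M \<sigma>c \<sigma>r]
  note [measurable] = increment_measurable[OF k] measurable_compose[OF measurable_snd m(1)] measurable_compose[OF measurable_snd m(2)]
  have "distr N borel (\<lambda>\<nu>. snd (fst \<nu>) k) = distr (distr N ?C fst) borel (\<lambda>s. snd s k)"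
    unfolding channel_noise_def by (subst distr_distr) (auto simp: comp_def)
  also have "distr N ?C fst = ?C"
    unfolding channel_noise_def by (rule prob_space.distr_pair_fst[OF RW])
  finally have dc: "distr (P \<Otimes>\<^sub>M N) borel (\<lambda>\<omega>. snd (fst (snd \<omega>)) k) = wrapped_normal \<sigma>c"
    by (simp add: distr_noise[OF m(1)] distr_phase_source_increment[OF sigma(1) k])
  have "distr N borel (\<lambda>\<nu>. snd (fst (snd \<nu>)) k) = distr (distr (distr N (?R \<Otimes>\<^sub>M ?W) snd) ?R fst) borel (\<lambda>s. snd s k)"
    unfolding channel_noise_def by (subst distr_distr, simp, simp, subst distr_distr) (auto simp: comp_def)
  also have "distr N (?R \<Otimes>\<^sub>M ?W) snd = ?R \<Otimes>\<^sub>M ?W"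
    unfolding channel_noise_def
    by (rule distr_pair_snd[OF prob_space_phase_source[OF sigma(1)] prob_space_imp_sigma_finite[OF RW]])
  also have "distr (?R \<Otimes>\<^sub>M ?W) ?R fst = ?R" by (rule W.distr_pair_fst)
  finally have dr: "distr (P \<Otimes>\<^sub>M N) borel (\<lambda>\<omega>. snd (fst (snd (snd \<omega>))) k) = wrapped_normal \<sigma>r"
    by (simp add: distr_noise[OF m(2)] distr_phase_source_increment[OF sigma(2) k])
  show "integrable (P \<Otimes>\<^sub>M N) (\<lambda>\<omega>. f (snd (fst (snd \<omega>)) k))" "integrable (P \<Otimes>\<^sub>M N) (\<lambda>\<omega>. f (snd (fst (snd (snd \<omega>))) k))"
    using bd by (auto intro!: PN.integrable_const_bound[of _ B])
  show "(\<integral>\<omega>. f (snd (fst (snd \<omega>)) k) \<partial>(P \<Otimes>\<^sub>M N)) = (\<integral>t. f t \<partial>wrapped_normal \<sigma>c)"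
    unfolding dc[symmetric] by (subst integral_distr) auto
  show "(\<integral>\<omega>. f (snd (fst (snd (snd \<omega>))) k) \<partial>(P \<Otimes>\<^sub>M N)) = (\<integral>t. f t \<partial>wrapped_normal \<sigma>r)"
    unfolding dr[symmetric] by (subst integral_distr) auto
qed

end

section \<open>Expected cost of a block\<close>

text \<open>The weights are chosen with the asymptotics in mind: the input power, which is of the
  order of \<open>\<tau>\<close>, receives a factor close to 1, and the large factor
  \<open>1 + 1 / e\<close> falls on the noise power, which is later divided by
  \<open>\<tau>\<close>.\<close>

lemma square_sum_le:
  fixes a b e :: real
  assumes "0 < e"
  shows "(a + b)\<^sup>2 \<le> (1 + e) * a\<^sup>2 + (1 + 1 / e) * b\<^sup>2"
proof -
  have "0 \<le> (e * a - b)\<^sup>2 / e" using assms by simp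
  also have "(e * a - b)\<^sup>2 / e = e * a\<^sup>2 - 2 * a * b + 1 / e * b\<^sup>2"
    using assms by (simp add: power2_eq_square field_simps)
  finally show ?thesis by (simp add: power2_eq_square algebra_simps)
qed

lemma cmod_le_one_plus_square: "cmod w \<le> 1 + (cmod w)\<^sup>2"
proof -
  have "0 \<le> (cmod w - 1 / 2)\<^sup>2" by simp
  then show ?thesis by (simp add: power2_eq_square algebra_simps)
qed

text \<open>The balance for an input of modulus \<open>x\<close>: the linear branch of
  \<open>phase_cost\<close> on its tail event, minus the reward \<open>H\<close> when the output is
  certain to fall into the disc of radius \<open>R\<close>.\<close>

abbreviation tail_cost :: "real \<Rightarrow> real \<Rightarrow> real \<Rightarrow> real \<Rightarrow> complex \<Rightarrow> real" where
  "tail_cost K H R x w \<equiv> K * cmod w * indicator {w. x \<le> K * cmod w} w - H * indicator {w. cmod w < R - x} w"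

lemma integrable_tail_cost:
  assumes K: "1 \<le> K" and H: "0 \<le> H"
  shows "integrable std_complex_normal (\<lambda>w. tail_cost K H R x w)"
proof -
  interpret CN: prob_space std_complex_normal by (rule prob_space_std_complex_normal)
  have W2: "integrable std_complex_normal (\<lambda>w. (cmod w)\<^sup>2)" by (rule std_complex_normal_second_moment)
  show ?thesis
  proof (rule Bochner_Integration.integrable_bound)
    show "integrable std_complex_normal (\<lambda>w. K * (1 + (cmod w)\<^sup>2) + H)" using W2 by auto
    show "AE w in std_complex_normal. norm (tail_cost K H R x w) \<le> norm (K * (1 + (cmod w)\<^sup>2) + H)"
    proof (rule AE_I2)
      fix w
      have a: "0 \<le> K * cmod w * indicator {w. x \<le> K * cmod w} w" "K * cmod w * indicator {w. x \<le> K * cmod w} w \<le> K * (1 + (cmod w)\<^sup>2)"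
        using K cmod_le_one_plus_square[of w] by (auto simp: indicator_def)
      have b: "0 \<le> H * indicator {w. cmod w < R - x} w" "H * indicator {w. cmod w < R - x} w \<le> H" using H by (auto simp: indicator_def)
      show "norm (tail_cost K H R x w) \<le> norm (K * (1 + (cmod w)\<^sup>2) + H)"
        using a b unfolding real_norm_def by linarith
    qed
  qed (unfold indicator_def mem_Collect_eq, measurable)
qed

text \<open>\<open>Lz\<close> is the target value for the sum of the logarithms of normaliser and
  inverse weight; it will be \<open>ln pi / 2 + e\<close>. \<open>Z1\<close> meets the target
  outside the disc, \<open>Z2\<close> undercuts it by \<open>H\<close> inside, and
  \<open>err\<close> says that this gain makes up for the tail event.\<close>

locale dual_params = dual_bound +
  fixes e K H Lz :: real
  assumes e: "0 < e" and K: "K = 1 + 1 / sqrt (1 - \<kappa>\<^sup>2)" and H: "0 \<le> H"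
    and Z1: "\<And>s. R \<le> s \<Longrightarrow> ln (s * phase_norm \<kappa> s) \<le> Lz"
    and Z2: "ln (2 * pi) - ln A \<le> Lz - H"
    and err: "\<And>x::real. 0 \<le> x \<Longrightarrow> (\<integral>w. tail_cost K H R x w \<partial>std_complex_normal) \<le> e"
begin

lemma K_ge_1: "1 \<le> K"
  unfolding K using \<kappa> abs_square_less_1[of \<kappa>] by simp

text \<open>Bounds \<open>|y|\<^sup>2 / \<tau> - |w|\<^sup>2\<close>, the quadratic part of the
  logarithm of noise density over output density, by separate terms for input and noise.\<close>

definition out_cost :: "nat \<Rightarrow> complex \<Rightarrow> complex \<Rightarrow> real" where
  "out_cost m x w = - (cmod w)\<^sup>2 + ((1 + e) * (cmod x)\<^sup>2 + (1 + 1 / e) * (cmod w)\<^sup>2) / \<tau>"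

definition coord_cost :: "nat \<Rightarrow> complex \<Rightarrow> real \<Rightarrow> complex \<Rightarrow> real" where
  "coord_cost m x \<phi> w = out_cost m x w + (if m < 2 then
      (- ln pi + ln (radial_norm A R \<tau>) + Lz) + (Im (w * (cis (- \<phi>) * cnj (unit_dir x))))\<^sup>2 +
        (tail_cost K H R (cmod x) w)
      else ln \<tau>)"

lemma power_output_le: "(cmod (cis \<phi> * x + w))\<^sup>2 \<le> (1 + e) * (cmod x)\<^sup>2 + (1 + 1 / e) * (cmod w)\<^sup>2"
proof -
  have "cmod (cis \<phi> * x + w) \<le> cmod x + cmod w"
    using norm_triangle_ineq[of "cis \<phi> * x" w] by (simp add: norm_mult)
  then have "(cmod (cis \<phi> * x + w))\<^sup>2 \<le> (cmod x + cmod w)\<^sup>2" by (intro power_mono) auto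
  also have "\<dots> \<le> (1 + e) * (cmod x)\<^sup>2 + (1 + 1 / e) * (cmod w)\<^sup>2" by (rule square_sum_le[OF e])
  finally show ?thesis .
qed

lemma ln_cgauss: "ln (cgauss w) = - (cmod w)\<^sup>2 - ln pi"
  by (simp add: cgauss_def ln_div)

lemma coord_cost_ge_data:
  assumes m: "\<not> m < 2"
  shows "ln (cgauss w) - ln (outd m (cis \<phi> * x + w)) \<le> coord_cost m x \<phi> w"
proof -
  let ?y = "cis \<phi> * x + w"
  have "ln (outd m ?y) = - (cmod ?y)\<^sup>2 / \<tau> - ln pi - ln \<tau>"
    using m pos by (simp add: out_density_def ln_div ln_mult)
  moreover have "(cmod ?y)\<^sup>2 / \<tau> \<le> ((1 + e) * (cmod x)\<^sup>2 + (1 + 1 / e) * (cmod w)\<^sup>2) / \<tau>"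
    using power_output_le pos by (intro divide_right_mono) auto
  ultimately show ?thesis using m by (simp add: coord_cost_def out_cost_def ln_cgauss)
qed

text \<open>Undoing the phase and the input direction puts the input on the positive real axis and
  only rotates the noise, so the posterior cost becomes \<open>phase_cost\<close> at
  \<open>|x|\<close> plus rotated noise. Normaliser and radial weight are then compared at the
  output modulus: from \<open>R\<close> on they combine to
  \<open>|y| * phase_norm \<kappa> |y|\<close>, and below \<open>R\<close> the crude bound
  \<open>2 * pi\<close> meets the weight \<open>A\<close>.\<close>

lemma coord_cost_ge_phase:
  assumes m: "m < 2"
  shows "ln (cgauss w) - ln (outd m (cis \<phi> * x + w)) - ln (phase_posterior \<kappa> x (cis \<phi> * x + w) \<phi>) \<le> coord_cost m x \<phi> w"
proof -
  let ?y = "cis \<phi> * x + w" and ?c = "cis (- \<phi>) * cnj (unit_dir x)"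
  let ?s = "cmod ?y"
  have V: "0 < radial_norm A R \<tau>" by (rule radial_norm_bounds(3)) (rule pos)+
  have rw: "0 < radial_weight A R ?s" by (rule radial_weight_pos) (rule pos)+
  have Zp: "0 < phase_norm \<kappa> ?s" by (rule phase_norm_eq(2)) simp
  have l1: "ln (outd m ?y) = - ?s\<^sup>2 / \<tau> + ln (radial_weight A R ?s) - ln (radial_norm A R \<tau>)"
    using m V rw by (simp add: out_density_def ln_div ln_mult)
  have c: "?y * cis (- \<phi>) * cnj (unit_dir x) = of_real (cmod x) + w * ?c"
  proof -
    have "?y * cis (- \<phi>) * cnj (unit_dir x) = (cis \<phi> * cis (- \<phi>)) * (x * cnj (unit_dir x)) + w * ?c"
      by (simp add: algebra_simps)
    also have "\<dots> = of_real (cmod x) + w * ?c" by (simp add: cis_mult unit_dir_mult_cnj)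
    finally show ?thesis .
  qed
  have l2: "ln (phase_posterior \<kappa> x ?y \<phi>) = - phase_cost \<kappa> (of_real (cmod x) + w * ?c) - ln (phase_norm \<kappa> ?s)"
    unfolding phase_posterior_def c using Zp by (simp add: ln_div)
  have cm: "cmod (w * ?c) = cmod w" by (simp add: norm_mult)
  have p: "phase_cost \<kappa> (of_real (cmod x) + w * ?c) \<le>
      (Im (w * ?c))\<^sup>2 + K * cmod w * indicator {w. cmod x \<le> K * cmod w} w"
    using phase_cost_shift_le[OF \<kappa> _ K, of "cmod x" "w * ?c"] by (simp add: cm indicator_def)
  \<comment> \<open>If \<open>|w| < R - |x|\<close>, the output must lie in the disc and the reward
    can be claimed. For other outputs in the disc it is given up, which \<open>0 \<le> H\<close>
    allows; outside the disc the indicator is 0.\<close>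
  have z: "ln (phase_norm \<kappa> ?s) - ln (radial_weight A R ?s) \<le> Lz - H * indicator {w. cmod w < R - cmod x} w"
  proof (cases "?s < R")
    case True
    have "ln (phase_norm \<kappa> ?s) \<le> ln (2 * pi)" using Zp phase_norm_eq(3)[of ?s \<kappa>] by (subst ln_le_cancel_iff) auto
    then have "ln (phase_norm \<kappa> ?s) - ln (radial_weight A R ?s) \<le> Lz - H"
      using True Z2 by (simp add: radial_weight_def)
    then show ?thesis using H by (auto simp: indicator_def)
  next
    case False
    then have s: "0 < ?s" using pos by linarith
    have "\<not> cmod w < R - cmod x"
      using False norm_triangle_ineq[of "cis \<phi> * x" w] by (simp add: norm_mult)
    moreover have "ln (phase_norm \<kappa> ?s) - ln (radial_weight A R ?s) = ln (?s * phase_norm \<kappa> ?s)"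
      using s False Zp by (simp add: radial_weight_def ln_div ln_mult)
    ultimately show ?thesis using Z1[of ?s] False by simp
  qed
  have "?s\<^sup>2 / \<tau> \<le> ((1 + e) * (cmod x)\<^sup>2 + (1 + 1 / e) * (cmod w)\<^sup>2) / \<tau>"
    using power_output_le pos by (intro divide_right_mono) auto
  then show ?thesis
    using m p z by (simp add: l1 l2 coord_cost_def out_cost_def ln_cgauss)
qed

lemma ln_block_lik:
  "- ln (lik \<xi> \<delta>c \<delta>r \<theta>c \<theta>r w) \<le> ln (fc \<delta>c) + ln (fr \<delta>r) + (\<Sum>m<M. coord_cost m (\<xi> m) (\<theta>c + real m * \<theta>r) (w m))"
proof -
  let ?y = "\<lambda>m. cis (\<theta>c + real m * \<theta>r) * \<xi> m + w m"
  let ?d = "\<lambda>m. ln (cgauss (w m)) - ln (outd m (?y m))"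
  let ?u = "\<lambda>m. coord_cost m (\<xi> m) (\<theta>c + real m * \<theta>r) (w m)"
  have Ms: "{..<M} = insert 0 (insert 1 {2..<M})" using M by auto
  have dp: "0 < outd m z / cgauss v" for m z v
    using outd_pos[of m z] cgauss_pos[of v] by simp
  have pr: "(\<Prod>m<M. outd m (?y m) / cgauss (w m)) > 0"
    using outd_pos cgauss_pos by (intro prod_pos divide_pos_pos ballI) auto
  have "ln (\<Prod>m<M. outd m (?y m) / cgauss (w m)) = (\<Sum>m<M. ln (outd m (?y m) / cgauss (w m)))"
    by (rule ln_prod) (simp, rule less_imp_neq[OF dp, THEN not_sym])
  also have "\<dots> = (\<Sum>m<M. - ?d m)"
  proof (rule sum.cong[OF refl])
    fix m show "ln (outd m (?y m) / cgauss (w m)) = - ?d m"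
      using outd_pos[of m "?y m"] cgauss_pos[of "w m"] by (simp add: ln_div)
  qed
  finally have lp: "ln (\<Prod>m<M. outd m (?y m) / cgauss (w m)) = - (\<Sum>m<M. ?d m)" by (simp only: sum_negf)
  have "- ln (lik \<xi> \<delta>c \<delta>r \<theta>c \<theta>r w) = ln (fc \<delta>c) + ln (fr \<delta>r) + (\<Sum>m<M. ?d m)
      - ln (phase_posterior \<kappa> (\<xi> 0) (cis \<theta>c * \<xi> 0 + w 0) \<theta>c)
      - ln (phase_posterior \<kappa> (\<xi> 1) (cis (\<theta>c + \<theta>r) * \<xi> 1 + w 1) (\<theta>c + \<theta>r))"
    unfolding block_lik_def cis_wrap_pi
    using lp pr fc_pos[of \<delta>c] fr_pos[of \<delta>r] phase_posterior_pos
    by (simp add: ln_mult ln_div less_imp_neq[symmetric])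
  also have "(\<Sum>m<M. ?d m) = ?d 0 + ?d 1 + (\<Sum>m\<in>{2..<M}. ?d m)" unfolding Ms by simp
  also have "(\<Sum>m\<in>{2..<M}. ?d m) \<le> (\<Sum>m\<in>{2..<M}. ?u m)"
    by (intro sum_mono coord_cost_ge_data) auto
  finally have "- ln (lik \<xi> \<delta>c \<delta>r \<theta>c \<theta>r w) \<le> ln (fc \<delta>c) + ln (fr \<delta>r) +
      (?d 0 - ln (phase_posterior \<kappa> (\<xi> 0) (?y 0) (\<theta>c + real 0 * \<theta>r))) +
      (?d 1 - ln (phase_posterior \<kappa> (\<xi> 1) (?y 1) (\<theta>c + real 1 * \<theta>r))) + (\<Sum>m\<in>{2..<M}. ?u m)"
    by simp
  also have "\<dots> \<le> ln (fc \<delta>c) + ln (fr \<delta>r) + ?u 0 + ?u 1 + (\<Sum>m\<in>{2..<M}. ?u m)"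
    by (intro add_mono order_refl coord_cost_ge_phase) auto
  also have "\<dots> = ln (fc \<delta>c) + ln (fr \<delta>r) + (\<Sum>m<M. ?u m)" unfolding Ms by simp
  finally show ?thesis .
qed

text \<open>The part of the mean cost that is free of the input: \<open>- 1\<close> is the noise
  energy, \<open>1 / 2\<close> the variance of the noise component orthogonal to the input,
  \<open>e\<close> the allowance for \<open>tail_cost\<close>, and
  \<open>(1 + 1 / e) / \<tau>\<close> the noise share of the output power.\<close>

definition coord_const :: "nat \<Rightarrow> real" where
  "coord_const m = (if m < 2 then - ln pi + ln (radial_norm A R \<tau>) + Lz + 1 / 2 + e else ln \<tau>) - 1 + (1 + 1 / e) / \<tau>"

lemma coord_cost_measurable:
  "(\<lambda>p. coord_cost m (fst (fst p)) (snd (fst p)) (snd p)) \<in> borel_measurable ((borel \<Otimes>\<^sub>M borel) \<Otimes>\<^sub>M borel)"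
  unfolding coord_cost_def out_cost_def indicator_def mem_Collect_eq by measurable

lemma coord_cost_bound:
  "\<exists>C0 C1 C2. 0 \<le> C0 \<and> 0 \<le> C1 \<and> 0 \<le> C2 \<and>
    (\<forall>x \<phi> w. \<bar>coord_cost m x \<phi> w\<bar> \<le> C0 + C1 * (cmod x)\<^sup>2 + C2 * (cmod w)\<^sup>2)"
proof (intro exI conjI allI)
  let ?a = "\<bar>- ln pi + ln (radial_norm A R \<tau>) + Lz\<bar> + \<bar>ln \<tau>\<bar>"
  show "0 \<le> ?a + K + H" "0 \<le> (1 + e) / \<tau>" "0 \<le> 2 + K + (1 + 1 / e) / \<tau>"
    using K_ge_1 H e pos by auto
  fix x w :: complex and \<phi> :: real
  let ?c = "cis (- \<phi>) * cnj (unit_dir x)"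
  have im: "(Im (w * ?c))\<^sup>2 \<le> (cmod w)\<^sup>2"
  proof -
    have "\<bar>Im (w * ?c)\<bar> \<le> cmod (w * ?c)" by (rule abs_Im_le_cmod)
    also have "\<dots> = cmod w" by (simp add: norm_mult)
    finally show ?thesis by (metis abs_le_square_iff abs_norm_cancel)
  qed
  have kw: "K * cmod w * indicator {w. cmod x \<le> K * cmod w} w \<le> K + K * (cmod w)\<^sup>2"
  proof -
    have "K * cmod w * indicator {w. cmod x \<le> K * cmod w} w \<le> K * cmod w"
      using K_ge_1 by (auto simp: indicator_def)
    also have "\<dots> \<le> K * (1 + (cmod w)\<^sup>2)" using K_ge_1 cmod_le_one_plus_square by (intro mult_left_mono) auto
    finally show ?thesis by (simp add: algebra_simps)
  qed
  have kw0: "0 \<le> K * cmod w * indicator {w. cmod x \<le> K * cmod w} w" using K_ge_1 by simp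
  have h: "0 \<le> H * indicator {w. cmod w < R - cmod x} w" "H * indicator {w. cmod w < R - cmod x} w \<le> H"
    using H by (auto simp: indicator_def)
  have d: "((1 + e) * (cmod x)\<^sup>2 + (1 + 1 / e) * (cmod w)\<^sup>2) / \<tau> = (1 + e) / \<tau> * (cmod x)\<^sup>2 + (1 + 1 / e) / \<tau> * (cmod w)\<^sup>2"
    by (subst add_divide_distrib) simp
  have d0: "0 \<le> (1 + e) / \<tau> * (cmod x)\<^sup>2" "0 \<le> (1 + 1 / e) / \<tau> * (cmod w)\<^sup>2" using e pos by auto
  have i0: "0 \<le> (Im (w * ?c))\<^sup>2" "0 \<le> (cmod w)\<^sup>2" by auto
  have "(2 + K + (1 + 1 / e) / \<tau>) * (cmod w)\<^sup>2 = 2 * (cmod w)\<^sup>2 + K * (cmod w)\<^sup>2 + (1 + 1 / e) / \<tau> * (cmod w)\<^sup>2"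
    by (simp add: algebra_simps)
  moreover have "0 \<le> K * (cmod w)\<^sup>2" using K_ge_1 by simp
  \<comment> \<open>The estimate is proved for arbitrary reals, so that the nonlinear terms act as
    atoms and linear arithmetic suffices.\<close>
  moreover have "\<bar>- W + (D1 + D2) + (if b then k + I + (k1 - h) else l)\<bar> \<le> (\<bar>k\<bar> + \<bar>l\<bar> + K' + H') + D1 + (2 * W + KW + D2)"
    if "I \<le> W" "k1 \<le> K' + KW" "0 \<le> k1" "0 \<le> h" "h \<le> H'" "0 \<le> D1" "0 \<le> D2" "0 \<le> I" "0 \<le> W" "1 \<le> K'" "0 \<le> H'" "0 \<le> KW"
    for W D1 D2 k I k1 h l K' H' KW :: real and b
    using that by (intro abs_leI; cases b; simp only: if_True if_False; linarith)
  note this[OF im kw kw0 h d0 i0 K_ge_1 H]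
  ultimately show "\<bar>coord_cost m x \<phi> w\<bar> \<le> (?a + K + H) + (1 + e) / \<tau> * (cmod x)\<^sup>2 + (2 + K + (1 + 1 / e) / \<tau>) * (cmod w)\<^sup>2"
    unfolding coord_cost_def out_cost_def d by (simp only:)
qed

lemma integral_coord_cost:
  "(\<integral>w. coord_cost m x \<phi> w \<partial>std_complex_normal) \<le> coord_const m + (1 + e) / \<tau> * (cmod x)\<^sup>2"
proof -
  interpret CN: prob_space std_complex_normal by (rule prob_space_std_complex_normal)
  let ?c = "cis (- \<phi>) * cnj (unit_dir x)"
  have W2: "integrable std_complex_normal (\<lambda>w. (cmod w)\<^sup>2)" "(\<integral>w. (cmod w)\<^sup>2 \<partial>std_complex_normal) = 1"
    by (rule std_complex_normal_second_moment)+
  have p: "CN.prob UNIV = 1" using CN.prob_space by simp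
  have I2: "integrable std_complex_normal (\<lambda>w. (Im (w * ?c))\<^sup>2)" "(\<integral>w. (Im (w * ?c))\<^sup>2 \<partial>std_complex_normal) = 1 / 2"
    using std_complex_normal_Im_rotate[of ?c] by (simp_all add: norm_mult)
  let ?E = "\<lambda>w. tail_cost K H R (cmod x) w"
  have E: "integrable std_complex_normal ?E" "(\<integral>w. ?E w \<partial>std_complex_normal) \<le> e"
    using integrable_tail_cost[OF K_ge_1 H] err[of "cmod x"] by auto
  have O: "integrable std_complex_normal (out_cost m x)"
    unfolding out_cost_def using W2 by (auto simp: add_divide_distrib)
  have Oi: "(\<integral>w. out_cost m x w \<partial>std_complex_normal) = - 1 + (1 + 1 / e) / \<tau> + (1 + e) / \<tau> * (cmod x)\<^sup>2"
  proof -
    have "out_cost m x w = (1 + e) / \<tau> * (cmod x)\<^sup>2 + ((1 + 1 / e) / \<tau> - 1) * (cmod w)\<^sup>2" for w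
      unfolding out_cost_def by (simp add: add_divide_distrib algebra_simps)
    then show ?thesis using W2 by (simp add: p)
  qed
  show ?thesis
  proof (cases "m < 2")
    case True
    have "(\<integral>w. coord_cost m x \<phi> w \<partial>std_complex_normal) =
      (\<integral>w. out_cost m x w + ((- ln pi + ln (radial_norm A R \<tau>) + Lz) + (Im (w * ?c))\<^sup>2 + ?E w) \<partial>std_complex_normal)"
      using True by (simp only: coord_cost_def if_True)
    also have "\<dots> = (\<integral>w. out_cost m x w \<partial>std_complex_normal) + (((- ln pi + ln (radial_norm A R \<tau>) + Lz) + 1 / 2) + (\<integral>w. ?E w \<partial>std_complex_normal))"
    proof -
      let ?k = "- ln pi + ln (radial_norm A R \<tau>) + Lz"
      have k: "integrable std_complex_normal (\<lambda>w. ?k + (Im (w * ?c))\<^sup>2)" using I2 by auto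
      have "(\<integral>w. ?k + (Im (w * ?c))\<^sup>2 \<partial>std_complex_normal) = ?k + 1 / 2"
        using I2 by (subst Bochner_Integration.integral_add) (auto simp: p)
      then show ?thesis
        by (subst Bochner_Integration.integral_add[OF O Bochner_Integration.integrable_add[OF k E(1)]],
            subst Bochner_Integration.integral_add[OF k E(1)]) (simp only:)
    qed
    finally show ?thesis using E(2) True by (simp add: Oi coord_const_def)
  next
    case False
    have "(\<integral>w. coord_cost m x \<phi> w \<partial>std_complex_normal) = (\<integral>w. out_cost m x w + ln \<tau> \<partial>std_complex_normal)"
      using False by (simp only: coord_cost_def if_False)
    also have "\<dots> = (\<integral>w. out_cost m x w \<partial>std_complex_normal) + ln \<tau>"
      using O by (subst Bochner_Integration.integral_add) (auto simp: p)
    finally show ?thesis using False by (simp add: Oi coord_const_def)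
  qed
qed

lemma abs_ln_f_le: "\<bar>ln (fc t)\<bar> \<le> \<bar>ln lo\<bar> + \<bar>ln hi\<bar>" "\<bar>ln (fr t)\<bar> \<le> \<bar>ln lo\<bar> + \<bar>ln hi\<bar>"
proof -
  have "ln lo \<le> ln (fc t)" "ln (fc t) \<le> ln hi" "ln lo \<le> ln (fr t)" "ln (fr t) \<le> ln hi"
    using fc(1,2)[of t] fr(1,2)[of t] lo fc_pos[of t] fr_pos[of t] by (simp_all add: ln_le_cancel_iff)
  then show "\<bar>ln (fc t)\<bar> \<le> \<bar>ln lo\<bar> + \<bar>ln hi\<bar>" "\<bar>ln (fr t)\<bar> \<le> \<bar>ln lo\<bar> + \<bar>ln hi\<bar>" by linarith+
qed

text \<open>\<open>U\<close> adds up, over the blocks, the logarithms of the increment densities and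
  the coordinate costs. Being a sum, its mean involves only one coordinate or one increment at a
  time, although the phases of different blocks are dependent.\<close>

theorem information_le:
  assumes P: "prob_space P" and sets_P: "sets P = sets (block_space M n)"
    and X: "\<And>k m. k \<in> {1..n} \<Longrightarrow> m < M \<Longrightarrow> integrable P (\<lambda>x. (cmod (x k m))\<^sup>2)"
  shows "info_integrable M \<sigma>c \<sigma>r n P" (is ?int)
    and "info_nats M \<sigma>c \<sigma>r n P \<le>
      real n * ((\<integral>t. ln (fc t) \<partial>wrapped_normal \<sigma>c) + (\<integral>t. ln (fr t) \<partial>wrapped_normal \<sigma>r) + (\<Sum>m<M. coord_const m))
      + (1 + e) / \<tau> * (\<Sum>k=1..n. \<Sum>m<M. \<integral>x. (cmod (x k m))\<^sup>2 \<partial>P)"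
proof -
  interpret channel_input M n \<sigma>c \<sigma>r P
    by (rule channel_input.intro) (rule \<sigma> P sets_P)+
  let ?u = "\<lambda>k m \<omega>. coord_cost m (fst \<omega> k m) (phase (fst (snd \<omega>)) k + real m * phase (fst (snd (snd \<omega>))) k) (snd (snd (snd \<omega>)) k m)"
  let ?c = "\<lambda>k \<omega>. ln (fc (snd (fst (snd \<omega>)) k))" and ?r = "\<lambda>k \<omega>. ln (fr (snd (fst (snd (snd \<omega>))) k))"
  define U where "U = (\<lambda>\<omega>. \<Sum>k=1..n. ?c k \<omega> + ?r k \<omega> + (\<Sum>m<M. ?u k m \<omega>))"
  have ui: "integrable (P \<Otimes>\<^sub>M N) (?u k m)"
    and ule: "(\<integral>\<omega>. ?u k m \<omega> \<partial>(P \<Otimes>\<^sub>M N)) \<le> coord_const m + (1 + e) / \<tau> * (\<integral>x. (cmod (x k m))\<^sup>2 \<partial>P)"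
    if k: "k \<in> {1..n}" and m: "m < M" for k m
  proof -
    obtain C0 C1 C2 where C: "0 \<le> C0" "0 \<le> C1" "0 \<le> C2"
      "\<And>x \<phi> w. \<bar>coord_cost m x \<phi> w\<bar> \<le> C0 + C1 * (cmod x)\<^sup>2 + C2 * (cmod w)\<^sup>2"
      using coord_cost_bound[of m] by blast
    note * = integral_noise_component_le[OF k m coord_cost_measurable C(4) C(1-3) integral_coord_cost X[OF k m]]
    show "integrable (P \<Otimes>\<^sub>M N) (?u k m)" by (rule *(1))
    show "(\<integral>\<omega>. ?u k m \<omega> \<partial>(P \<Otimes>\<^sub>M N)) \<le> coord_const m + (1 + e) / \<tau> * (\<integral>x. (cmod (x k m))\<^sup>2 \<partial>P)" by (rule *(2))
  qed
  have lnm: "(\<lambda>t. ln (fc t)) \<in> borel_measurable borel" "(\<lambda>t. ln (fr t)) \<in> borel_measurable borel" by measurable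
  note ic = integral_increment(1,2)[OF _ lnm(1) abs_ln_f_le(1)] and ir = integral_increment(3,4)[OF _ lnm(2) abs_ln_f_le(2)]
  have Ui: "integrable (P \<Otimes>\<^sub>M N) U"
    unfolding U_def by (intro Bochner_Integration.integrable_sum Bochner_Integration.integrable_add ui ic(1) ir(1)) auto
  have UL: "exp (- U \<omega>) \<le> sample_lik n (fst \<omega>) (snd \<omega>)" for \<omega>
  proof -
    have "- ln (sample_lik n (fst \<omega>) (snd \<omega>)) = (\<Sum>k=1..n. - ln (lik (fst \<omega> k) (snd (fst (snd \<omega>)) k) (snd (fst (snd (snd \<omega>))) k)
      (phase (fst (snd \<omega>)) k) (phase (fst (snd (snd \<omega>))) k) (snd (snd (snd \<omega>)) k)))"
      unfolding sample_lik_def sum_negf using lik_pos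
      by (subst ln_prod) (auto simp: less_imp_neq[symmetric])
    also have "\<dots> \<le> U \<omega>" unfolding U_def by (intro sum_mono ln_block_lik)
    finally have "exp (- U \<omega>) \<le> exp (ln (sample_lik n (fst \<omega>) (snd \<omega>)))" by simp
    then show ?thesis using sample_lik_pos by simp
  qed
  show ?int by (rule information_upper(1)[OF P sets_P Ui UL])
  have "info_nats M \<sigma>c \<sigma>r n P \<le> (\<integral>\<omega>. U \<omega> \<partial>(P \<Otimes>\<^sub>M N))"
    by (rule information_upper(2)[OF P sets_P Ui UL])
  also have "\<dots> = (\<Sum>k=1..n. (\<integral>t. ln (fc t) \<partial>wrapped_normal \<sigma>c) + (\<integral>t. ln (fr t) \<partial>wrapped_normal \<sigma>r) + (\<Sum>m<M. \<integral>\<omega>. ?u k m \<omega> \<partial>(P \<Otimes>\<^sub>M N)))"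
  proof -
    have "(\<integral>\<omega>. U \<omega> \<partial>(P \<Otimes>\<^sub>M N)) = (\<Sum>k=1..n. \<integral>\<omega>. ?c k \<omega> + ?r k \<omega> + (\<Sum>m<M. ?u k m \<omega>) \<partial>(P \<Otimes>\<^sub>M N))"
      unfolding U_def by (intro Bochner_Integration.integral_sum Bochner_Integration.integrable_sum Bochner_Integration.integrable_add ui ic(1) ir(1)) auto
    also have "\<dots> = (\<Sum>k=1..n. (\<integral>t. ln (fc t) \<partial>wrapped_normal \<sigma>c) + (\<integral>t. ln (fr t) \<partial>wrapped_normal \<sigma>r) + (\<Sum>m<M. \<integral>\<omega>. ?u k m \<omega> \<partial>(P \<Otimes>\<^sub>M N)))"
    proof (rule sum.cong[OF refl])
      fix k assume k: "k \<in> {1..n}"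
      then have k1: "1 \<le> k" by simp
      have us: "integrable (P \<Otimes>\<^sub>M N) (\<lambda>\<omega>. \<Sum>m<M. ?u k m \<omega>)"
        by (intro Bochner_Integration.integrable_sum ui[OF k]) auto
      have "(\<integral>\<omega>. (\<Sum>m<M. ?u k m \<omega>) \<partial>(P \<Otimes>\<^sub>M N)) = (\<Sum>m<M. \<integral>\<omega>. ?u k m \<omega> \<partial>(P \<Otimes>\<^sub>M N))"
        by (intro Bochner_Integration.integral_sum ui[OF k]) auto
      then show "(\<integral>\<omega>. ?c k \<omega> + ?r k \<omega> + (\<Sum>m<M. ?u k m \<omega>) \<partial>(P \<Otimes>\<^sub>M N)) = (\<integral>t. ln (fc t) \<partial>wrapped_normal \<sigma>c) + (\<integral>t. ln (fr t) \<partial>wrapped_normal \<sigma>r) + (\<Sum>m<M. \<integral>\<omega>. ?u k m \<omega> \<partial>(P \<Otimes>\<^sub>M N))"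
        by (subst Bochner_Integration.integral_add[OF Bochner_Integration.integrable_add[OF ic(1)[OF k1] ir(1)[OF k1]] us],
            subst Bochner_Integration.integral_add[OF ic(1)[OF k1] ir(1)[OF k1]])
          (simp only: ic(2)[OF k1] ir(2)[OF k1])
    qed
    finally show ?thesis .
  qed
  also have "\<dots> \<le> (\<Sum>k=1..n. (\<integral>t. ln (fc t) \<partial>wrapped_normal \<sigma>c) + (\<integral>t. ln (fr t) \<partial>wrapped_normal \<sigma>r) +
      (\<Sum>m<M. coord_const m + (1 + e) / \<tau> * (\<integral>x. (cmod (x k m))\<^sup>2 \<partial>P)))"
    by (intro sum_mono add_left_mono ule) auto
  also have "\<dots> = real n * ((\<integral>t. ln (fc t) \<partial>wrapped_normal \<sigma>c) + (\<integral>t. ln (fr t) \<partial>wrapped_normal \<sigma>r) + (\<Sum>m<M. coord_const m))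
      + (1 + e) / \<tau> * (\<Sum>k=1..n. \<Sum>m<M. \<integral>x. (cmod (x k m))\<^sup>2 \<partial>P)"
    by (simp add: sum.distrib sum_distrib_left algebra_simps)
  finally show "info_nats M \<sigma>c \<sigma>r n P \<le>
      real n * ((\<integral>t. ln (fc t) \<partial>wrapped_normal \<sigma>c) + (\<integral>t. ln (fr t) \<partial>wrapped_normal \<sigma>r) + (\<Sum>m<M. coord_const m))
      + (1 + e) / \<tau> * (\<Sum>k=1..n. \<Sum>m<M. \<integral>x. (cmod (x k m))\<^sup>2 \<partial>P)" .
qed

end

text \<open>All parameters are functions of \<open>e\<close>; therefore the constants of the final
  bound are uniform in the number of blocks, the power and the input law. The tail is handled by two
  regimes of the input modulus, separated at \<open>K\<^sup>2 / e\<close>.\<close>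

lemma dual_params_exist:
  assumes e: "0 < e"
  shows "\<exists>\<kappa> A R K H. 0 < \<kappa> \<and> \<kappa> < 1 \<and> 0 < A \<and> 0 < R \<and> K = 1 + 1 / sqrt (1 - \<kappa>\<^sup>2) \<and> 0 \<le> H \<and>
    (\<forall>s\<ge>R. ln (s * phase_norm \<kappa> s) \<le> ln pi / 2 + e) \<and>
    ln (2 * pi) - ln A \<le> (ln pi / 2 + e) - H \<and>
    (\<forall>x\<ge>0. (\<integral>w. tail_cost K H R x w \<partial>std_complex_normal) \<le> e)"
proof -
  interpret CN: prob_space std_complex_normal by (rule prob_space_std_complex_normal)
  have W2: "integrable std_complex_normal (\<lambda>w. (cmod w)\<^sup>2)" "(\<integral>w. (cmod w)\<^sup>2 \<partial>std_complex_normal) = 1"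
    by (rule std_complex_normal_second_moment)+
  have p: "CN.prob UNIV = 1" using CN.prob_space by simp
  \<comment> \<open>This \<open>\<kappa>\<close> turns the leading term
    \<open>sqrt pi / \<kappa>\<close> of the bound on \<open>s * phase_norm \<kappa> s\<close> into
    \<open>sqrt pi * exp (e / 2)\<close>. The number \<open>D\<close> below is the room left up to
    \<open>sqrt pi * exp e\<close>, to be filled by the linear branch.\<close>
  define \<kappa> where "\<kappa> = exp (- (e / 2))"
  have \<kappa>: "0 < \<kappa>" "\<kappa> < 1" using e by (auto simp: \<kappa>_def)
  define K where "K = 1 + 1 / sqrt (1 - \<kappa>\<^sup>2)"
  have K1: "1 \<le> K" unfolding K_def using \<kappa> abs_square_less_1[of \<kappa>] by simp
  define D where "D = sqrt pi * (exp e - exp (e / 2))"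
  have D: "0 < D" using e by (auto simp: D_def)
  \<comment> \<open>Two demands. By \<open>s\<^sup>2 / 2 \<le> exp s\<close> the linear branch
    contributes at most \<open>4 * pi / s\<close>, and \<open>R \<ge> 4 * pi / D\<close> keeps this
    below \<open>D\<close>. The part \<open>K\<^sup>2 / e + 2\<close> ensures that an input of
    modulus below \<open>K\<^sup>2 / e\<close> stays in the disc under any noise of modulus less
    than 2.\<close>
  define R where "R = K\<^sup>2 / e + 2 + 4 * pi / D"
  have R: "K\<^sup>2 / e + 2 \<le> R" "4 * pi / D \<le> R" "0 < R"
    using D e by (auto simp: R_def add_nonneg_pos add_pos_nonneg)
  \<comment> \<open>The noise has modulus below 2 with probability at least \<open>3 / 4\<close>, so
    the mean reward is at least \<open>3 / 2 * K\<close>, more than the bound \<open>K\<close> for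
    the mean of \<open>K * |w|\<close>.\<close>
  define H where "H = 2 * K"
  have H: "0 \<le> H" using K1 by (simp add: H_def)
  show ?thesis
  \<comment> \<open>The weight \<open>A = 2 * pi * exp H\<close> gives
    \<open>ln (2 * pi) - ln A = - H\<close>, and \<open>ln pi / 2 + e\<close> is
    nonnegative.\<close>
  proof (rule exI[of _ \<kappa>], rule exI[of _ "2 * pi * exp H"], rule exI[of _ R], rule exI[of _ K], rule exI[of _ H],
      intro conjI allI impI)
    show "ln (s * phase_norm \<kappa> s) \<le> ln pi / 2 + e" if s: "R \<le> s" for s
    proof -
      have s0: "0 < s" using s R by linarith
      have Zp: "0 < phase_norm \<kappa> s" using s0 by (intro phase_norm_eq(2)) simp
      have "s\<^sup>2 / 2 \<le> exp s" using exp_lower_Taylor_quadratic[of s] s0 by linarith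
      then have "s * exp (- s) \<le> 2 / s"
        using s0 by (simp add: exp_minus field_simps power2_eq_square)
      moreover have "4 * pi / s \<le> D"
      proof -
        have "4 * pi / D \<le> s" using R s by linarith
        then show ?thesis using s0 D by (simp add: field_simps)
      qed
      ultimately have t: "2 * pi * (s * exp (- s)) \<le> D"
        using mult_left_mono[of "s * exp (- s)" "2 / s" "2 * pi"] by simp
      have "s * phase_norm \<kappa> s \<le> s * (sqrt pi / (\<kappa> * s) + 2 * pi * exp (- s))"
        using s0 by (intro mult_left_mono phase_norm_le \<kappa>) auto
      also have "\<dots> = sqrt pi * exp (e / 2) + 2 * pi * (s * exp (- s))"
        using s0 by (simp add: \<kappa>_def exp_minus field_simps)
      also have "\<dots> \<le> sqrt pi * exp e" using t by (simp add: D_def algebra_simps)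
      finally have "ln (s * phase_norm \<kappa> s) \<le> ln (sqrt pi * exp e)"
        using s0 Zp by (subst ln_le_cancel_iff) auto
      also have "\<dots> = ln pi / 2 + e" by (simp add: ln_mult ln_sqrt)
      finally show ?thesis .
    qed
    have "ln (2 * pi * exp H) = ln (2 * pi) + H" by (simp add: ln_mult)
    moreover have "0 \<le> ln pi" using pi_gt3 by simp
    ultimately show "ln (2 * pi) - ln (2 * pi * exp H) \<le> (ln pi / 2 + e) - H" using e by simp
    show "(\<integral>w. tail_cost K H R x w \<partial>std_complex_normal) \<le> e"
      if x: "0 \<le> x" for x
    \<comment> \<open>For large \<open>x\<close>, the tail event \<open>x \<le> K * |w|\<close> lets
      \<open>K * |w|\<close> be replaced by \<open>K\<^sup>2 * |w|\<^sup>2 / x\<close>, of mean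
      \<open>K\<^sup>2 / x \<le> e\<close>. For small \<open>x\<close> the cost is not small, and
      the reward outweighs it.\<close>
    proof (cases "K\<^sup>2 / e \<le> x")
      case True
      have "0 < K\<^sup>2 / e" using K1 e by simp
      then have x0: "0 < x" using True by linarith
      have "(\<integral>w. tail_cost K H R x w \<partial>std_complex_normal)
        \<le> (\<integral>w. K\<^sup>2 / x * (cmod w)\<^sup>2 \<partial>std_complex_normal)"
      proof (rule integral_mono[OF integrable_tail_cost[OF K1 H]])
        fix w
        have "K * cmod w * indicator {w. x \<le> K * cmod w} w \<le> K\<^sup>2 / x * (cmod w)\<^sup>2"
        proof (cases "x \<le> K * cmod w")
          case True
          then have "K * cmod w * x \<le> K * cmod w * (K * cmod w)" using K1 by (intro mult_left_mono) auto
          then show ?thesis using True x0 by (simp add: field_simps power2_eq_square)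
        qed (use x0 in simp)
        moreover have "0 \<le> H * indicator {w. cmod w < R - x} w" using H by simp
        ultimately show "tail_cost K H R x w \<le> K\<^sup>2 / x * (cmod w)\<^sup>2" by linarith
      qed (use W2 in auto)
      also have "\<dots> = K\<^sup>2 / x" using W2 by simp
      also have "\<dots> \<le> e" using True x0 e by (simp add: field_simps)
      finally show ?thesis .
    next
      case False
      then have Rx: "2 < R - x" using R by linarith
      have i2: "integrable std_complex_normal (\<lambda>w. indicator {w. 2 \<le> cmod w} w :: real)"
        by (rule CN.integrable_const_bound[of _ 1]) (auto simp: indicator_def)
      have "(\<integral>w. tail_cost K H R x w \<partial>std_complex_normal)
        \<le> (\<integral>w. K / 2 - H + K / 2 * (cmod w)\<^sup>2 + H * indicator {w. 2 \<le> cmod w} w \<partial>std_complex_normal)"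
      proof (rule integral_mono[OF integrable_tail_cost[OF K1 H]])
        show "integrable std_complex_normal (\<lambda>w. K / 2 - H + K / 2 * (cmod w)\<^sup>2 + H * indicator {w. 2 \<le> cmod w} w)"
          using W2 i2 by auto
        fix w
        have "0 \<le> (cmod w - 1)\<^sup>2" by simp
        then have "cmod w \<le> (1 + (cmod w)\<^sup>2) / 2" by (simp add: power2_eq_square algebra_simps)
        then have "K * cmod w \<le> K * ((1 + (cmod w)\<^sup>2) / 2)" using K1 by (intro mult_left_mono) auto
        moreover have "K * cmod w * indicator {w. x \<le> K * cmod w} w \<le> K * cmod w"
          using K1 by (auto simp: indicator_def)
        ultimately have "K * cmod w * indicator {w. x \<le> K * cmod w} w \<le> K / 2 + K / 2 * (cmod w)\<^sup>2"
          by (simp add: algebra_simps)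
        moreover have "H - H * indicator {w. 2 \<le> cmod w} w \<le> H * indicator {w. cmod w < R - x} w"
          using H Rx by (auto simp: indicator_def)
        ultimately show "tail_cost K H R x w
          \<le> K / 2 - H + K / 2 * (cmod w)\<^sup>2 + H * indicator {w. 2 \<le> cmod w} w" by linarith
      qed
      also have "\<dots> = K - H + H * CN.prob {w. 2 \<le> cmod w}"
        using W2 i2 by (simp add: p)
      also have "\<dots> \<le> K - H + H * (1 / 2\<^sup>2)"
        using std_complex_normal_tail[of 2] H by (intro add_left_mono mult_left_mono) auto
      also have "\<dots> \<le> e" using K1 e by (simp add: H_def)
      finally show ?thesis .
    qed
  qed (use \<kappa> R H in \<open>auto simp: K_def\<close>)
qed

section \<open>From the power constraint to a bound on the rate\<close>

lemma admissible_second_moments: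
  assumes P: "P \<in> admissible_inputs M n \<rho>" and \<rho>: "0 \<le> \<rho>"
  shows "\<And>k m. k \<in> {1..n} \<Longrightarrow> m < M \<Longrightarrow> integrable P (\<lambda>x. (cmod (x k m))\<^sup>2)"
    and "(\<Sum>k=1..n. \<Sum>m<M. \<integral>x. (cmod (x k m))\<^sup>2 \<partial>P) \<le> real n * \<rho>"
proof -
  have sP: "sets P = sets (block_space M n)"
    and pw: "(\<Sum>k=1..n. \<integral>\<^sup>+x. ennreal ((L2_set (\<lambda>m. cmod (x k m)) {..<M})\<^sup>2) \<partial>P) \<le> ennreal (real n * \<rho>)"
    using P by (auto simp: admissible_inputs_def)
  have m: "(\<lambda>x. x k m) \<in> borel_measurable P" if "k \<in> {1..n}" "m < M" for k m
    using block_space_component[OF that] measurable_cong_sets[OF sP refl] by blast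
  have e: "(\<integral>\<^sup>+x. ennreal ((L2_set (\<lambda>m. cmod (x k m)) {..<M})\<^sup>2) \<partial>P) = (\<Sum>m<M. \<integral>\<^sup>+x. ennreal ((cmod (x k m))\<^sup>2) \<partial>P)"
    if k: "k \<in> {1..n}" for k
  proof -
    have "(\<integral>\<^sup>+x. ennreal ((L2_set (\<lambda>m. cmod (x k m)) {..<M})\<^sup>2) \<partial>P) = (\<integral>\<^sup>+x. (\<Sum>m<M. ennreal ((cmod (x k m))\<^sup>2)) \<partial>P)"
      by (intro nn_integral_cong) (simp add: L2_set_def sum_nonneg)
    also have "\<dots> = (\<Sum>m<M. \<integral>\<^sup>+x. ennreal ((cmod (x k m))\<^sup>2) \<partial>P)"
    proof (rule nn_integral_sum)
      fix i assume "i \<in> {..<M}"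
      then have [measurable]: "(\<lambda>x. x k i) \<in> borel_measurable P" using m[OF k] by auto
      show "(\<lambda>x. ennreal ((cmod (x k i))\<^sup>2)) \<in> borel_measurable P" by measurable
    qed
    finally show ?thesis .
  qed
  have pw': "(\<Sum>k=1..n. \<Sum>m<M. \<integral>\<^sup>+x. ennreal ((cmod (x k m))\<^sup>2) \<partial>P) \<le> ennreal (real n * \<rho>)"
    using pw by (simp only: e cong: sum.cong)
  show I: "integrable P (\<lambda>x. (cmod (x k m))\<^sup>2)" if k: "k \<in> {1..n}" and mM: "m < M" for k m
  proof (rule integrableI_nonneg)
    have [measurable]: "(\<lambda>x. x k m) \<in> borel_measurable P" by (rule m[OF k mM])
    show "(\<lambda>x. (cmod (x k m))\<^sup>2) \<in> borel_measurable P" by measurable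
    have "(\<integral>\<^sup>+x. ennreal ((cmod (x k m))\<^sup>2) \<partial>P) \<le> (\<Sum>m<M. \<integral>\<^sup>+x. ennreal ((cmod (x k m))\<^sup>2) \<partial>P)"
      using mM by (intro member_le_sum) auto
    also have "\<dots> \<le> (\<Sum>k=1..n. \<Sum>m<M. \<integral>\<^sup>+x. ennreal ((cmod (x k m))\<^sup>2) \<partial>P)"
      using k by (intro member_le_sum) auto
    also have "\<dots> < \<infinity>" using pw' by (simp add: le_less_trans)
    finally show "(\<integral>\<^sup>+x. ennreal ((cmod (x k m))\<^sup>2) \<partial>P) < \<infinity>" .
  qed auto
  have "ennreal (\<Sum>k=1..n. \<Sum>m<M. \<integral>x. (cmod (x k m))\<^sup>2 \<partial>P) = (\<Sum>k=1..n. \<Sum>m<M. ennreal (\<integral>x. (cmod (x k m))\<^sup>2 \<partial>P))"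
    by (subst sum_ennreal[symmetric], intro sum_nonneg integral_nonneg_AE, simp)
      (intro sum.cong refl sum_ennreal[symmetric] integral_nonneg_AE, simp)
  also have "\<dots> = (\<Sum>k=1..n. \<Sum>m<M. \<integral>\<^sup>+x. ennreal ((cmod (x k m))\<^sup>2) \<partial>P)"
    by (intro sum.cong refl nn_integral_eq_integral[symmetric] I) auto
  also have "\<dots> \<le> ennreal (real n * \<rho>)" by (rule pw')
  finally show "(\<Sum>k=1..n. \<Sum>m<M. \<integral>x. (cmod (x k m))\<^sup>2 \<partial>P) \<le> real n * \<rho>"
    using \<rho> by (subst (asm) ennreal_le_iff) auto
qed

text \<open>In nats. The last bracket collects the errors and tends to \<open>e * (M + 3)\<close>:
  the two phase coordinates lose \<open>2 * e\<close> each, through the normaliser and the tail, and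
  the power term loses \<open>(M - 1) * e\<close>.\<close>

definition rate_bound :: "nat \<Rightarrow> real \<Rightarrow> real \<Rightarrow> real \<Rightarrow> real \<Rightarrow> real" where
  "rate_bound M h e C \<rho> = h + 2 * ln pi + real (M - 1) * ln (\<rho> / real (M - 1)) +
     (e * (real M + 3) + 2 * ln (1 + C / sqrt (\<rho> / real (M - 1))) + real M * (1 + 1 / e) / (\<rho> / real (M - 1)))"

theorem information_rate_bound:
  assumes M: "2 \<le> M" and \<sigma>: "0 < \<sigma>c" "0 < \<sigma>r" and lo: "0 < lo"
    and fm: "fc \<in> borel_measurable borel" "fr \<in> borel_measurable borel"
    and fc: "\<And>t. lo \<le> fc t" "\<And>t. fc t \<le> hi" "wrapped_normal \<sigma>c = density circle_lborel (\<lambda>t. ennreal (fc t))"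
    and fr: "\<And>t. lo \<le> fr t" "\<And>t. fr t \<le> hi" "wrapped_normal \<sigma>r = density circle_lborel (\<lambda>t. ennreal (fr t))"
    and e: "0 < e"
  shows "\<exists>C\<ge>0. \<forall>n \<rho> P. 0 < \<rho> \<longrightarrow> P \<in> admissible_inputs M n \<rho> \<longrightarrow>
      info_integrable M \<sigma>c \<sigma>r n P \<and>
      info_nats M \<sigma>c \<sigma>r n P \<le> real n * rate_bound M ((\<integral>t. ln (fc t) \<partial>wrapped_normal \<sigma>c) + (\<integral>t. ln (fr t) \<partial>wrapped_normal \<sigma>r)) e C \<rho>"
proof -
  let ?h = "(\<integral>t. ln (fc t) \<partial>wrapped_normal \<sigma>c) + (\<integral>t. ln (fr t) \<partial>wrapped_normal \<sigma>r)"
  obtain \<kappa> A R K H where par: "0 < \<kappa>" "\<kappa> < 1" "0 < A" "0 < R" "K = 1 + 1 / sqrt (1 - \<kappa>\<^sup>2)" "0 \<le> H"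
    "\<And>s. R \<le> s \<Longrightarrow> ln (s * phase_norm \<kappa> s) \<le> ln pi / 2 + e"
    "ln (2 * pi) - ln A \<le> (ln pi / 2 + e) - H"
    "\<And>x. 0 \<le> x \<Longrightarrow> (\<integral>w. tail_cost K H R x w \<partial>std_complex_normal) \<le> e"
    using dual_params_exist[OF e] by blast
  \<comment> \<open>Chosen so that the bound on \<open>radial_norm A R \<tau>\<close> factors as
    \<open>pi * sqrt pi * sqrt \<tau> * (1 + C / sqrt \<tau>)\<close>: the share of the raised disc
    in the normalisation dies out as \<open>\<tau>\<close> grows.\<close>
  define C where "C = A * R\<^sup>2 * exp 1 / sqrt pi"
  have C: "0 \<le> C" using par by (simp add: C_def)
  show ?thesis
  proof (rule exI[of _ C], intro conjI C allI impI)
    fix n \<rho> P assume \<rho>: "0 < \<rho>" and P: "P \<in> admissible_inputs M n \<rho>"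
    define \<tau> where "\<tau> = \<rho> / real (M - 1)"
    have M1: "0 < real (M - 1)" using M by simp
    have \<tau>: "0 < \<tau>" using \<rho> M1 by (simp add: \<tau>_def)
    interpret dual_params M \<sigma>c \<sigma>r \<kappa> A R \<tau> lo hi fc fr e K H "ln pi / 2 + e"
      by unfold_locales (fact M \<sigma> lo fm fc fr e par \<tau>)+
    have PP: "prob_space P" "sets P = sets (block_space M n)" using P by (auto simp: admissible_inputs_def)
    note mom = admissible_second_moments[OF P less_imp_le[OF \<rho>]]
    have int: "info_integrable M \<sigma>c \<sigma>r n P"
      by (rule information_le(1)[OF PP mom(1)])
    have "info_nats M \<sigma>c \<sigma>r n P \<le> real n * (?h + (\<Sum>m<M. coord_const m)) + (1 + e) / \<tau> * (\<Sum>k=1..n. \<Sum>m<M. \<integral>x. (cmod (x k m))\<^sup>2 \<partial>P)"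
      by (rule information_le(2)[OF PP mom(1)])
    also have "\<dots> \<le> real n * (?h + (\<Sum>m<M. coord_const m)) + (1 + e) / \<tau> * (real n * \<rho>)"
      using e \<tau> by (intro add_left_mono mult_left_mono mom(2)) auto
    also have "(1 + e) / \<tau> * (real n * \<rho>) = real n * ((1 + e) * real (M - 1))"
      using \<rho> M1 by (simp add: \<tau>_def field_simps)
    also have "real n * (?h + (\<Sum>m<M. coord_const m)) + real n * ((1 + e) * real (M - 1)) =
      real n * (?h + (\<Sum>m<M. coord_const m) + (1 + e) * real (M - 1))" by (simp add: algebra_simps)
    also have "\<dots> \<le> real n * rate_bound M ?h e C \<rho>"
    proof (rule mult_left_mono)
      have V0: "0 < radial_norm A R \<tau>" by (rule radial_norm_bounds(3)[OF \<tau> par(3,4)])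
      have "radial_norm A R \<tau> \<le> pi * sqrt pi * sqrt \<tau> + A * (pi * R\<^sup>2 * exp 1)"
        by (rule radial_norm_bounds(2)[OF \<tau> par(3,4)])
      also have "\<dots> = pi * sqrt pi * sqrt \<tau> * (1 + C / sqrt \<tau>)"
        using \<tau> by (simp add: C_def field_simps)
      finally have "ln (radial_norm A R \<tau>) \<le> ln (pi * sqrt pi * sqrt \<tau> * (1 + C / sqrt \<tau>))"
        using V0 by (subst ln_le_cancel_iff) auto
      also have "\<dots> = ln pi + ln pi / 2 + ln \<tau> / 2 + ln (1 + C / sqrt \<tau>)"
      proof -
        have "1 + C / sqrt \<tau> \<noteq> 0"
          using \<tau> C divide_nonneg_pos[of C "sqrt \<tau>"] by (intro less_imp_neq[THEN not_sym] add_pos_nonneg) auto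
        then show ?thesis using \<tau> by (simp add: ln_mult ln_sqrt)
      qed
      finally have lV: "ln (radial_norm A R \<tau>) \<le> ln pi + ln pi / 2 + ln \<tau> / 2 + ln (1 + C / sqrt \<tau>)" .
      define c where "c = (1 + 1 / e) / \<tau>"
      have Ms: "{..<M} = insert 0 (insert 1 {2..<M})" using M by auto
      have "(\<Sum>m<M. coord_const m) = 2 * (- ln pi + ln (radial_norm A R \<tau>) + (ln pi / 2 + e) + 1 / 2 + e - 1 + c)
          + real (M - 2) * (ln \<tau> - 1 + c)"
        unfolding Ms by (simp add: coord_const_def c_def)
      also have "\<dots> \<le> 2 * (- ln pi + (ln pi + ln pi / 2 + ln \<tau> / 2 + ln (1 + C / sqrt \<tau>)) + (ln pi / 2 + e) + 1 / 2 + e - 1 + c)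
          + real (M - 2) * (ln \<tau> - 1 + c)"
        using lV by simp
      \<comment> \<open>Each of the two phase coordinates brings only half of
        \<open>ln \<tau>\<close>, whence the factor \<open>M - 1\<close> instead of
        \<open>M\<close>. The term \<open>- real (M - 1)\<close> will cancel against the power term,
        by the choice of \<open>\<tau>\<close>.\<close>
      also have "\<dots> = 2 * ln pi + real (M - 1) * ln \<tau> - real (M - 1) + 4 * e + 2 * ln (1 + C / sqrt \<tau>) + real M * c"
        using M by (simp add: of_nat_diff algebra_simps)
      finally have "?h + (\<Sum>m<M. coord_const m) + (1 + e) * real (M - 1) \<le>
        ?h + (2 * ln pi + real (M - 1) * ln \<tau> - real (M - 1) + 4 * e + 2 * ln (1 + C / sqrt \<tau>) + real M * c) + (1 + e) * real (M - 1)"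
        by simp
      also have "\<dots> = rate_bound M ?h e C \<rho>"
        proof -
        have "real M * (1 + 1 / e) / \<tau> = real M * c" by (simp add: c_def)
        then show ?thesis unfolding rate_bound_def \<tau>_def[symmetric] using M by (simp add: of_nat_diff algebra_simps)
      qed
      finally show "?h + (\<Sum>m<M. coord_const m) + (1 + e) * real (M - 1) \<le> rate_bound M ?h e C \<rho>" .
    qed simp
    finally show "info_nats M \<sigma>c \<sigma>r n P \<le> real n * rate_bound M ?h e C \<rho>" .
    show "info_integrable M \<sigma>c \<sigma>r n P" by (rule int)
  qed
qed

section \<open>Stationarity of the channel noise\<close>

lemma sets_phase_source' [measurable_cong]: "sets (phase_source \<sigma>) = sets (uniform_phase \<Otimes>\<^sub>M PiM {1..} (\<lambda>_. wrapped_normal \<sigma>))"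
  by (simp only: phase_source_def)

text \<open>The same process observed from block \<open>n\<close> on, with the phase reached there
  as initial phase. The restriction keeps the increments in the extensional product space.\<close>

definition shift_phase :: "nat \<Rightarrow> real \<times> (nat \<Rightarrow> real) \<Rightarrow> real \<times> (nat \<Rightarrow> real)" where
  "shift_phase n s = (phase s n, \<lambda>k\<in>{1..}. snd s (k + n))"

lemma phase_shift_phase: "phase (shift_phase n s) k = phase s (k + n)"
  by (induction k) (simp_all add: shift_phase_def)

lemma shift_phase_measurable: "shift_phase n \<in> measurable (phase_source \<sigma>) (phase_source \<sigma>)"
proof -
  have "shift_phase n \<in> measurable (phase_source \<sigma>) (uniform_phase \<Otimes>\<^sub>M PiM {1..} (\<lambda>_. wrapped_normal \<sigma>))"
    unfolding shift_phase_def
  proof (rule measurable_Pair)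
    show "(\<lambda>s. phase s n) \<in> measurable (phase_source \<sigma>) uniform_phase"
      using phase_source_measurable[of n \<sigma>] measurable_cong_sets[OF refl sets_uniform_phase] by blast
    show "(\<lambda>s. \<lambda>k\<in>{1..}. snd s (k + n)) \<in> measurable (phase_source \<sigma>) (PiM {1..} (\<lambda>_. wrapped_normal \<sigma>))"
    proof (rule measurable_restrict)
      fix k :: nat assume "k \<in> {1..}"
      then have "1 \<le> k + n" by simp
      from increment_measurable[OF this]
      show "(\<lambda>s. snd s (k + n)) \<in> measurable (phase_source \<sigma>) (wrapped_normal \<sigma>)"
        using measurable_cong_sets[OF refl sets_wrapped_normal] by blast
    qed
  qed
  then show ?thesis by (simp add: phase_source_def)
qed

text \<open>An independent identically distributed sequence is its first term followed by an
  independent copy of itself: coordinate 1 is split off and the indices from 2 on are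
  renumbered.\<close>

lemma nn_integral_PiM_split_first:
  fixes W :: "real measure"
  assumes W: "prob_space W" and F: "F \<in> borel_measurable (W \<Otimes>\<^sub>M PiM {1..} (\<lambda>_::nat. W))"
  shows "(\<integral>\<^sup>+d. F (d 1, \<lambda>k\<in>{1..}. d (Suc k)) \<partial>PiM {1..} (\<lambda>_::nat. W)) = (\<integral>\<^sup>+x. \<integral>\<^sup>+d. F (x, d) \<partial>PiM {1..} (\<lambda>_::nat. W) \<partial>W)"
proof -
  let ?D1 = "PiM {1..} (\<lambda>_::nat. W)" and ?D2 = "PiM {2..} (\<lambda>_::nat. W)"
  interpret D1: prob_space ?D1 by (intro prob_space_PiM W)
  interpret D2: prob_space ?D2 by (intro prob_space_PiM W)
  have ins: "insert 1 {2..} = {1::nat..}" by auto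
  have eq: "distr (W \<Otimes>\<^sub>M ?D2) ?D1 (\<lambda>(x, X). X(1 := x)) = ?D1"
    by (rule distr_pair_PiM_eq_PiM[of "{2..}" "\<lambda>_::nat. W" 1, OF W W, unfolded ins])
  have um: "(\<lambda>(x, X). X(1 := x)) \<in> measurable (W \<Otimes>\<^sub>M ?D2) ?D1"
    unfolding case_prod_beta' by (rule measurable_fun_upd[where J = "{2..}"]) auto
  have sh: "(\<lambda>d. \<lambda>k\<in>{1..}. d (Suc k)) \<in> measurable (PiM I (\<lambda>_. W)) ?D1" if "{2..} \<subseteq> I" for I
    by (intro measurable_restrict measurable_component_singleton) (use that in auto)
  have re: "distr ?D2 ?D1 (\<lambda>d. \<lambda>k\<in>{1..}. d (Suc k)) = ?D1"
    using distr_PiM_reindex[of "{2..}" "\<lambda>_. W" Suc "{1..}"] W by auto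
  have m1: "(\<lambda>d. F (d 1, \<lambda>k\<in>{1..}. d (Suc k))) \<in> borel_measurable ?D1"
    by (rule measurable_compose[OF measurable_Pair F]) (auto intro!: sh measurable_component_singleton)
  have m2: "(\<lambda>p. F (fst p, \<lambda>k\<in>{1..}. snd p (Suc k))) \<in> borel_measurable (W \<Otimes>\<^sub>M ?D2)"
    by (rule measurable_compose[OF measurable_Pair F]) (auto intro!: measurable_compose[OF measurable_snd sh])
  have "(\<integral>\<^sup>+d. F (d 1, \<lambda>k\<in>{1..}. d (Suc k)) \<partial>?D1) = (\<integral>\<^sup>+d. F (d 1, \<lambda>k\<in>{1..}. d (Suc k)) \<partial>distr (W \<Otimes>\<^sub>M ?D2) ?D1 (\<lambda>(x, X). X(1 := x)))"
    by (simp only: eq)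
  also have "\<dots> = (\<integral>\<^sup>+p. F (fst p, \<lambda>k\<in>{1..}. snd p (Suc k)) \<partial>(W \<Otimes>\<^sub>M ?D2))"
  proof (subst nn_integral_distr[OF um])
    show "(\<lambda>d. F (d 1, \<lambda>k\<in>{1..}. d (Suc k))) \<in> borel_measurable (distr (W \<Otimes>\<^sub>M ?D2) ?D1 (\<lambda>(x, X). X(1 := x)))"
      using m1 by (simp add: eq)
    show "(\<integral>\<^sup>+p. F ((case p of (x, X) \<Rightarrow> X(1 := x)) 1, \<lambda>k\<in>{1..}. (case p of (x, X) \<Rightarrow> X(1 := x)) (Suc k)) \<partial>(W \<Otimes>\<^sub>M ?D2)) =
      (\<integral>\<^sup>+p. F (fst p, \<lambda>k\<in>{1..}. snd p (Suc k)) \<partial>(W \<Otimes>\<^sub>M ?D2))"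
    proof (intro nn_integral_cong)
      fix p :: "real \<times> (nat \<Rightarrow> real)"
      obtain x X where p: "p = (x, X)" by (cases p)
      have "(\<lambda>k\<in>{1..}. (X(1 := x)) (Suc k)) = (\<lambda>k\<in>{1..}. X (Suc k))" by (intro restrict_ext) auto
      then show "F ((case p of (x, X) \<Rightarrow> X(1 := x)) 1, \<lambda>k\<in>{1..}. (case p of (x, X) \<Rightarrow> X(1 := x)) (Suc k)) = F (fst p, \<lambda>k\<in>{1..}. snd p (Suc k))"
        by (simp add: p)
    qed
  qed
  also have "\<dots> = (\<integral>\<^sup>+x. \<integral>\<^sup>+d. F (x, \<lambda>k\<in>{1..}. d (Suc k)) \<partial>?D2 \<partial>W)"
    by (subst D2.nn_integral_fst[OF m2, symmetric]) simp
  also have "\<dots> = (\<integral>\<^sup>+x. \<integral>\<^sup>+d. F (x, d) \<partial>?D1 \<partial>W)"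
  proof (rule nn_integral_cong)
    fix x assume x: "x \<in> space W"
    have Fx: "(\<lambda>d. F (x, d)) \<in> borel_measurable ?D1"
      by (rule measurable_compose[OF measurable_Pair1'[OF x] F])
    have "(\<integral>\<^sup>+d. F (x, d) \<partial>distr ?D2 ?D1 (\<lambda>d. \<lambda>k\<in>{1..}. d (Suc k))) = (\<integral>\<^sup>+d. F (x, \<lambda>k\<in>{1..}. d (Suc k)) \<partial>?D2)"
      by (rule nn_integral_distr[OF sh]) (use Fx in \<open>auto simp: re\<close>)
    then show "(\<integral>\<^sup>+d. F (x, \<lambda>k\<in>{1..}. d (Suc k)) \<partial>?D2) = (\<integral>\<^sup>+d. F (x, d) \<partial>?D1)" by (simp only: re)
  qed
  finally show ?thesis .
qed

text \<open>The first increment is absorbed into the new initial phase. By rotation invariance that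
  phase is uniform given all increments, so it is again independent of the later ones.\<close>

lemma distr_shift_phase_1:
  assumes \<sigma>: "0 < \<sigma>"
  shows "distr (phase_source \<sigma>) (phase_source \<sigma>) (shift_phase 1) = phase_source \<sigma>"
proof (rule measure_eqI_nn_integral)
  let ?W = "wrapped_normal \<sigma>" let ?D = "PiM {1..} (\<lambda>_::nat. ?W)" let ?U = uniform_phase
  interpret U: prob_space ?U by (rule prob_space_uniform_phase)
  interpret W: prob_space ?W by (rule prob_space_wrapped_normal[OF \<sigma>])
  interpret D: prob_space ?D by (intro prob_space_PiM prob_space_wrapped_normal \<sigma>)
  interpret WD: pair_prob_space ?W ?D ..
  have WDp: "prob_space (?W \<Otimes>\<^sub>M ?D)" by (rule WD.prob_space_axioms)
  interpret UWD: pair_sigma_finite ?U "?W \<Otimes>\<^sub>M ?D"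
    by (intro pair_sigma_finite.intro U.sigma_finite_measure_axioms prob_space_imp_sigma_finite WDp)
  interpret DU: pair_sigma_finite ?D ?U ..
  fix g :: "real \<times> (nat \<Rightarrow> real) \<Rightarrow> ennreal"
  assume "g \<in> borel_measurable (distr (phase_source \<sigma>) (phase_source \<sigma>) (shift_phase 1))"
  then have g [measurable]: "g \<in> borel_measurable (?U \<Otimes>\<^sub>M ?D)" by (simp only: measurable_distr_eq1 phase_source_def)
  have gB: "g \<in> borel_measurable (borel \<Otimes>\<^sub>M ?D)"
    using g measurable_cong_sets[OF sets_pair_measure_cong[OF sets_uniform_phase refl] refl] by blast
  have gd: "(\<lambda>a. g (a, d)) \<in> borel_measurable borel" if "d \<in> space ?D" for d
    by (rule measurable_compose[OF measurable_Pair2'[OF that] gB])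
  have g3: "(\<lambda>q. g (wrap_pi (fst q + a), snd q)) \<in> borel_measurable (?W \<Otimes>\<^sub>M ?D)" for a
    by (rule measurable_compose[OF measurable_Pair gB]) measurable
  have g4: "(\<lambda>p. g (wrap_pi (fst (snd p) + fst p), snd (snd p))) \<in> borel_measurable (?U \<Otimes>\<^sub>M (?W \<Otimes>\<^sub>M ?D))"
    by (rule measurable_compose[OF measurable_Pair gB]) measurable
  have gP: "g \<in> borel_measurable (phase_source \<sigma>)" using g by (simp only: phase_source_def)
  have gs: "(\<lambda>s. g (shift_phase 1 s)) \<in> borel_measurable (?U \<Otimes>\<^sub>M ?D)"
    using measurable_compose[OF shift_phase_measurable[of 1 \<sigma>] gP] by (simp only: phase_source_def)
  have "(\<integral>\<^sup>+s. g s \<partial>distr (phase_source \<sigma>) (phase_source \<sigma>) (shift_phase 1)) = (\<integral>\<^sup>+s. g (shift_phase 1 s) \<partial>phase_source \<sigma>)"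
    by (rule nn_integral_distr[OF shift_phase_measurable]) (simp add: gP)
  also have "\<dots> = (\<integral>\<^sup>+a. \<integral>\<^sup>+d. g (wrap_pi (d 1 + a), \<lambda>k\<in>{1..}. d (Suc k)) \<partial>?D \<partial>?U)"
    unfolding phase_source_def by (subst D.nn_integral_fst[OF gs, symmetric]) (simp add: shift_phase_def)
  also have "\<dots> = (\<integral>\<^sup>+a. \<integral>\<^sup>+x. \<integral>\<^sup>+d. g (wrap_pi (x + a), d) \<partial>?D \<partial>?W \<partial>?U)"
  proof (rule nn_integral_cong)
    fix a
    from nn_integral_PiM_split_first[OF W.prob_space_axioms g3[of a]]
    show "(\<integral>\<^sup>+d. g (wrap_pi (d 1 + a), \<lambda>k\<in>{1..}. d (Suc k)) \<partial>?D) = (\<integral>\<^sup>+x. \<integral>\<^sup>+d. g (wrap_pi (x + a), d) \<partial>?D \<partial>?W)"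
      by simp
  qed
  also have "\<dots> = (\<integral>\<^sup>+a. \<integral>\<^sup>+q. g (wrap_pi (fst q + a), snd q) \<partial>(?W \<Otimes>\<^sub>M ?D) \<partial>?U)"
  proof (rule nn_integral_cong)
    fix a
    show "(\<integral>\<^sup>+x. \<integral>\<^sup>+d. g (wrap_pi (x + a), d) \<partial>?D \<partial>?W) = (\<integral>\<^sup>+q. g (wrap_pi (fst q + a), snd q) \<partial>(?W \<Otimes>\<^sub>M ?D))"
      using D.nn_integral_fst[OF g3[of a]] by simp
  qed
  also have "\<dots> = (\<integral>\<^sup>+q. \<integral>\<^sup>+a. g (wrap_pi (fst q + a), snd q) \<partial>?U \<partial>(?W \<Otimes>\<^sub>M ?D))"
    by (rule UWD.Fubini'[symmetric]) (use g4 in \<open>simp add: case_prod_beta'\<close>)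
  also have "\<dots> = (\<integral>\<^sup>+q. \<integral>\<^sup>+a. g (a, snd q) \<partial>?U \<partial>(?W \<Otimes>\<^sub>M ?D))"
  proof (rule nn_integral_cong)
    fix q assume "q \<in> space (?W \<Otimes>\<^sub>M ?D)"
    then have "snd q \<in> space ?D" by (auto simp: space_pair_measure)
    from nn_integral_uniform_phase_rotate[OF gd[OF this], of "fst q"]
    show "(\<integral>\<^sup>+a. g (wrap_pi (fst q + a), snd q) \<partial>?U) = (\<integral>\<^sup>+a. g (a, snd q) \<partial>?U)" by (simp add: add.commute)
  qed
  also have "\<dots> = (\<integral>\<^sup>+x. \<integral>\<^sup>+d. \<integral>\<^sup>+a. g (a, d) \<partial>?U \<partial>?D \<partial>?W)"
  proof -
    have "(\<lambda>q. \<integral>\<^sup>+a. g (a, snd q) \<partial>?U) \<in> borel_measurable (?W \<Otimes>\<^sub>M ?D)"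
    proof (rule U.borel_measurable_nn_integral)
      show "(\<lambda>(q, a). g (a, snd q)) \<in> borel_measurable ((?W \<Otimes>\<^sub>M ?D) \<Otimes>\<^sub>M ?U)"
        unfolding case_prod_beta' by (rule measurable_compose[OF measurable_Pair g]) measurable
    qed
    from D.nn_integral_fst[OF this] show ?thesis by simp
  qed
  also have "\<dots> = (\<integral>\<^sup>+d. \<integral>\<^sup>+a. g (a, d) \<partial>?U \<partial>?D)" using W.emeasure_space_1 by simp
  also have "\<dots> = (\<integral>\<^sup>+a. \<integral>\<^sup>+d. g (a, d) \<partial>?D \<partial>?U)"
    by (rule DU.Fubini'[symmetric], unfold case_prod_beta', rule measurable_compose[OF measurable_Pair g]) measurable
  also have "\<dots> = (\<integral>\<^sup>+s. g s \<partial>phase_source \<sigma>)" unfolding phase_source_def by (rule D.nn_integral_fst[OF g])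
  finally show "(\<integral>\<^sup>+s. g s \<partial>distr (phase_source \<sigma>) (phase_source \<sigma>) (shift_phase 1)) = (\<integral>\<^sup>+s. g s \<partial>phase_source \<sigma>)" .
qed simp

lemma distr_shift_phase:
  assumes \<sigma>: "0 < \<sigma>"
  shows "distr (phase_source \<sigma>) (phase_source \<sigma>) (shift_phase n) = phase_source \<sigma>"
proof (induction n)
  \<comment> \<open>The shift by 0 is the identity on extensional sequences only, so equality is
    checked on the space of the measure.\<close>
  case 0
  have "distr (phase_source \<sigma>) (phase_source \<sigma>) (shift_phase 0) = distr (phase_source \<sigma>) (phase_source \<sigma>) (\<lambda>s. s)"
  proof (rule distr_cong[OF refl refl])
    fix s assume "s \<in> space (phase_source \<sigma>)"
    then have "snd s \<in> extensional {1..}" by (auto simp: phase_source_def space_pair_measure space_PiM PiE_def)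
    then show "shift_phase 0 s = s" by (simp add: shift_phase_def extensional_restrict prod_eq_iff)
  qed
  then show ?case by (simp add: distr_id)
next
  case (Suc n)
  have "shift_phase (Suc n) = shift_phase 1 \<circ> shift_phase n"
    by (auto simp: shift_phase_def fun_eq_iff)
  then have "distr (phase_source \<sigma>) (phase_source \<sigma>) (shift_phase (Suc n)) =
      distr (distr (phase_source \<sigma>) (phase_source \<sigma>) (shift_phase n)) (phase_source \<sigma>) (shift_phase 1)"
    by (simp add: distr_distr[OF shift_phase_measurable shift_phase_measurable])
  then show ?case by (simp only: Suc.IH distr_shift_phase_1[OF \<sigma>])
qed

definition shift_noise :: "nat \<Rightarrow> noise_sample \<Rightarrow> noise_sample" where
  "shift_noise n \<nu> = (shift_phase n (fst \<nu>), shift_phase n (fst (snd \<nu>)), \<lambda>k\<in>{1..}. snd (snd \<nu>) (k + n))"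

lemma distr_shift_additive_noise:
  "(\<lambda>w. \<lambda>k\<in>{1..}. w (k + n)) \<in> measurable (additive_noise M) (additive_noise M)"
  "distr (additive_noise M) (additive_noise M) (\<lambda>w. \<lambda>k\<in>{1..}. w (k + n)) = additive_noise M"
proof -
  have W: "prob_space (noise_block M)"
    by (intro prob_space_PiM prob_space_std_complex_normal)
  show "(\<lambda>w. \<lambda>k\<in>{1..}. w (k + n)) \<in> measurable (additive_noise M) (additive_noise M)"
    unfolding additive_noise_def by (intro measurable_restrict measurable_component_singleton) auto
  show "distr (additive_noise M) (additive_noise M) (\<lambda>w. \<lambda>k\<in>{1..}. w (k + n)) = additive_noise M"
    unfolding additive_noise_def
    using distr_PiM_reindex[of "{1..}" "\<lambda>_. noise_block M" "\<lambda>k. k + n" "{1..}"] W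
    by (auto simp: inj_on_def)
qed

lemma distr_shift_noise:
  assumes \<sigma>: "0 < \<sigma>c" "0 < \<sigma>r"
  shows "shift_noise n \<in> measurable (channel_noise M \<sigma>c \<sigma>r) (channel_noise M \<sigma>c \<sigma>r)"
    and "distr (channel_noise M \<sigma>c \<sigma>r) (channel_noise M \<sigma>c \<sigma>r) (shift_noise n) = channel_noise M \<sigma>c \<sigma>r"
proof -
  let ?w = "\<lambda>w :: nat \<Rightarrow> nat \<Rightarrow> complex. \<lambda>k\<in>{1..}. w (k + n)"
  let ?C = "phase_source \<sigma>c" and ?R = "phase_source \<sigma>r" and ?A = "additive_noise M"
  have W: "sigma_finite_measure ?A" by (intro prob_space_imp_sigma_finite prob_space_additive_noise)
  have RW: "sigma_finite_measure (?R \<Otimes>\<^sub>M ?A)"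
    by (intro prob_space_imp_sigma_finite prob_space_pair prob_space_additive_noise prob_space_phase_source \<sigma>)
  have m2: "(\<lambda>(s, w). (shift_phase n s, ?w w)) \<in> measurable (?R \<Otimes>\<^sub>M ?A) (?R \<Otimes>\<^sub>M ?A)"
    unfolding case_prod_beta'
    by (intro measurable_Pair measurable_compose[OF measurable_fst shift_phase_measurable]
        measurable_compose[OF measurable_snd distr_shift_additive_noise(1)])
  have e: "shift_noise n = (\<lambda>(s, q). (shift_phase n s, (\<lambda>(s, w). (shift_phase n s, ?w w)) q))"
    by (auto simp: shift_noise_def)
  have d2: "distr (?R \<Otimes>\<^sub>M ?A) (?R \<Otimes>\<^sub>M ?A) (\<lambda>(s, w). (shift_phase n s, ?w w)) = ?R \<Otimes>\<^sub>M ?A"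
    by (rule pair_measure_distr[OF shift_phase_measurable[of n \<sigma>r] distr_shift_additive_noise(1)[of n M],
          unfolded distr_shift_phase[OF \<sigma>(2)] distr_shift_additive_noise(2), OF W, symmetric])
  show "shift_noise n \<in> measurable (channel_noise M \<sigma>c \<sigma>r) (channel_noise M \<sigma>c \<sigma>r)"
    unfolding shift_noise_def channel_noise_def
    by (intro measurable_Pair; (rule measurable_compose[OF _ shift_phase_measurable]
        measurable_compose[OF _ distr_shift_additive_noise(1)]); measurable)
  show "distr (channel_noise M \<sigma>c \<sigma>r) (channel_noise M \<sigma>c \<sigma>r) (shift_noise n) = channel_noise M \<sigma>c \<sigma>r"
    unfolding e channel_noise_def
    by (rule pair_measure_distr[OF shift_phase_measurable[of n \<sigma>c] m2,
          unfolded distr_shift_phase[OF \<sigma>(1)] d2, OF RW, symmetric])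
qed

section \<open>Superadditivity\<close>

definition left_blocks :: "nat \<Rightarrow> (nat \<Rightarrow> nat \<Rightarrow> complex) \<Rightarrow> nat \<Rightarrow> nat \<Rightarrow> complex" where
  "left_blocks n x = (\<lambda>k\<in>{1..n}. x k)"

definition right_blocks :: "nat \<Rightarrow> nat \<Rightarrow> (nat \<Rightarrow> nat \<Rightarrow> complex) \<Rightarrow> nat \<Rightarrow> nat \<Rightarrow> complex" where
  "right_blocks n m x = (\<lambda>k\<in>{1..m}. x (k + n))"

definition join_blocks :: "nat \<Rightarrow> nat \<Rightarrow> (nat \<Rightarrow> nat \<Rightarrow> complex) \<times> (nat \<Rightarrow> nat \<Rightarrow> complex) \<Rightarrow> nat \<Rightarrow> nat \<Rightarrow> complex" where
  "join_blocks n m p = (\<lambda>k\<in>{1..n + m}. if k \<le> n then fst p k else snd p (k - n))"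

lemma left_blocks_measurable: "left_blocks n \<in> measurable (block_space M (n + m)) (block_space M n)"
  unfolding left_blocks_def block_space_def
  by (intro measurable_restrict measurable_component_singleton) auto

lemma right_blocks_measurable: "right_blocks n m \<in> measurable (block_space M (n + m)) (block_space M m)"
  unfolding right_blocks_def block_space_def
  by (intro measurable_restrict measurable_component_singleton) auto

lemma join_blocks_measurable:
  "join_blocks n m \<in> measurable (block_space M n \<Otimes>\<^sub>M block_space M m) (block_space M (n + m))"
  unfolding join_blocks_def block_space_def
proof (intro measurable_restrict)
  fix k assume k: "k \<in> {1..n + m}"
  let ?B = "vec_borel M"
  show "(\<lambda>p. if k \<le> n then fst p k else snd p (k - n)) \<in> measurable (PiM {1..n} (\<lambda>_. ?B) \<Otimes>\<^sub>M PiM {1..m} (\<lambda>_. ?B)) ?B"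
  proof (cases "k \<le> n")
    case True
    have "(\<lambda>p. fst p k) \<in> measurable (PiM {1..n} (\<lambda>_. ?B) \<Otimes>\<^sub>M PiM {1..m} (\<lambda>_. ?B)) ?B"
      by (rule measurable_compose[OF measurable_fst measurable_component_singleton]) (use k True in auto)
    then show ?thesis using True by simp
  next
    case False
    have "(\<lambda>p. snd p (k - n)) \<in> measurable (PiM {1..n} (\<lambda>_. ?B) \<Otimes>\<^sub>M PiM {1..m} (\<lambda>_. ?B)) ?B"
      by (rule measurable_compose[OF measurable_snd measurable_component_singleton]) (use k False in auto)
    then show ?thesis using False by simp
  qed
qed

lemma left_join: "x \<in> space (block_space M n) \<Longrightarrow> left_blocks n (join_blocks n m (x, y)) = x"
  by (auto simp: left_blocks_def join_blocks_def block_space_def space_PiM PiE_def extensional_def fun_eq_iff)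

lemma right_join: "y \<in> space (block_space M m) \<Longrightarrow> right_blocks n m (join_blocks n m (x, y)) = y"
  by (auto simp: right_blocks_def join_blocks_def block_space_def space_PiM PiE_def extensional_def fun_eq_iff)

lemma channel_output_left: "channel_output M n (left_blocks n x, \<nu>) = left_blocks n (channel_output M (n + m) (x, \<nu>))"
  by (auto simp: channel_output_def left_blocks_def case_prod_beta fun_eq_iff)

text \<open>Time invariance: the later blocks of a long transmission form a transmission of their
  own once the noise is shifted along. The shift preserves the law of the noise, so the right
  stretch is statistically a fresh channel.\<close>

lemma channel_output_right:
  "channel_output M m (right_blocks n m x, shift_noise n \<nu>) = right_blocks n m (channel_output M (n + m) (x, \<nu>))"
  by (auto simp: channel_output_def right_blocks_def case_prod_beta fun_eq_iff shift_noise_def phase_shift_phase)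

lemma block_power_measurable:
  assumes k: "k \<in> {1..q}"
  shows "(\<lambda>x. ennreal ((L2_set (\<lambda>i. cmod (x k i)) {..<M})\<^sup>2)) \<in> borel_measurable (block_space M q)"
proof -
  have e: "ennreal ((L2_set (\<lambda>i. cmod (x k i)) {..<M})\<^sup>2) = ennreal (\<Sum>i<M. (cmod (x k i))\<^sup>2)" for x :: "nat \<Rightarrow> nat \<Rightarrow> complex"
    by (simp add: L2_set_def sum_nonneg)
  have "(\<lambda>x. \<Sum>i<M. (cmod (x k i))\<^sup>2) \<in> borel_measurable (block_space M q)"
  proof (rule borel_measurable_sum)
    fix i assume "i \<in> {..<M}"
    then have [measurable]: "(\<lambda>x. x k i) \<in> borel_measurable (block_space M q)" using block_space_component[OF k] by auto
    show "(\<lambda>x. (cmod (x k i))\<^sup>2) \<in> borel_measurable (block_space M q)" by measurable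
  qed
  then show ?thesis unfolding e by measurable
qed

text \<open>An equivariance principle that covers both stretches of a long transmission: the left
  one with the noise unchanged, the right one with the noise shifted.\<close>

lemma joint_law_map:
  assumes \<sigma>: "0 < \<sigma>c" "0 < \<sigma>r" and sP: "sets P = sets (block_space M n)" and sQ: "sets Q = sets (block_space M n')"
    and P: "prob_space P" and Q: "prob_space Q"
    and f: "f \<in> measurable (block_space M n) (block_space M n')" and d: "distr P (block_space M n') f = Q"
    and s: "s \<in> measurable (channel_noise M \<sigma>c \<sigma>r) (channel_noise M \<sigma>c \<sigma>r)"
    and ds: "distr (channel_noise M \<sigma>c \<sigma>r) (channel_noise M \<sigma>c \<sigma>r) s = channel_noise M \<sigma>c \<sigma>r"
    and out: "\<And>x \<nu>. channel_output M n' (f x, s \<nu>) = f (channel_output M n (x, \<nu>))"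
  shows "distr (joint_law M \<sigma>c \<sigma>r n P) (block_space M n' \<Otimes>\<^sub>M block_space M n') (map_prod f f) = joint_law M \<sigma>c \<sigma>r n' Q"
proof -
  let ?N = "channel_noise M \<sigma>c \<sigma>r" and ?B = "block_space M n" and ?B' = "block_space M n'"
  interpret P: channel_input M n \<sigma>c \<sigma>r P by (rule channel_input.intro) fact+
  interpret Q: channel_input M n' \<sigma>c \<sigma>r Q by (rule channel_input.intro) fact+
  have fP: "f \<in> measurable P ?B'" using f measurable_cong_sets[OF sP refl] by blast
  have dQ: "distr P Q f = Q" using d distr_cong[OF refl sQ, of P f f] by simp
  have fQ: "f \<in> measurable P Q" using fP measurable_cong_sets[OF refl sQ] by blast
  have pm: "Q \<Otimes>\<^sub>M ?N = distr (P \<Otimes>\<^sub>M ?N) (Q \<Otimes>\<^sub>M ?N) (\<lambda>(x, \<nu>). (f x, s \<nu>))"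
    using pair_measure_distr[OF fQ s] prob_space_imp_sigma_finite[OF prob_space_channel_noise[OF \<sigma>]] by (simp add: dQ ds)
  have mm: "(\<lambda>(x, \<nu>). (f x, s \<nu>)) \<in> measurable (P \<Otimes>\<^sub>M ?N) (Q \<Otimes>\<^sub>M ?N)"
    unfolding case_prod_beta' by (intro measurable_Pair measurable_compose[OF measurable_fst fQ] measurable_compose[OF measurable_snd s])
  have ff: "map_prod f f \<in> measurable (?B \<Otimes>\<^sub>M ?B) (?B' \<Otimes>\<^sub>M ?B')"
    unfolding map_prod_def case_prod_beta' by (intro measurable_Pair measurable_compose[OF measurable_fst f] measurable_compose[OF measurable_snd f])
  have "joint_law M \<sigma>c \<sigma>r n' Q = distr (distr (P \<Otimes>\<^sub>M ?N) (Q \<Otimes>\<^sub>M ?N) (\<lambda>(x, \<nu>). (f x, s \<nu>))) (?B' \<Otimes>\<^sub>M ?B') (\<lambda>\<omega>. (fst \<omega>, channel_output M n' \<omega>))"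
    unfolding joint_law_def by (subst pm) (rule refl)
  also have "\<dots> = distr (P \<Otimes>\<^sub>M ?N) (?B' \<Otimes>\<^sub>M ?B') ((\<lambda>\<omega>. (fst \<omega>, channel_output M n' \<omega>)) \<circ> (\<lambda>(x, \<nu>). (f x, s \<nu>)))"
    by (rule distr_distr[OF Q.XY_measurable mm])
  also have "(\<lambda>\<omega>. (fst \<omega>, channel_output M n' \<omega>)) \<circ> (\<lambda>(x, \<nu>). (f x, s \<nu>)) = map_prod f f \<circ> (\<lambda>\<omega>. (fst \<omega>, channel_output M n \<omega>))"
    by (auto simp: fun_eq_iff out)
  also have "distr (P \<Otimes>\<^sub>M ?N) (?B' \<Otimes>\<^sub>M ?B') (map_prod f f \<circ> (\<lambda>\<omega>. (fst \<omega>, channel_output M n \<omega>))) =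
      distr (joint_law M \<sigma>c \<sigma>r n P) (?B' \<Otimes>\<^sub>M ?B') (map_prod f f)"
    unfolding joint_law_def by (rule distr_distr[OF ff P.XY_measurable, symmetric])
  finally show ?thesis ..
qed

text \<open>Absolute continuity does not mention the reference measure, so one arbitrary member of
  the family proves it.\<close>

lemma joint_law_ac:
  assumes M: "2 \<le> M" and \<sigma>: "0 < \<sigma>c" "0 < \<sigma>r" and P: "prob_space P" "sets P = sets (block_space M n)"
  shows "absolutely_continuous (P \<Otimes>\<^sub>M out_law M \<sigma>c \<sigma>r n P) (joint_law M \<sigma>c \<sigma>r n P)"
proof -
  obtain fc lc hc where fc: "fc \<in> borel_measurable borel" "0 < lc" "\<And>\<theta>. lc \<le> fc \<theta>" "\<And>\<theta>. fc \<theta> \<le> hc"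
    "wrapped_normal \<sigma>c = density circle_lborel (\<lambda>\<theta>. ennreal (fc \<theta>))"
    using wrapped_normal_has_density[OF \<sigma>(1)] by metis
  obtain fr lr hr where fr: "fr \<in> borel_measurable borel" "0 < lr" "\<And>\<theta>. lr \<le> fr \<theta>" "\<And>\<theta>. fr \<theta> \<le> hr"
    "wrapped_normal \<sigma>r = density circle_lborel (\<lambda>\<theta>. ennreal (fr \<theta>))"
    using wrapped_normal_has_density[OF \<sigma>(2)] by metis
  interpret dual_bound M \<sigma>c \<sigma>r "1 / 2" 1 1 1 "min lc lr" "max hc hr" fc fr
    by unfold_locales (use M \<sigma> fc fr in \<open>auto simp: min_le_iff_disj le_max_iff_disj\<close>)
  show ?thesis by (rule joint_law_absolutely_continuous[OF P])
qed

section \<open>Normalisation of the derivative and sign of the information\<close>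

context channel_input
begin

text \<open>For a fixed output the derivative is the density of the conditional law of the input
  against \<open>P\<close>. Formally, its mean over the input is the density of the output marginal
  of the joint law, which is the output law itself, so almost everywhere 1.\<close>

lemma nn_integral_info_deriv:
  assumes M: "2 \<le> M"
  shows "AE y in out_law M \<sigma>c \<sigma>r n P. (\<integral>\<^sup>+x. info_deriv M \<sigma>c \<sigma>r n P (x, y) \<partial>P) = 1"
proof -
  let ?O = "out_law M \<sigma>c \<sigma>r n P" and ?J = "joint_law M \<sigma>c \<sigma>r n P" and ?B = "block_space M n"
  let ?\<rho> = "info_deriv M \<sigma>c \<sigma>r n P"
  let ?a = "\<lambda>y. \<integral>\<^sup>+x. ?\<rho> (x, y) \<partial>P"
  interpret O: prob_space ?O by (rule prob_space_out_law)
  interpret PO: pair_prob_space P ?O ..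
  have ac: "absolutely_continuous (P \<Otimes>\<^sub>M ?O) ?J" by (rule joint_law_ac[OF M sigma P sets_P])
  have am [measurable]: "?a \<in> borel_measurable ?O"
  proof (rule PN.M1.borel_measurable_nn_integral)
    have "(\<lambda>p. ?\<rho> (snd p, fst p)) \<in> borel_measurable (?O \<Otimes>\<^sub>M P)"
      by (rule measurable_compose[OF _ borel_measurable_RN_deriv]) measurable
    then show "(\<lambda>(y, x). ?\<rho> (x, y)) \<in> borel_measurable (?O \<Otimes>\<^sub>M P)" by (simp add: case_prod_beta')
  qed
  have "density ?O ?a = density ?O (\<lambda>_. 1)"
  proof (rule measure_eqI_nn_integral)
    fix g :: "(nat \<Rightarrow> nat \<Rightarrow> complex) \<Rightarrow> ennreal" assume "g \<in> borel_measurable (density ?O ?a)"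
    then have g [measurable]: "g \<in> borel_measurable ?O" "g \<in> borel_measurable ?B" by (simp_all cong: measurable_cong_sets)
    have m: "(\<lambda>z. ?\<rho> z * g (snd z)) \<in> borel_measurable (P \<Otimes>\<^sub>M ?O)" by measurable
    have m': "(\<lambda>x. ?\<rho> (x, y)) \<in> borel_measurable P" if "y \<in> space ?O" for y
      by (rule measurable_compose[OF measurable_Pair2'[OF that] borel_measurable_RN_deriv])
    have "(\<integral>\<^sup>+y. g y \<partial>density ?O ?a) = (\<integral>\<^sup>+y. ?a y * g y \<partial>?O)"
      by (rule nn_integral_density) (use am g in auto)
    also have "\<dots> = (\<integral>\<^sup>+y. \<integral>\<^sup>+x. ?\<rho> (x, y) * g (snd (x, y)) \<partial>P \<partial>?O)"
      by (intro nn_integral_cong) (simp add: nn_integral_multc m')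
    also have "\<dots> = (\<integral>\<^sup>+z. ?\<rho> z * g (snd z) \<partial>(P \<Otimes>\<^sub>M ?O))"
      using PO.nn_integral_snd[OF m] by simp
    also have "\<dots> = (\<integral>\<^sup>+z. g (snd z) \<partial>?J)"
      by (rule PO.RN_deriv_nn_integral[OF ac sets_joint_law, symmetric]) measurable
    also have "\<dots> = (\<integral>\<^sup>+\<omega>. g (Y \<omega>) \<partial>(P \<Otimes>\<^sub>M N))"
      unfolding joint_law_def by (subst nn_integral_distr) auto
    also have "\<dots> = (\<integral>\<^sup>+y. g y \<partial>?O)"
      unfolding out_law_def by (rule nn_integral_distr[symmetric]) (use g in \<open>auto simp: out_law_def\<close>)
    finally show "(\<integral>\<^sup>+y. g y \<partial>density ?O ?a) = (\<integral>\<^sup>+y. g y \<partial>density ?O (\<lambda>_. 1))" by (simp add: density_1)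
  qed simp
  then show ?thesis by (subst (asm) O.density_unique_iff) auto
qed

lemma AE_info_deriv_pos_finite:
  assumes M: "2 \<le> M"
  shows "AE z in joint_law M \<sigma>c \<sigma>r n P. 0 < info_deriv M \<sigma>c \<sigma>r n P z \<and> info_deriv M \<sigma>c \<sigma>r n P z < \<infinity>"
  by (rule AE_RN_deriv_pos_finite[OF prob_space_product prob_space_joint_law sets_joint_law joint_law_ac[OF M sigma P sets_P]])

lemma info_nats_nonneg:
  assumes M: "2 \<le> M" and int: "info_integrable M \<sigma>c \<sigma>r n P"
  shows "0 \<le> info_nats M \<sigma>c \<sigma>r n P"
proof -
  interpret PO: prob_space "P \<Otimes>\<^sub>M out_law M \<sigma>c \<sigma>r n P" by (rule prob_space_product)
  show ?thesis
    using KL_lower[OF prob_space_product prob_space_joint_law sets_joint_law joint_law_ac[OF M sigma P sets_P] int, of "\<lambda>_. 1"]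
    by (simp add: info_nats_def PO.emeasure_space_1)
qed

lemma out_law_eq_distr_joint: "out_law M \<sigma>c \<sigma>r n P = distr (joint_law M \<sigma>c \<sigma>r n P) (block_space M n) snd"
  unfolding out_law_def joint_law_def by (subst distr_distr[OF measurable_snd XY_measurable]) (simp add: comp_def)

lemma info_deriv_measurable: "info_deriv M \<sigma>c \<sigma>r n P \<in> borel_measurable (block_space M n \<Otimes>\<^sub>M block_space M n)"
  using borel_measurable_RN_deriv[of "P \<Otimes>\<^sub>M out_law M \<sigma>c \<sigma>r n P" "joint_law M \<sigma>c \<sigma>r n P"]
    measurable_cong_sets[OF sets_joint_law refl] measurable_cong_sets[OF sets_joint_law' refl] by blast

end

text \<open>The input is the concatenation of two independent inputs, and the product
  \<open>G\<close> of the two short derivatives serves as competitor in \<open>KL_lower\<close>. The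
  outputs of the two stretches are dependent through the phases, so \<open>G\<close> need not be the
  derivative of the long transmission. It is enough that \<open>G\<close> has mass at most 1 against
  the product of the marginals, and for that only the inputs have to be independent.\<close>

theorem info_nats_superadditive:
  assumes M: "2 \<le> M" and \<sigma>: "0 < \<sigma>c" "0 < \<sigma>r" and \<rho>: "0 < \<rho>"
    and int: "\<And>n P. P \<in> admissible_inputs M n \<rho> \<Longrightarrow> info_integrable M \<sigma>c \<sigma>r n P"
    and P1: "P1 \<in> admissible_inputs M n \<rho>" and P2: "P2 \<in> admissible_inputs M m \<rho>"
  shows "\<exists>P\<in>admissible_inputs M (n + m) \<rho>. info_nats M \<sigma>c \<sigma>r n P1 + info_nats M \<sigma>c \<sigma>r m P2 \<le> info_nats M \<sigma>c \<sigma>r (n + m) P"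
proof -
  let ?N = "channel_noise M \<sigma>c \<sigma>r" and ?B = "block_space M (n + m)" and ?B1 = "block_space M n" and ?B2 = "block_space M m"
  let ?l = "left_blocks n" and ?r = "right_blocks n m"
  have p1: "prob_space P1" and s1: "sets P1 = sets ?B1"
    and w1: "(\<Sum>k=1..n. \<integral>\<^sup>+x. ennreal ((L2_set (\<lambda>i. cmod (x k i)) {..<M})\<^sup>2) \<partial>P1) \<le> ennreal (real n * \<rho>)"
    using P1 by (auto simp: admissible_inputs_def)
  have p2: "prob_space P2" and s2: "sets P2 = sets ?B2"
    and w2: "(\<Sum>k=1..m. \<integral>\<^sup>+x. ennreal ((L2_set (\<lambda>i. cmod (x k i)) {..<M})\<^sup>2) \<partial>P2) \<le> ennreal (real m * \<rho>)"
    using P2 by (auto simp: admissible_inputs_def)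
  interpret P1: prob_space P1 by fact
  interpret P2: prob_space P2 by fact
  interpret P12: pair_prob_space P1 P2 ..
  define P where "P = distr (P1 \<Otimes>\<^sub>M P2) ?B (join_blocks n m)"
  have s12: "sets (P1 \<Otimes>\<^sub>M P2) = sets (?B1 \<Otimes>\<^sub>M ?B2)" by (intro sets_pair_measure_cong s1 s2)
  have sp1: "space P1 = space ?B1" and sp2: "space P2 = space ?B2" using s1 s2 by (auto dest: sets_eq_imp_space_eq)
  have jm: "join_blocks n m \<in> measurable (P1 \<Otimes>\<^sub>M P2) ?B"
    using join_blocks_measurable measurable_cong_sets[OF s12 refl] by blast
  have pP: "prob_space P" unfolding P_def by (rule P12.prob_space_distr[OF jm])
  have sP: "sets P = sets ?B" by (simp add: P_def)
  interpret P: prob_space P by fact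
  note lm = left_blocks_measurable[of n M m] and rm = right_blocks_measurable[of n m M]
  have f1: "distr (P1 \<Otimes>\<^sub>M P2) ?B1 fst = P1"
    using distr_cong[OF refl s1[symmetric], of "P1 \<Otimes>\<^sub>M P2" fst fst] P2.distr_pair_fst by simp
  have PE: "(\<integral>\<^sup>+x. a (?l x) * b (?r x) \<partial>P) = (\<integral>\<^sup>+x. a x \<partial>P1) * (\<integral>\<^sup>+x. b x \<partial>P2)"
    if a: "a \<in> borel_measurable ?B1" and b: "b \<in> borel_measurable ?B2" for a b :: "(nat \<Rightarrow> nat \<Rightarrow> complex) \<Rightarrow> ennreal"
  proof -
    have a': "a \<in> borel_measurable P1" using a measurable_cong_sets[OF s1 refl] by blast
    have b': "b \<in> borel_measurable P2" using b measurable_cong_sets[OF s2 refl] by blast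
    note [measurable] = a' b'
    have m: "(\<lambda>x. a (?l x) * b (?r x)) \<in> borel_measurable ?B"
      using measurable_compose[OF lm a] measurable_compose[OF rm b] by measurable
    have "(\<integral>\<^sup>+x. a (?l x) * b (?r x) \<partial>P) = (\<integral>\<^sup>+p. a (?l (join_blocks n m p)) * b (?r (join_blocks n m p)) \<partial>(P1 \<Otimes>\<^sub>M P2))"
      unfolding P_def by (rule nn_integral_distr[OF jm]) (use m in auto)
    also have "\<dots> = (\<integral>\<^sup>+p. a (fst p) * b (snd p) \<partial>(P1 \<Otimes>\<^sub>M P2))"
    proof (rule nn_integral_cong)
      fix p assume "p \<in> space (P1 \<Otimes>\<^sub>M P2)"
      then have "fst p \<in> space ?B1" "snd p \<in> space ?B2" by (auto simp: space_pair_measure sp1 sp2)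
      then show "a (?l (join_blocks n m p)) * b (?r (join_blocks n m p)) = a (fst p) * b (snd p)"
        using left_join[of "fst p" M n m "snd p"] right_join[of "snd p" M m n "fst p"] by simp
    qed
    also have "\<dots> = (\<integral>\<^sup>+x. \<integral>\<^sup>+y. a x * b y \<partial>P2 \<partial>P1)"
      by (subst P2.nn_integral_fst[symmetric]) auto
    also have "\<dots> = (\<integral>\<^sup>+x. a x \<partial>P1) * (\<integral>\<^sup>+x. b x \<partial>P2)"
      by (simp add: nn_integral_cmult nn_integral_multc)
    finally show ?thesis .
  qed
  have lP: "?l \<in> measurable P ?B1" and rP: "?r \<in> measurable P ?B2"
    using lm rm measurable_cong_sets[OF sP refl] by blast+
  have dl: "distr P ?B1 ?l = P1"
  proof (rule measure_eqI_nn_integral)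
    fix g :: "(nat \<Rightarrow> nat \<Rightarrow> complex) \<Rightarrow> ennreal" assume "g \<in> borel_measurable (distr P ?B1 ?l)"
    then have g: "g \<in> borel_measurable ?B1" by simp
    show "(\<integral>\<^sup>+x. g x \<partial>distr P ?B1 ?l) = (\<integral>\<^sup>+x. g x \<partial>P1)"
      using PE[OF g borel_measurable_const[of 1]] g by (simp add: nn_integral_distr[OF lP] P1.emeasure_space_1 P2.emeasure_space_1)
  qed (simp add: s1)
  have dr: "distr P ?B2 ?r = P2"
  proof (rule measure_eqI_nn_integral)
    fix g :: "(nat \<Rightarrow> nat \<Rightarrow> complex) \<Rightarrow> ennreal" assume "g \<in> borel_measurable (distr P ?B2 ?r)"
    then have g: "g \<in> borel_measurable ?B2" by simp
    show "(\<integral>\<^sup>+x. g x \<partial>distr P ?B2 ?r) = (\<integral>\<^sup>+x. g x \<partial>P2)"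
      using PE[OF borel_measurable_const[of 1] g] g by (simp add: nn_integral_distr[OF rP] P1.emeasure_space_1 P2.emeasure_space_1)
  qed (simp add: s2)
  let ?e = "\<lambda>k x. ennreal ((L2_set (\<lambda>i. cmod (x k i)) {..<M})\<^sup>2)"
  note em = block_power_measurable[where M = M]
  have adm: "P \<in> admissible_inputs M (n + m) \<rho>"
  proof -
    have el: "(\<integral>\<^sup>+x. ?e k x \<partial>P) = (\<integral>\<^sup>+x. ?e k x \<partial>P1)" if k: "k \<in> {1..n}" for k
    proof -
      have "(\<integral>\<^sup>+x. ?e k x \<partial>P1) = (\<integral>\<^sup>+x. ?e k x \<partial>distr P ?B1 ?l)" by (simp only: dl)
      also have "\<dots> = (\<integral>\<^sup>+x. ?e k (?l x) \<partial>P)" by (rule nn_integral_distr[OF lP]) (use em[OF k] in simp)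
      also have "\<dots> = (\<integral>\<^sup>+x. ?e k x \<partial>P)" using k by (simp add: left_blocks_def)
      finally show ?thesis ..
    qed
    have er: "(\<integral>\<^sup>+x. ?e (k + n) x \<partial>P) = (\<integral>\<^sup>+x. ?e k x \<partial>P2)" if k: "k \<in> {1..m}" for k
    proof -
      have "(\<integral>\<^sup>+x. ?e k x \<partial>P2) = (\<integral>\<^sup>+x. ?e k x \<partial>distr P ?B2 ?r)" by (simp only: dr)
      also have "\<dots> = (\<integral>\<^sup>+x. ?e k (?r x) \<partial>P)" by (rule nn_integral_distr[OF rP]) (use em[OF k] in simp)
      also have "\<dots> = (\<integral>\<^sup>+x. ?e (k + n) x \<partial>P)" using k by (simp add: right_blocks_def)
      finally show ?thesis ..
    qed
    have "{1..n + m} = {1..n} \<union> {1 + n..m + n}" by auto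
    then have "(\<Sum>k=1..n+m. \<integral>\<^sup>+x. ?e k x \<partial>P) = (\<Sum>k=1..n. \<integral>\<^sup>+x. ?e k x \<partial>P) + (\<Sum>k=1+n..m+n. \<integral>\<^sup>+x. ?e k x \<partial>P)"
      by (simp add: sum.union_disjoint)
    also have "(\<Sum>k=1+n..m+n. \<integral>\<^sup>+x. ?e k x \<partial>P) = (\<Sum>k=1..m. \<integral>\<^sup>+x. ?e (k + n) x \<partial>P)"
      by (rule sum.shift_bounds_cl_nat_ivl)
    also have "(\<Sum>k=1..n. \<integral>\<^sup>+x. ?e k x \<partial>P) + (\<Sum>k=1..m. \<integral>\<^sup>+x. ?e (k + n) x \<partial>P) = (\<Sum>k=1..n. \<integral>\<^sup>+x. ?e k x \<partial>P1) + (\<Sum>k=1..m. \<integral>\<^sup>+x. ?e k x \<partial>P2)"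
      by (intro arg_cong2[where f = "(+)"] sum.cong refl el er)
    also have "\<dots> \<le> ennreal (real n * \<rho>) + ennreal (real m * \<rho>)" by (intro add_mono w1 w2)
    also have "\<dots> = ennreal (real (n + m) * \<rho>)"
      using \<rho> by (simp add: ennreal_plus[symmetric] algebra_simps del: ennreal_plus)
    finally show ?thesis using pP sP by (simp add: admissible_inputs_def)
  qed
  interpret C: channel_input M "n + m" \<sigma>c \<sigma>r P by (rule channel_input.intro) fact+
  interpret C1: channel_input M n \<sigma>c \<sigma>r P1 by (rule channel_input.intro) fact+
  interpret C2: channel_input M m \<sigma>c \<sigma>r P2 by (rule channel_input.intro) fact+
  let ?J = "joint_law M \<sigma>c \<sigma>r (n + m) P" and ?J1 = "joint_law M \<sigma>c \<sigma>r n P1" and ?J2 = "joint_law M \<sigma>c \<sigma>r m P2"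
  let ?O = "out_law M \<sigma>c \<sigma>r (n + m) P" and ?O1 = "out_law M \<sigma>c \<sigma>r n P1" and ?O2 = "out_law M \<sigma>c \<sigma>r m P2"
  let ?d1 = "info_deriv M \<sigma>c \<sigma>r n P1" and ?d2 = "info_deriv M \<sigma>c \<sigma>r m P2"
  interpret O: prob_space ?O by (rule C.prob_space_out_law)
  interpret PO: pair_prob_space P ?O ..
  have J1: "distr ?J (?B1 \<Otimes>\<^sub>M ?B1) (map_prod ?l ?l) = ?J1"
    by (rule joint_law_map[where s = "\<lambda>\<nu>. \<nu>", OF \<sigma> sP s1 pP p1 lm dl]) (auto simp: distr_id channel_output_left)
  have J2: "distr ?J (?B2 \<Otimes>\<^sub>M ?B2) (map_prod ?r ?r) = ?J2"
    by (rule joint_law_map[where s = "shift_noise n", OF \<sigma> sP s2 pP p2 rm dr distr_shift_noise[OF \<sigma>]]) (rule channel_output_right)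
  have ml: "map_prod ?l ?l \<in> measurable (?B \<Otimes>\<^sub>M ?B) (?B1 \<Otimes>\<^sub>M ?B1)"
    unfolding map_prod_def case_prod_beta' by (intro measurable_Pair measurable_compose[OF measurable_fst lm] measurable_compose[OF measurable_snd lm])
  have mr: "map_prod ?r ?r \<in> measurable (?B \<Otimes>\<^sub>M ?B) (?B2 \<Otimes>\<^sub>M ?B2)"
    unfolding map_prod_def case_prod_beta' by (intro measurable_Pair measurable_compose[OF measurable_fst rm] measurable_compose[OF measurable_snd rm])
  have mlJ: "map_prod ?l ?l \<in> measurable ?J (?B1 \<Otimes>\<^sub>M ?B1)" and mrJ: "map_prod ?r ?r \<in> measurable ?J (?B2 \<Otimes>\<^sub>M ?B2)"
    using ml mr measurable_cong_sets[OF C.sets_joint_law' refl] by blast+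
  have lO: "?l \<in> measurable ?O ?B1" and rO: "?r \<in> measurable ?O ?B2"
    using lm rm measurable_cong_sets[OF C.sets_out_law refl] by blast+
  have sndJ: "snd \<in> measurable ?J ?B"
    using measurable_snd[of ?B ?B] measurable_cong_sets[OF C.sets_joint_law' refl] by blast
  have O1: "distr ?O ?B1 ?l = ?O1"
  proof -
    have "distr ?O ?B1 ?l = distr ?J ?B1 (?l \<circ> snd)"
      unfolding C.out_law_eq_distr_joint by (rule distr_distr[OF lm sndJ])
    also have "?l \<circ> snd = snd \<circ> map_prod ?l ?l" by (auto simp: fun_eq_iff)
    also have "distr ?J ?B1 (snd \<circ> map_prod ?l ?l) = distr (distr ?J (?B1 \<Otimes>\<^sub>M ?B1) (map_prod ?l ?l)) ?B1 snd"
      by (rule distr_distr[OF measurable_snd mlJ, symmetric])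
    also have "\<dots> = ?O1" by (simp only: J1 C1.out_law_eq_distr_joint)
    finally show ?thesis .
  qed
  have O2: "distr ?O ?B2 ?r = ?O2"
  proof -
    have "distr ?O ?B2 ?r = distr ?J ?B2 (?r \<circ> snd)"
      unfolding C.out_law_eq_distr_joint by (rule distr_distr[OF rm sndJ])
    also have "?r \<circ> snd = snd \<circ> map_prod ?r ?r" by (auto simp: fun_eq_iff)
    also have "distr ?J ?B2 (snd \<circ> map_prod ?r ?r) = distr (distr ?J (?B2 \<Otimes>\<^sub>M ?B2) (map_prod ?r ?r)) ?B2 snd"
      by (rule distr_distr[OF measurable_snd mrJ, symmetric])
    also have "\<dots> = ?O2" by (simp only: J2 C2.out_law_eq_distr_joint)
    finally show ?thesis .
  qed
  define G where "G = (\<lambda>z. ?d1 (map_prod ?l ?l z) * ?d2 (map_prod ?r ?r z))"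
  have d1m: "(\<lambda>z. ?d1 (map_prod ?l ?l z)) \<in> borel_measurable (?B \<Otimes>\<^sub>M ?B)" by (rule measurable_compose[OF ml C1.info_deriv_measurable])
  have d2m: "(\<lambda>z. ?d2 (map_prod ?r ?r z)) \<in> borel_measurable (?B \<Otimes>\<^sub>M ?B)" by (rule measurable_compose[OF mr C2.info_deriv_measurable])
  have sPO: "sets (P \<Otimes>\<^sub>M ?O) = sets (?B \<Otimes>\<^sub>M ?B)" using C.sets_joint_law C.sets_joint_law' by simp
  have Gm: "G \<in> borel_measurable (P \<Otimes>\<^sub>M ?O)"
    unfolding G_def using d1m d2m measurable_cong_sets[OF sPO refl] by (intro borel_measurable_times_ennreal) blast+
  have sec1: "(\<lambda>x. ?d1 (x, y)) \<in> borel_measurable ?B1" if "y \<in> space ?B1" for y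
    by (rule measurable_compose[OF measurable_Pair2'[OF that] C1.info_deriv_measurable])
  have sec2: "(\<lambda>x. ?d2 (x, y)) \<in> borel_measurable ?B2" if "y \<in> space ?B2" for y
    by (rule measurable_compose[OF measurable_Pair2'[OF that] C2.info_deriv_measurable])
  \<comment> \<open>The output is held fixed and the input integrated first: \<open>G\<close> then
    splits over the two independent stretches, and both factors are 1 for almost every
    output.\<close>
  have G1: "(\<integral>\<^sup>+z. G z \<partial>(P \<Otimes>\<^sub>M ?O)) \<le> 1"
  proof -
    have a1: "AE y in ?O. (\<integral>\<^sup>+x. ?d1 (x, ?l y) \<partial>P1) = 1"
      by (rule AE_distrD[OF lO]) (simp only: O1, rule C1.nn_integral_info_deriv[OF M])
    have a2: "AE y in ?O. (\<integral>\<^sup>+x. ?d2 (x, ?r y) \<partial>P2) = 1"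
      by (rule AE_distrD[OF rO]) (simp only: O2, rule C2.nn_integral_info_deriv[OF M])
    have "(\<integral>\<^sup>+z. G z \<partial>(P \<Otimes>\<^sub>M ?O)) = (\<integral>\<^sup>+y. \<integral>\<^sup>+x. G (x, y) \<partial>P \<partial>?O)"
      by (rule PO.nn_integral_snd[symmetric]) (use Gm in simp)
    also have "\<dots> = (\<integral>\<^sup>+y. (\<integral>\<^sup>+x. ?d1 (x, ?l y) \<partial>P1) * (\<integral>\<^sup>+x. ?d2 (x, ?r y) \<partial>P2) \<partial>?O)"
    proof (rule nn_integral_cong)
      fix y assume y: "y \<in> space ?O"
      have "?l y \<in> space ?B1" "?r y \<in> space ?B2" using measurable_space[OF lO y] measurable_space[OF rO y] by auto
      from PE[OF sec1[OF this(1)] sec2[OF this(2)]]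
      show "(\<integral>\<^sup>+x. G (x, y) \<partial>P) = (\<integral>\<^sup>+x. ?d1 (x, ?l y) \<partial>P1) * (\<integral>\<^sup>+x. ?d2 (x, ?r y) \<partial>P2)"
        by (simp add: G_def)
    qed
    also have "\<dots> = (\<integral>\<^sup>+y. 1 \<partial>?O)"
      by (rule nn_integral_cong_AE, use a1 a2 in eventually_elim) simp
    finally show ?thesis by (simp add: O.emeasure_space_1)
  qed
  have ae1: "AE z in ?J. 0 < ?d1 (map_prod ?l ?l z) \<and> ?d1 (map_prod ?l ?l z) < \<infinity>"
    by (rule AE_distrD[OF mlJ]) (simp only: J1, rule C1.AE_info_deriv_pos_finite[OF M])
  have ae2: "AE z in ?J. 0 < ?d2 (map_prod ?r ?r z) \<and> ?d2 (map_prod ?r ?r z) < \<infinity>"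
    by (rule AE_distrD[OF mrJ]) (simp only: J2, rule C2.AE_info_deriv_pos_finite[OF M])
  have Gpos: "AE z in ?J. 0 < G z \<and> G z < \<infinity>"
    using ae1 ae2 by eventually_elim (auto simp: G_def ennreal_zero_less_mult_iff ennreal_mult_less_top)
  let ?L1 = "\<lambda>z. ln (enn2real (?d1 (map_prod ?l ?l z)))" and ?L2 = "\<lambda>z. ln (enn2real (?d2 (map_prod ?r ?r z)))"
  have lnm1: "(\<lambda>z. ln (enn2real (?d1 z))) \<in> borel_measurable (?B1 \<Otimes>\<^sub>M ?B1)" using C1.info_deriv_measurable by measurable
  have lnm2: "(\<lambda>z. ln (enn2real (?d2 z))) \<in> borel_measurable (?B2 \<Otimes>\<^sub>M ?B2)" using C2.info_deriv_measurable by measurable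
  have i1: "integrable ?J ?L1" and v1: "(\<integral>z. ?L1 z \<partial>?J) = info_nats M \<sigma>c \<sigma>r n P1"
    using integrable_distr_eq[OF mlJ lnm1] integral_distr[OF mlJ lnm1] int[OF P1] by (simp_all add: J1 info_nats_def)
  have i2: "integrable ?J ?L2" and v2: "(\<integral>z. ?L2 z \<partial>?J) = info_nats M \<sigma>c \<sigma>r m P2"
    using integrable_distr_eq[OF mrJ lnm2] integral_distr[OF mrJ lnm2] int[OF P2] by (simp_all add: J2 info_nats_def)
  have lnG: "AE z in ?J. ln (enn2real (G z)) = ?L1 z + ?L2 z"
    using ae1 ae2
  proof eventually_elim
    case (elim z)
    then have "0 < enn2real (?d1 (map_prod ?l ?l z))" "0 < enn2real (?d2 (map_prod ?r ?r z))"
      by (auto simp: enn2real_positive_iff)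
    then show ?case by (simp add: G_def enn2real_mult ln_mult)
  qed
  have GJ: "G \<in> borel_measurable ?J" using Gm measurable_cong_sets[OF C.sets_joint_law refl] by blast
  have lnGm: "(\<lambda>z. ln (enn2real (G z))) \<in> borel_measurable ?J" using GJ by measurable
  have iG: "integrable ?J (\<lambda>z. ln (enn2real (G z)))"
    using integrable_cong_AE[OF lnGm _ lnG] i1 i2 by auto
  have "info_nats M \<sigma>c \<sigma>r n P1 + info_nats M \<sigma>c \<sigma>r m P2 = (\<integral>z. ?L1 z + ?L2 z \<partial>?J)"
    using i1 i2 by (simp add: v1 v2)
  also have "\<dots> = (\<integral>z. ln (enn2real (G z)) \<partial>?J)"
    using i1 i2 lnG by (intro integral_cong_AE lnGm) auto
  also have "\<dots> \<le> info_nats M \<sigma>c \<sigma>r (n + m) P"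
    unfolding info_nats_def
    by (rule KL_lower[OF C.prob_space_product C.prob_space_joint_law C.sets_joint_law joint_law_ac[OF M \<sigma> pP sP] int[OF adm] Gm G1 Gpos iG])
  finally show ?thesis using adm by blast
qed

section \<open>The capacity limit\<close>

text \<open>The limit is the supremum of \<open>a n / n\<close>. A nearly optimal length
  \<open>m\<close> is repeated \<open>n div m\<close> times; the remainder has nonnegative value and
  is dropped, which costs at most \<open>a m / n\<close> in the quotient.\<close>

lemma fekete_superadditive:
  fixes a :: "nat \<Rightarrow> real"
  assumes nn: "\<And>n. 0 \<le> a n" and sup: "\<And>n m. a n + a m \<le> a (n + m)" and bd: "\<And>n. a n \<le> real n * B"
  shows "\<exists>L. (\<lambda>n. a n / real n) \<longlonglongrightarrow> L"
proof -
  let ?S = "(\<lambda>n. a n / real n) ` {1..}"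
  define c where "c = Sup ?S"
  have le: "a n / real n \<le> B" if "1 \<le> n" for n
    using bd[of n] that by (simp add: field_simps)
  have bdd: "bdd_above ?S" using le by (auto intro!: bdd_aboveI[of _ B])
  have up: "a n / real n \<le> c" if "1 \<le> n" for n
    unfolding c_def using that bdd by (intro cSup_upper) auto
  have mult: "real q * a m \<le> a (q * m)" for q m
  proof (induction q)
    case (Suc q)
    then show ?case using sup[of m "q * m"] by (simp add: algebra_simps)
  qed (simp add: nn)
  have "(\<lambda>n. a n / real n) \<longlonglongrightarrow> c"
  proof (rule tendstoI)
    fix r :: real assume r: "0 < r"
    obtain m where m: "1 \<le> m" "c - r / 2 < a m / real m"
      using less_cSup_iff[of ?S "c - r / 2"] bdd r by (auto simp: c_def)
    obtain N :: nat where N: "2 * a m / r < real N" using reals_Archimedean2 by blast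
    show "\<forall>\<^sub>F n in sequentially. dist (a n / real n) c < r"
      unfolding eventually_sequentially
    proof (intro exI[of _ "max 1 N"] allI impI)
      fix n assume n: "max 1 N \<le> n"
      then have n1: "1 \<le> n" "2 * a m / r < real n" using N by (auto intro: less_le_trans)
      define q where "q = n div m"
      have "real q * a m \<le> a (q * m) + a (n mod m)" using mult[of q m] nn[of "n mod m"] by linarith
      also have "\<dots> \<le> a n" using sup[of "q * m" "n mod m"] by (simp add: q_def)
      finally have q: "real q * a m \<le> a n" .
      have nq: "n < (q + 1) * m"
        using dividend_less_div_times[of m n] m by (simp add: q_def algebra_simps)
      then have "real n \<le> real ((q + 1) * m)" by linarith
      then have "real n / real m - 1 \<le> real q" using m by (simp add: field_simps)
      then have "(real n / real m - 1) * a m \<le> a n"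
        using mult_right_mono[OF _ nn[of m]] q by fastforce
      then have "((real n / real m - 1) * a m) / real n \<le> a n / real n" by (intro divide_right_mono) auto
      also have "((real n / real m - 1) * a m) / real n = a m / real m - a m / real n"
        using n1 m by (simp add: field_simps)
      finally have l: "a m / real m - a m / real n \<le> a n / real n" .
      have "a m / real n < r / 2" using n1 r by (simp add: field_simps)
      then have "c - r < a n / real n" using l m by linarith
      then show "dist (a n / real n) c < r" using up[OF n1(1)] r by (simp add: dist_real_def)
    qed
  qed
  then show ?thesis by blast
qed

text \<open>Keeps the supremum in the capacity from ranging over the empty set, where it would be
  minus infinity.\<close>

lemma admissible_zero: "0 < \<rho> \<Longrightarrow> return (block_space M n) (\<lambda>k\<in>{1..n}. \<lambda>m\<in>{..<M}. 0) \<in> admissible_inputs M n \<rho>"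
proof -
  assume \<rho>: "0 < \<rho>"
  let ?z = "\<lambda>k\<in>{1..n}. \<lambda>m\<in>{..<M}. (0 :: complex)"
  have z: "?z \<in> space (block_space M n)" by (simp add: block_space_def space_PiM)
  have "(\<integral>\<^sup>+x. ennreal ((L2_set (\<lambda>m. cmod (x k m)) {..<M})\<^sup>2) \<partial>return (block_space M n) ?z) = 0" if k: "k \<in> {1..n}" for k
    by (subst nn_integral_return[OF z block_power_measurable[OF k]]) (use k in \<open>simp add: L2_set_def\<close>)
  then show ?thesis using prob_space_return[OF z] by (simp add: admissible_inputs_def)
qed

text \<open>The operator \<open>lim\<close> yields the limit only if there is one, so bounding the
  terms is not enough: convergence itself has to be proved. The bound \<open>bd\<close> makes the
  suprema finite, and with superadditivity they satisfy the hypotheses of Fekete's lemma.\<close>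

lemma capacity_limit:
  assumes M: "2 \<le> M" and \<sigma>: "0 < \<sigma>c" "0 < \<sigma>r" and \<rho>: "0 < \<rho>"
    and int: "\<And>n P. P \<in> admissible_inputs M n \<rho> \<Longrightarrow> info_integrable M \<sigma>c \<sigma>r n P"
    and bd: "\<And>n P. P \<in> admissible_inputs M n \<rho> \<Longrightarrow> info_nats M \<sigma>c \<sigma>r n P \<le> real n * B"
  shows "\<exists>L. capacity M \<sigma>c \<sigma>r \<rho> = ereal L \<and>
    (\<forall>B'. (\<forall>n P. P \<in> admissible_inputs M n \<rho> \<longrightarrow> info_nats M \<sigma>c \<sigma>r n P \<le> real n * B') \<longrightarrow> L \<le> B' / ln 2)"
proof -
  let ?A = "\<lambda>n. admissible_inputs M n \<rho>" and ?I = "block_information M \<sigma>c \<sigma>r"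
  have ci: "channel_input M n \<sigma>c \<sigma>r P" if "P \<in> ?A n" for n P
    using that \<sigma> by (auto simp: admissible_inputs_def intro: channel_input.intro)
  have eq: "?I n P = info_nats M \<sigma>c \<sigma>r n P / ln 2" if "P \<in> ?A n" for n P
    using channel_input.block_information_eq[OF ci[OF that]] .
  have I0: "0 \<le> ?I n P" if "P \<in> ?A n" for n P
    using channel_input.info_nats_nonneg[OF ci[OF that] M int[OF that]] that by (simp add: eq)
  have Ibd: "?I n P \<le> real n * (B' / ln 2)" if "P \<in> ?A n" "info_nats M \<sigma>c \<sigma>r n P \<le> real n * B'" for n P B'
    using divide_right_mono[OF that(2), of "ln 2"] that by (simp add: eq)
  define s where "s = (\<lambda>n. SUP P\<in>?A n. ereal (?I n P))"
  define a where "a = (\<lambda>n. real_of_ereal (s n))"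
  have ne: "?A n \<noteq> {}" for n using admissible_zero[OF \<rho>] by blast
  have s0: "0 \<le> s n" for n
  proof -
    obtain P where P: "P \<in> ?A n" using ne by blast
    have "0 \<le> ereal (?I n P)" using I0[OF P] by simp
    also have "\<dots> \<le> s n" unfolding s_def by (rule SUP_upper[OF P])
    finally show ?thesis .
  qed
  have sB: "s n \<le> ereal (real n * (B / ln 2))" for n
    unfolding s_def by (rule SUP_least) (use Ibd bd in simp)
  have sa: "s n = ereal (a n)" for n
  proof -
    have "\<bar>s n\<bar> \<noteq> \<infinity>" using s0[of n] sB[of n] by auto
    then show ?thesis by (simp add: a_def ereal_real)
  qed
  have Ia: "?I n P \<le> a n" if "P \<in> ?A n" for n P
  proof -
    have "ereal (?I n P) \<le> s n" unfolding s_def by (rule SUP_upper[OF that])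
    then show ?thesis by (simp add: sa)
  qed
  have a_least: "a n \<le> t" if "\<And>P. P \<in> ?A n \<Longrightarrow> ?I n P \<le> t" for n t
  proof -
    have "s n \<le> ereal t" unfolding s_def by (rule SUP_least) (use that in simp)
    then show ?thesis by (simp add: sa)
  qed
  have sup: "a n + a m \<le> a (n + m)" for n m
  proof -
    have step: "?I n P1 + ?I m P2 \<le> a (n + m)" if P1: "P1 \<in> ?A n" and P2: "P2 \<in> ?A m" for P1 P2
    proof -
      obtain P where P: "P \<in> ?A (n + m)" "info_nats M \<sigma>c \<sigma>r n P1 + info_nats M \<sigma>c \<sigma>r m P2 \<le> info_nats M \<sigma>c \<sigma>r (n + m) P"
        using info_nats_superadditive[OF M \<sigma> \<rho> int P1 P2] by blast
      have "?I n P1 + ?I m P2 \<le> ?I (n + m) P"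
        using divide_right_mono[OF P(2), of "ln 2"] P1 P2 P(1) by (simp add: eq add_divide_distrib)
      also have "\<dots> \<le> a (n + m)" by (rule Ia[OF P(1)])
      finally show ?thesis .
    qed
    \<comment> \<open>The two suprema are taken one after the other, first over the second input
      with the first one fixed.\<close>
    have "a m \<le> a (n + m) - ?I n P1" if "P1 \<in> ?A n" for P1
      using step[OF that] by (intro a_least) (simp add: algebra_simps)
    then have "a n \<le> a (n + m) - a m" by (intro a_least) (simp add: algebra_simps)
    then show ?thesis by simp
  qed
  obtain L where L: "(\<lambda>n. a n / real n) \<longlonglongrightarrow> L"
    using fekete_superadditive[of a "B / ln 2"] sup s0 sB by (auto simp: sa)
  have "(\<lambda>n. s n / ereal (real n)) \<longlonglongrightarrow> ereal L"
  proof (rule Lim_transform_eventually)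
    show "(\<lambda>n. ereal (a n / real n)) \<longlonglongrightarrow> ereal L" using L by simp
    show "\<forall>\<^sub>F n in sequentially. ereal (a n / real n) = s n / ereal (real n)"
      using eventually_gt_at_top[of 0] by eventually_elim (simp add: sa)
  qed
  then have "capacity M \<sigma>c \<sigma>r \<rho> = ereal L" unfolding capacity_def s_def by (rule limI)
  moreover have "L \<le> B' / ln 2" if B': "\<forall>n P. P \<in> ?A n \<longrightarrow> info_nats M \<sigma>c \<sigma>r n P \<le> real n * B'" for B'
  proof (rule LIMSEQ_le_const2[OF L], intro exI[of _ 1] allI impI)
    fix n :: nat assume n: "1 \<le> n"
    have "a n \<le> real n * (B' / ln 2)" by (rule a_least) (use Ibd B' in blast)
    then show "a n / real n \<le> B' / ln 2" using n by (simp add: field_simps)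
  qed
  ultimately show ?thesis by blast
qed

text \<open>The joint density with respect to Lebesgue measure on the plane is a product that
  vanishes off the square of side \<open>2 * pi\<close>. Under the joint law almost every point lies
  in the square, where the logarithm of the product splits into bounded terms.\<close>

lemma entropy_increments:
  assumes \<Omega>: "prob_space \<Omega>" and ind: "prob_space.indep_var \<Omega> borel X borel Y"
    and fm [measurable]: "f \<in> borel_measurable borel" "g \<in> borel_measurable borel" and lo: "0 < lo"
    and f: "\<And>t. lo \<le> f t" "\<And>t. f t \<le> hi" "distr \<Omega> borel X = density circle_lborel (\<lambda>t. ennreal (f t))"
    and g: "\<And>t. lo \<le> g t" "\<And>t. g t \<le> hi" "distr \<Omega> borel Y = density circle_lborel (\<lambda>t. ennreal (g t))"
  shows "prob_space.entropy \<Omega> 2 (lborel \<Otimes>\<^sub>M lborel) (\<lambda>\<omega>. (X \<omega>, Y \<omega>)) =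
    - ((\<integral>t. ln (f t) \<partial>distr \<Omega> borel X) + (\<integral>t. ln (g t) \<partial>distr \<Omega> borel Y)) / ln 2"
proof -
  interpret \<Omega>: prob_space \<Omega> by fact
  have X: "\<Omega>.random_variable borel X" and Y: "\<Omega>.random_variable borel Y"
    using \<Omega>.indep_var_rv1[OF ind] \<Omega>.indep_var_rv2[OF ind] by auto
  let ?X = "distr \<Omega> borel X" and ?Y = "distr \<Omega> borel Y" and ?L = "lborel \<Otimes>\<^sub>M lborel :: (real \<times> real) measure"
  interpret X: prob_space ?X by (rule \<Omega>.prob_space_distr[OF X])
  interpret Y: prob_space ?Y by (rule \<Omega>.prob_space_distr[OF Y])
  interpret XY: pair_prob_space ?X ?Y ..
  have fpos: "0 < f t" "0 < g t" for t using f(1)[of t] g(1)[of t] lo by linarith+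
  define F where "F = (\<lambda>t. indicator {-pi..<pi} t * f t)"
  define G where "G = (\<lambda>t. indicator {-pi..<pi} t * g t)"
  have [measurable]: "F \<in> borel_measurable borel" "G \<in> borel_measurable borel" unfolding F_def G_def by measurable
  have F0: "0 \<le> F t" "0 \<le> G t" for t using fpos[of t] by (auto simp: F_def G_def)
  have dX: "?X = density lborel (\<lambda>t. ennreal (F t))"
    unfolding f(3) circle_lborel_def F_def
    by (subst density_density_eq) (auto intro!: density_cong simp: indicator_def)
  have dY: "?Y = density lborel (\<lambda>t. ennreal (G t))"
    unfolding g(3) circle_lborel_def G_def
    by (subst density_density_eq) (auto intro!: density_cong simp: indicator_def)
  let ?FG = "\<lambda>p. F (fst p) * G (snd p)"
  have "distr \<Omega> ?L (\<lambda>\<omega>. (X \<omega>, Y \<omega>)) = distr \<Omega> (borel \<Otimes>\<^sub>M borel) (\<lambda>\<omega>. (X \<omega>, Y \<omega>))"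
    by (rule distr_cong) (auto intro!: sets_pair_measure_cong)
  also have "\<dots> = ?X \<Otimes>\<^sub>M ?Y"
    using \<Omega>.indep_var_distribution_eq[of borel X borel Y] ind by simp
  finally have joint: "distr \<Omega> ?L (\<lambda>\<omega>. (X \<omega>, Y \<omega>)) = ?X \<Otimes>\<^sub>M ?Y" .
  have "density lborel (\<lambda>t. ennreal (F t)) \<Otimes>\<^sub>M density lborel (\<lambda>t. ennreal (G t)) = density ?L (\<lambda>(x, y). ennreal (F x) * ennreal (G y))"
    by (intro pair_measure_density) (auto simp flip: dY intro: lborel.sigma_finite_measure_axioms Y.sigma_finite_measure_axioms)
  also have "\<dots> = density ?L (\<lambda>p. ennreal (?FG p))"
    using F0 by (intro arg_cong[where f = "density _"]) (auto simp: fun_eq_iff ennreal_mult')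
  finally have dXY: "?X \<Otimes>\<^sub>M ?Y = density ?L (\<lambda>p. ennreal (?FG p))" by (simp only: dX dY)
  have Lsf: "sigma_finite_measure ?L" by (rule lborel_pair.sigma_finite_measure_axioms)
  have "\<Omega>.entropy 2 ?L (\<lambda>\<omega>. (X \<omega>, Y \<omega>)) = - KL_divergence 2 ?L (density ?L (\<lambda>p. ennreal (?FG p)))"
    unfolding \<Omega>.entropy_def joint dXY ..
  also have "KL_divergence 2 ?L (density ?L (\<lambda>p. ennreal (?FG p))) = (\<integral>p. ?FG p * log 2 (?FG p) \<partial>?L)"
    by (rule sigma_finite_measure.KL_density[OF Lsf]) (use F0 in auto)
  also have "\<dots> = (\<integral>p. log 2 (?FG p) \<partial>density ?L (\<lambda>p. ennreal (?FG p)))"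
    by (subst integral_density) (use F0 in auto)
  also have "\<dots> = (\<integral>p. (ln (f (fst p)) + ln (g (snd p))) / ln 2 \<partial>density ?L (\<lambda>p. ennreal (?FG p)))"
  proof (rule integral_cong_AE)
    show "AE p in density ?L (\<lambda>p. ennreal (?FG p)). log 2 (?FG p) = (ln (f (fst p)) + ln (g (snd p))) / ln 2"
    proof (subst AE_density, simp, rule AE_I2, rule impI)
      fix p assume "0 < ennreal (?FG p)"
      then have "?FG p \<noteq> 0" by auto
      then have "fst p \<in> {-pi..<pi}" "snd p \<in> {-pi..<pi}" by (auto simp: F_def G_def indicator_def split: if_splits)
      then have "?FG p = f (fst p) * g (snd p)" by (simp add: F_def G_def)
      then show "log 2 (?FG p) = (ln (f (fst p)) + ln (g (snd p))) / ln 2"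
        using fpos[of "fst p"] fpos[of "snd p"] by (simp add: log_def ln_mult)
    qed
  qed measurable
  also have "\<dots> = (\<integral>p. ln (f (fst p)) + ln (g (snd p)) \<partial>(?X \<Otimes>\<^sub>M ?Y)) / ln 2"
    by (simp only: dXY Bochner_Integration.integral_divide_zero)
  also have "(\<integral>p. ln (f (fst p)) + ln (g (snd p)) \<partial>(?X \<Otimes>\<^sub>M ?Y)) = (\<integral>t. ln (f t) \<partial>?X) + (\<integral>t. ln (g t) \<partial>?Y)"
  proof -
    let ?B = "\<bar>ln lo\<bar> + \<bar>ln hi\<bar>"
    have b: "\<bar>ln (f t)\<bar> \<le> ?B" "\<bar>ln (g t)\<bar> \<le> ?B" for t
    proof -
      have "ln lo \<le> ln (f t)" "ln (f t) \<le> ln hi" "ln lo \<le> ln (g t)" "ln (g t) \<le> ln hi"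
        using f(1,2)[of t] g(1,2)[of t] lo fpos[of t] by (simp_all add: ln_le_cancel_iff)
      then show "\<bar>ln (f t)\<bar> \<le> ?B" "\<bar>ln (g t)\<bar> \<le> ?B" by linarith+
    qed
    have i1: "integrable (?X \<Otimes>\<^sub>M ?Y) (\<lambda>p. ln (f (fst p)))" and i2: "integrable (?X \<Otimes>\<^sub>M ?Y) (\<lambda>p. ln (g (snd p)))"
      using b by (auto intro!: XY.integrable_const_bound[of _ ?B])
    have "(\<integral>p. ln (f (fst p)) \<partial>(?X \<Otimes>\<^sub>M ?Y)) = (\<integral>t. ln (f t) \<partial>?X)"
      using XY.integral_fst'[OF i1] Y.prob_space by simp
    moreover have "(\<integral>p. ln (g (snd p)) \<partial>(?X \<Otimes>\<^sub>M ?Y)) = (\<integral>t. ln (g t) \<partial>?Y)"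
      using XY.integral_fst'[OF i2] X.prob_space by simp
    ultimately show ?thesis using i1 i2 by simp
  qed
  finally show ?thesis by (simp only: minus_divide_left)
qed

theorem theorem3:
  fixes M :: nat and \<sigma>c \<sigma>r :: real
    and \<Omega> :: "'a measure" and \<Delta>c \<Delta>r :: "'a \<Rightarrow> real"
  assumes "2 \<le> M" and "0 < \<sigma>c" and "0 < \<sigma>r"
    and "prob_space \<Omega>"
    and "prob_space.indep_var \<Omega> borel \<Delta>c borel \<Delta>r"
    and "distr \<Omega> borel \<Delta>c = wrapped_normal \<sigma>c"
    and "distr \<Omega> borel \<Delta>r = wrapped_normal \<sigma>r"
  shows "\<exists>\<epsilon>. (\<epsilon> \<longlongrightarrow> (0::real)) at_top \<and>
    (\<forall>\<rho>>0. capacity M \<sigma>c \<sigma>r \<rho> \<le>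
       ereal (real (M - 1) * log 2 (\<rho> / real (M - 1)) + 2 * log 2 pi
         - prob_space.entropy \<Omega> 2 (lborel \<Otimes>\<^sub>M lborel) (\<lambda>\<omega>. (\<Delta>c \<omega>, \<Delta>r \<omega>)) + \<epsilon> \<rho>))"
proof -
  note M = assms(1) and \<sigma> = assms(2,3)
  obtain fc lc hc where fc: "fc \<in> borel_measurable borel" "0 < lc" "\<And>\<theta>. lc \<le> fc \<theta>" "\<And>\<theta>. fc \<theta> \<le> hc"
    "wrapped_normal \<sigma>c = density circle_lborel (\<lambda>\<theta>. ennreal (fc \<theta>))"
    using wrapped_normal_has_density[OF \<sigma>(1)] by metis
  obtain fr lr hr where fr: "fr \<in> borel_measurable borel" "0 < lr" "\<And>\<theta>. lr \<le> fr \<theta>" "\<And>\<theta>. fr \<theta> \<le> hr"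
    "wrapped_normal \<sigma>r = density circle_lborel (\<lambda>\<theta>. ennreal (fr \<theta>))"
    using wrapped_normal_has_density[OF \<sigma>(2)] by metis
  define lo where "lo = min lc lr"
  define hi where "hi = max hc hr"
  have lo: "0 < lo" using fc fr by (simp add: lo_def)
  have bc: "lo \<le> fc t" "fc t \<le> hi" and br: "lo \<le> fr t" "fr t \<le> hi" for t
    using fc(3,4)[of t] fr(3,4)[of t] by (auto simp: lo_def hi_def min_le_iff_disj le_max_iff_disj)
  define h where "h = (\<integral>t. ln (fc t) \<partial>wrapped_normal \<sigma>c) + (\<integral>t. ln (fr t) \<partial>wrapped_normal \<sigma>r)"
  have ent: "prob_space.entropy \<Omega> 2 (lborel \<Otimes>\<^sub>M lborel) (\<lambda>\<omega>. (\<Delta>c \<omega>, \<Delta>r \<omega>)) = - h / ln 2"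
    using entropy_increments[OF assms(4,5) fc(1) fr(1) lo bc _ br] fc(5) fr(5) by (simp add: assms(6,7) h_def)
  define main where "main = (\<lambda>\<rho>. real (M - 1) * log 2 (\<rho> / real (M - 1)) + 2 * log 2 pi + h / ln 2)"
  define \<delta> where "\<delta> = (\<lambda>e C \<rho>. e * (real M + 3) + 2 * ln (1 + C / sqrt (\<rho> / real (M - 1))) + real M * (1 + 1 / e) / (\<rho> / real (M - 1)))"
  have rb: "rate_bound M h e C \<rho> / ln 2 = main \<rho> + \<delta> e C \<rho> / ln 2" for e C \<rho>
    by (simp add: rate_bound_def main_def \<delta>_def log_def add_divide_distrib)
  have bound: "\<exists>C\<ge>0. \<forall>\<rho>>0. \<exists>L. capacity M \<sigma>c \<sigma>r \<rho> = ereal L \<and> L \<le> main \<rho> + \<delta> e C \<rho> / ln 2" if e: "0 < e" for e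
  proof -
    obtain C where C: "0 \<le> C" and CB: "\<And>n \<rho> P. 0 < \<rho> \<Longrightarrow> P \<in> admissible_inputs M n \<rho> \<Longrightarrow>
      info_integrable M \<sigma>c \<sigma>r n P \<and>
      info_nats M \<sigma>c \<sigma>r n P \<le> real n * rate_bound M h e C \<rho>"
      using information_rate_bound[OF M \<sigma> lo fc(1) fr(1) bc fc(5) br fr(5) e] unfolding h_def by blast
    show ?thesis
    proof (rule exI[of _ C], intro conjI C allI impI)
      fix \<rho> :: real assume \<rho>: "0 < \<rho>"
      obtain L where L: "capacity M \<sigma>c \<sigma>r \<rho> = ereal L"
        "\<And>B'. \<forall>n P. P \<in> admissible_inputs M n \<rho> \<longrightarrow> info_nats M \<sigma>c \<sigma>r n P \<le> real n * B' \<Longrightarrow> L \<le> B' / ln 2"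
        using capacity_limit[OF M \<sigma> \<rho>, of "rate_bound M h e C \<rho>"] CB[OF \<rho>] by blast
      have "L \<le> rate_bound M h e C \<rho> / ln 2" by (rule L(2)) (use CB[OF \<rho>] in blast)
      then show "\<exists>L. capacity M \<sigma>c \<sigma>r \<rho> = ereal L \<and> L \<le> main \<rho> + \<delta> e C \<rho> / ln 2" using L(1) by (auto simp: rb)
    qed
  qed
  \<comment> \<open>The least nonnegative remainder. It does not mention \<open>e\<close>, so the
    error bounds for all \<open>e\<close> apply to one and the same function. The truncation at 0 is
    needed because the capacity is bounded from one side only.\<close>
  define \<epsilon> where "\<epsilon> = (\<lambda>\<rho>. max 0 (real_of_ereal (capacity M \<sigma>c \<sigma>r \<rho>) - main \<rho>))"
  have lim\<delta>: "(\<delta> e C \<longlongrightarrow> e * (real M + 3)) at_top" for e C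
  proof -
    have M1: "0 < real (M - 1)" using M by simp
    have f1: "filterlim (\<lambda>\<rho>. \<rho> / real (M - 1)) at_top at_top"
      using filterlim_tendsto_pos_mult_at_top[OF tendsto_const[of "inverse (real (M - 1))"] _ filterlim_ident] M1
      by (simp add: divide_inverse mult.commute)
    have f2: "filterlim (\<lambda>\<rho>. sqrt (\<rho> / real (M - 1))) at_top at_top"
      by (rule filterlim_compose[OF sqrt_at_top f1])
    have "((\<lambda>\<rho>. C / sqrt (\<rho> / real (M - 1))) \<longlongrightarrow> 0) at_top"
      by (rule tendsto_divide_0[OF tendsto_const filterlim_at_top_imp_at_infinity[OF f2]])
    then have "((\<lambda>\<rho>. ln (1 + C / sqrt (\<rho> / real (M - 1)))) \<longlongrightarrow> ln (1 + 0)) at_top"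
      by (intro tendsto_ln tendsto_add tendsto_const) auto
    moreover have "((\<lambda>\<rho>. real M * (1 + 1 / e) / (\<rho> / real (M - 1))) \<longlongrightarrow> 0) at_top"
      by (rule tendsto_divide_0[OF tendsto_const filterlim_at_top_imp_at_infinity[OF f1]])
    ultimately have "(\<delta> e C \<longlongrightarrow> e * (real M + 3) + 2 * ln (1 + 0) + 0) at_top"
      unfolding \<delta>_def by (intro tendsto_add tendsto_mult tendsto_const)
    then show ?thesis by simp
  qed
  have "(\<epsilon> \<longlongrightarrow> 0) at_top"
  proof (rule tendstoI)
    fix r :: real assume r: "0 < r"
    \<comment> \<open>Then the limit \<open>e * (M + 3) / ln 2\<close> of the error is
      \<open>r / 2\<close>, and the other half of \<open>r\<close> absorbs the distance from that
      limit.\<close>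
    define e where "e = r * ln 2 / (2 * (real M + 3))"
    have e: "0 < e" using r by (simp add: e_def)
    obtain C where C: "\<forall>\<rho>>0. \<exists>L. capacity M \<sigma>c \<sigma>r \<rho> = ereal L \<and> L \<le> main \<rho> + \<delta> e C \<rho> / ln 2"
      using bound[OF e] by blast
    have "e * (real M + 3) = r * ln 2 / 2"
    proof -
      have "r * ln 2 / (2 * c) * c = r * ln 2 / 2" if "c \<noteq> 0" for c :: real
        using that by simp
      from this[of "real M + 3"] show ?thesis unfolding e_def by linarith
    qed
    moreover have "0 < r * ln 2" using r by simp
    ultimately have "e * (real M + 3) < r * ln 2" by linarith
    from order_tendstoD(2)[OF lim\<delta> this, of C] eventually_gt_at_top[of 0]
    show "\<forall>\<^sub>F \<rho> in at_top. dist (\<epsilon> \<rho>) 0 < r"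
    proof eventually_elim
      case (elim \<rho>)
      obtain L where L: "capacity M \<sigma>c \<sigma>r \<rho> = ereal L" "L \<le> main \<rho> + \<delta> e C \<rho> / ln 2" using C elim(2) by blast
      have "\<delta> e C \<rho> / ln 2 < r" using elim(1) by (simp add: field_simps)
      then have "L - main \<rho> < r" using L(2) by linarith
      then show ?case using r by (simp add: \<epsilon>_def L(1) dist_real_def)
    qed
  qed
  moreover have "capacity M \<sigma>c \<sigma>r \<rho> \<le> ereal (real (M - 1) * log 2 (\<rho> / real (M - 1)) + 2 * log 2 pi
         - prob_space.entropy \<Omega> 2 (lborel \<Otimes>\<^sub>M lborel) (\<lambda>\<omega>. (\<Delta>c \<omega>, \<Delta>r \<omega>)) + \<epsilon> \<rho>)" if \<rho>: "0 < \<rho>" for \<rho>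
  proof -
    \<comment> \<open>Any positive tolerance shows that the capacity is finite, so that
      \<open>real_of_ereal\<close> in \<open>\<epsilon>\<close> returns its true value.\<close>
    obtain L where L: "capacity M \<sigma>c \<sigma>r \<rho> = ereal L" using bound[of 1] \<rho> by force
    have "L \<le> main \<rho> + \<epsilon> \<rho>" by (simp add: \<epsilon>_def L)
    then show ?thesis by (simp add: L ent main_def)
  qed
  ultimately show ?thesis by blast
qed

end
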